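(* Let $f\in C_b^2(H)$ and let $(P_t)$ be the Ornstein--Uhlenbeck semigroup on $H$. The following statements hold: (i) for any $x\in D(A)$, the real mapping $t\mapsto\mathcal{L}_0(P_tf)(x)$ is continuous on $[0,+\infty)$ and $\lim_{t\to0^+}\mathcal{L}_0(P_tf)(x)=\mathcal{L}_0f(x)$. Moreover, $$P_tf(x)=f(x)+\int_0^t\mathcal{L}_0(P_sf)(x)\,ds,\qquad t\ge0,\ x\in D(A);$$ (ii) if in addition $f\in C_A^2(H)$, then all the assertions of (i) (continuity, limit at $0^+$, and the integral formula) hold for any $x\in H$.
   Context: Let $H$ be a real separable Hilbert space with inner product $\langle\cdot,\cdot\rangle$ and norm $|\cdot|$, and $L_2(H)$ the Hilbert space of Hilbert--Schmidt operators on $H$. Let $Q:H\to H$ be a non-negative symmetric trace-class operator, $a\in H$, and $\nu$ a $\sigma$-finite Borel measure on $H$ with $\nu(\{0\})=0$ and $\int_H(1\wedge|y|^2)\,\nu(dy)<\infty$. Let $Z=(Z_t)_{t\ge0}$ be an $H$-valued Lévy process with $\mathbb{E}[e^{i\langle Z_t,h\rangle}]=e^{-t\psi(h)}$, where $$\psi(h)=\tfrac12\langle Qh,h\rangle-i\langle a,h\rangle-\int_H\big(e^{i\langle h,y\rangle}-1-i\langle h,y\rangle\mathbf{1}_{\{|y|\le1\}}\big)\,\nu(dy),\quad h\in H.$$ Let $A:D(A)\subset H\to H$ generate a $C_0$-semigroup $(e^{tA})$ on $H$, with adjoint $A^*:D(A^* )\subset H\to H$, which generates $(e^{tA^*})$.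 Put $X_t^x=e^{tA}x+Y_t$, $Y_t=\int_0^te^{(t-s)A}\,dZ_s$. The law $\mu_t$ of $Y_t$ is the Borel probability measure on $H$ with characteristic function $\hat\mu_t(h)=\exp\big(-\int_0^t\psi(e^{sA^*}h)\,ds\big)$, $h\in H$. The Ornstein--Uhlenbeck semigroup is, for $f:H\to\mathbb{R}$ bounded and Borel, $$P_tf(x)=\mathbb{E}[f(X_t^x)]=\int_Hf(e^{tA}x+y)\,\mu_t(dy),\quad t\ge0,\ x\in H.$$ $C_b^2(H)$ is the space of bounded continuous $f:H\to\mathbb{R}$, twice Fréchet differentiable on $H$, with $Df:H\to H$ bounded and continuous, $D^2f(x)\in L_2(H)$ for all $x\in H$, and $D^2f:H\to L_2(H)$ bounded and continuous. Further, $$C_A^2(H)=\{f\in C_b^2(H):\ Df(x)\in D(A^* )\ \text{for all }x\in H,\ \text{and } A^*Df:H\to H\text{ is bounded and continuous}\}.$$ For $f\in C_b^2(H)$ set $$\mathcal{L}_1f(x)=\int_H\big(f(x+y)-f(x)-\mathbf{1}_{\{|y|\le1\}}\langle y,Df(x)\rangle\big)\,\nu(dy)+\tfrac12\mathrm{Tr}(QD^2f(x))+\langle a,Df(x)\rangle,\quad x\in H,$$ and $\mathcal{L}_0f(x)=\langle Ax,Df(x)\rangle+\mathcal{L}_1f(x)$ for $x\in D(A)$. If $f\in C_A^2(H)$, then $\mathcal{L}_0f$ is defined on all of $H$ by $\mathcal{L}_0f(x)=\langle x,A^*Df(x)\rangle+\mathcal{L}_1f(x)$, $x\in H$. The semigroup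 $P_t$ maps $C_b^2(H)$ into itself and $C_A^2(H)$ into itself, so $\mathcal{L}_0(P_tf)$ makes sense. *)

theory Defs
  imports "HOL-Probability.Probability"
begin

text \<open>The real separable Hilbert space \<open>H\<close> is a type of sort
  \<open>{real_inner, banach, second_countable_topology}\<close>.\<close>

section \<open>Hilbert--Schmidt and trace-class operators\<close>

definition orthonormal_basis :: "'h::real_inner set \<Rightarrow> bool" where
  "orthonormal_basis B \<longleftrightarrow>
     (\<forall>e\<in>B. norm e = 1) \<and> pairwise orthogonal B \<and> closure (span B) = UNIV"

lemma extend_orthonormal:
  fixes v :: "'h::real_inner"
  assumes fin: "finite B" and n1: "\<forall>e\<in>B. norm e = 1" and po: "pairwise orthogonal B"
  shows "\<exists>B'. finite B' \<and> (\<forall>e\<in>B'. norm e = 1) \<and> pairwise orthogonal B' \<and> B \<subseteq> B' \<and> v \<in> span B'"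
proof -
  define p where "p = (\<Sum>e\<in>B. inner v e *\<^sub>R e)"
  define r where "r = v - p"
  have p: "p \<in> span B"
    unfolding p_def by (intro span_sum span_scale span_base)
  have orth: "inner r e = 0" if "e \<in> B" for e
  proof -
    have "inner p e = (\<Sum>d\<in>B. inner v d * inner d e)"
      unfolding p_def by (simp add: inner_sum_left)
    also have "\<dots> = (\<Sum>d\<in>B. if d = e then inner v e else 0)"
      using po n1 that by (intro sum.cong) (auto simp: pairwise_def orthogonal_def norm_eq_1)
    also have "\<dots> = inner v e"
      using fin that by simp
    finally show ?thesis by (simp add: r_def inner_diff_left)
  qed
  show ?thesis
  proof (cases "r = 0")
    case True
    then have "v \<in> span B" using p by (simp add: r_def)
    then show ?thesis using fin n1 po by blast
  next
    case False
    define B' where "B' = insert (r /\<^sub>R norm r) B"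
    have "r /\<^sub>R norm r \<in> span B'" "p \<in> span B'"
      using p span_mono[of B B'] by (auto simp: B'_def intro: span_base)
    then have "norm r *\<^sub>R (r /\<^sub>R norm r) + p \<in> span B'"
      by (blast intro: span_add span_scale)
    moreover have "norm r *\<^sub>R (r /\<^sub>R norm r) + p = v"
      using False by (simp add: r_def)
    ultimately have "v \<in> span B'" by simp
    moreover have "pairwise orthogonal B'"
      unfolding B'_def pairwise_insert using po orth
      by (auto simp: orthogonal_def inner_commute)
    moreover have "finite B'" "\<forall>e\<in>B'. norm e = 1" "B \<subseteq> B'"
      using fin n1 False by (auto simp: B'_def)
    ultimately show ?thesis by blast
  qed
qed

lemma orthonormal_basis_exists:
  "\<exists>B :: 'h::{real_inner, second_countable_topology} set. orthonormal_basis B"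
proof -
  obtain D :: "'h set" where D: "countable D" "\<And>X. open X \<Longrightarrow> X \<noteq> {} \<Longrightarrow> \<exists>d\<in>D. d \<in> X"
    using countable_dense_setE by blast
  have "D \<noteq> {}" using D(2)[of UNIV] by auto
  then obtain d :: "nat \<Rightarrow> 'h" where d: "range d = D"
    using D(1) by (metis range_from_nat_into)
  define P where "P = (\<lambda>B :: 'h set. finite B \<and> (\<forall>e\<in>B. norm e = 1) \<and> pairwise orthogonal B)"
  have "\<exists>F. \<forall>n. P (F n) \<and> (F n \<subseteq> F (Suc n) \<and> d n \<in> span (F (Suc n)))"
  proof (rule dependent_nat_choice)
    show "\<exists>B. P B" by (rule exI[of _ "{}"]) (simp add: P_def)
  next
    fix B n assume "P B"
    then show "\<exists>B'. P B' \<and> B \<subseteq> B' \<and> d n \<in> span B'"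
      using extend_orthonormal[of B "d n"] unfolding P_def by blast
  qed
  then obtain F where F: "\<And>n. P (F n)" "\<And>n. F n \<subseteq> F (Suc n)" "\<And>n. d n \<in> span (F (Suc n))"
    by blast
  define B where "B = (\<Union>n. F n)"
  have mono: "F m \<subseteq> F n" if "m \<le> n" for m n
    using lift_Suc_mono_le[of F, OF F(2) that] .
  have "pairwise orthogonal B"
    unfolding pairwise_def
  proof (intro ballI impI)
    fix x y assume "x \<in> B" "y \<in> B" "x \<noteq> y"
    then obtain m n where "x \<in> F m" "y \<in> F n" by (auto simp: B_def)
    then have "x \<in> F (max m n)" "y \<in> F (max m n)"
      using mono[of m "max m n"] mono[of n "max m n"] by auto
    with F(1)[of "max m n"] \<open>x \<noteq> y\<close> show "orthogonal x y"
      by (auto simp: P_def pairwise_def)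
  qed
  moreover have "\<forall>e\<in>B. norm e = 1" using F(1) by (auto simp: B_def P_def)
  moreover have "closure (span B) = UNIV"
  proof -
    have "d n \<in> span B" for n
      using F(3)[of n] span_mono[of "F (Suc n)" B] by (auto simp: B_def)
    then have "D \<subseteq> span B" using d by auto
    moreover have "closure D = UNIV"
    proof (rule ccontr)
      assume "closure D \<noteq> UNIV"
      then obtain z where "z \<in> D" "z \<in> - closure D"
        using D(2)[of "- closure D"] by auto
      then show False using closure_subset by auto
    qed
    ultimately show ?thesis using closure_mono by blast
  qed
  ultimately show ?thesis unfolding orthonormal_basis_def by blast
qed

text \<open>A fixed orthonormal basis. The notions defined from it below do not depend on the choice.\<close>

definition hbasis :: "'h::{real_inner, second_countable_topology} set" where
  "hbasis = (SOME B. orthonormal_basis B)"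

lemma orthonormal_basis_hbasis: "orthonormal_basis hbasis"
  unfolding hbasis_def by (rule someI_ex[OF orthonormal_basis_exists])

definition hilbert_schmidt :: "('h::{real_inner, second_countable_topology} \<Rightarrow> 'h) \<Rightarrow> bool" where
  "hilbert_schmidt T \<longleftrightarrow> bounded_linear T \<and> (\<lambda>e. (norm (T e))\<^sup>2) summable_on hbasis"

definition hs_norm :: "('h::{real_inner, second_countable_topology} \<Rightarrow> 'h) \<Rightarrow> real" where
  "hs_norm T = sqrt (\<Sum>\<^sub>\<infinity>e\<in>hbasis. (norm (T e))\<^sup>2)"

text \<open>Trace class in the sense of nuclear operators:
  \<open>T x = (\<Sum>k. \<langle>a k, x\<rangle> b k)\<close> with \<open>(\<Sum>k. |a k| |b k|) < \<infinity>\<close>.\<close>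

definition trace_class :: "('h::real_inner \<Rightarrow> 'h) \<Rightarrow> bool" where
  "trace_class T \<longleftrightarrow> bounded_linear T \<and>
     (\<exists>a b :: nat \<Rightarrow> 'h. summable (\<lambda>k. norm (a k) * norm (b k)) \<and>
        (\<forall>x. (\<lambda>k. inner (a k) x *\<^sub>R b k) sums T x))"

definition op_trace :: "('h::{real_inner, second_countable_topology} \<Rightarrow> 'h) \<Rightarrow> real" where
  "op_trace T = (\<Sum>\<^sub>\<infinity>e\<in>hbasis. inner (T e) e)"


section \<open>Semigroup generators and adjoints\<close>

definition c0_semigroup :: "(real \<Rightarrow> 'h::real_normed_vector \<Rightarrow> 'h) \<Rightarrow> bool" where
  "c0_semigroup T \<longleftrightarrow>
     (\<forall>t\<ge>0. bounded_linear (T t)) \<and> (\<forall>x. T 0 x = x) \<and>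
     (\<forall>s\<ge>0. \<forall>t\<ge>0. \<forall>x. T (s + t) x = T s (T t x)) \<and>
     (\<forall>x. ((\<lambda>t. T t x) \<longlongrightarrow> x) (at_right 0))"

text \<open>An unbounded operator is a domain \<open>DA\<close> together with a function \<open>A\<close> that is
  relevant only on \<open>DA\<close>; \<open>T t\<close> plays the role of \<open>e\<^sup>t\<^sup>A\<close>.\<close>

definition generates ::
  "'h::real_normed_vector set \<Rightarrow> ('h \<Rightarrow> 'h) \<Rightarrow> (real \<Rightarrow> 'h \<Rightarrow> 'h) \<Rightarrow> bool" where
  "generates DA A T \<longleftrightarrow> c0_semigroup T \<and>
     DA = {x. \<exists>y. ((\<lambda>t. (T t x - x) /\<^sub>R t) \<longlongrightarrow> y) (at_right 0)} \<and>
     (\<forall>x\<in>DA. ((\<lambda>t. (T t x - x) /\<^sub>R t) \<longlongrightarrow> A x) (at_right 0))"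

definition adj_dom :: "'h::real_inner set \<Rightarrow> ('h \<Rightarrow> 'h) \<Rightarrow> 'h set" where
  "adj_dom DA A = {z. \<exists>w. \<forall>x\<in>DA. inner (A x) z = inner x w}"

definition adj_op :: "'h::real_inner set \<Rightarrow> ('h \<Rightarrow> 'h) \<Rightarrow> 'h \<Rightarrow> 'h" where
  "adj_op DA A z = (THE w. \<forall>x\<in>DA. inner (A x) z = inner x w)"


section \<open>Function spaces\<close>

definition grad :: "('h::real_inner \<Rightarrow> real) \<Rightarrow> 'h \<Rightarrow> 'h" where
  "grad f x = (THE g. GDERIV f x :> g)"

definition hess :: "('h::real_inner \<Rightarrow> real) \<Rightarrow> 'h \<Rightarrow> 'h \<Rightarrow> 'h" where
  "hess f x = frechet_derivative (grad f) (at x)"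

definition Cb2 :: "('h::{real_inner, banach, second_countable_topology} \<Rightarrow> real) set" where
  "Cb2 = {f.
     continuous_on UNIV f \<and> bounded (range f) \<and>
     (\<forall>x. \<exists>g. GDERIV f x :> g) \<and>
     continuous_on UNIV (grad f) \<and> bounded (range (grad f)) \<and>
     (\<forall>x. grad f differentiable (at x)) \<and>
     (\<forall>x. hilbert_schmidt (hess f x)) \<and>
     (\<exists>C. \<forall>x. hs_norm (hess f x) \<le> C) \<and>
     (\<forall>x. ((\<lambda>y. hs_norm (\<lambda>h. hess f y h - hess f x h)) \<longlongrightarrow> 0) (at x))}"

definition CA2 ::
  "'h::{real_inner, banach, second_countable_topology} set \<Rightarrow> ('h \<Rightarrow> 'h) \<Rightarrow> ('h \<Rightarrow> real) set" where
  "CA2 DA A = {f \<in> Cb2.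
     (\<forall>x. grad f x \<in> adj_dom DA A) \<and>
     continuous_on UNIV (\<lambda>x. adj_op DA A (grad f x)) \<and>
     bounded (range (\<lambda>x. adj_op DA A (grad f x)))}"


section \<open>Levy processes and the Ornstein--Uhlenbeck semigroup\<close>

definition levy_process ::
  "'w measure \<Rightarrow> (real \<Rightarrow> 'w \<Rightarrow> 'h::{real_normed_vector, second_countable_topology}) \<Rightarrow> bool" where
  "levy_process M Z \<longleftrightarrow>
     prob_space M \<and>
     (\<forall>t\<ge>0. Z t \<in> borel_measurable M) \<and>
     (AE \<omega> in M. Z 0 \<omega> = 0) \<and>
     (\<forall>(n::nat) p. 0 \<le> p 0 \<and> (\<forall>i<n. p i < p (Suc i)) \<longrightarrow>
        prob_space.indep_vars M (\<lambda>_. borel) (\<lambda>i \<omega>. Z (p (Suc i)) \<omega> - Z (p i) \<omega>) {..<n}) \<and>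
     (\<forall>s\<ge>0. \<forall>t\<ge>0. distr M borel (\<lambda>\<omega>. Z (s + t) \<omega> - Z s \<omega>) = distr M borel (Z t)) \<and>
     (\<forall>t\<ge>0. \<forall>\<epsilon>>0. ((\<lambda>s. measure M {\<omega>\<in>space M. norm (Z s \<omega> - Z t \<omega>) > \<epsilon>}) \<longlongrightarrow> 0)
        (at t within {0..}))"

definition levy_exponent ::
  "('h::{real_inner, banach, second_countable_topology} \<Rightarrow> 'h) \<Rightarrow> 'h \<Rightarrow> 'h measure \<Rightarrow> 'h \<Rightarrow> complex"
  where
  "levy_exponent Q a \<nu> h =
     of_real (inner (Q h) h / 2) - \<i> * of_real (inner a h)
     - (\<integral>y. (exp (\<i> * of_real (inner h y)) - 1
            - \<i> * of_real (inner h y * indicator (cball 0 1) y)) \<partial>\<nu>)"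

text \<open>\<open>Y\<close> is (a version of) the stochastic integral of \<open>s \<mapsto> T (t - s)\<close> over \<open>[0, t]\<close> with
  respect to \<open>Z\<close>: the limit in probability of the Riemann sums as the mesh of the
  partition tends to 0.\<close>

definition stoch_convolution ::
  "'w measure \<Rightarrow> (real \<Rightarrow> 'h \<Rightarrow> 'h) \<Rightarrow> (real \<Rightarrow> 'w \<Rightarrow> 'h) \<Rightarrow> real
     \<Rightarrow> ('w \<Rightarrow> 'h::{real_normed_vector, second_countable_topology}) \<Rightarrow> bool" where
  "stoch_convolution M T Z t Y \<longleftrightarrow> Y \<in> borel_measurable M \<and>
     (\<forall>\<epsilon>>0. \<exists>\<delta>>0. \<forall>(n::nat) p.
        p 0 = 0 \<and> p n = t \<and> (\<forall>i<n. p i < p (Suc i) \<and> p (Suc i) - p i < \<delta>) \<longrightarrow>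
        measure M {\<omega>\<in>space M.
          norm ((\<Sum>i<n. T (t - p i) (Z (p (Suc i)) \<omega> - Z (p i) \<omega>)) - Y \<omega>) > \<epsilon>} < \<epsilon>)"

definition ou_semigroup ::
  "'w measure \<Rightarrow> (real \<Rightarrow> 'h \<Rightarrow> 'h) \<Rightarrow> (real \<Rightarrow> 'w \<Rightarrow> 'h::real_normed_vector)
     \<Rightarrow> real \<Rightarrow> ('h \<Rightarrow> real) \<Rightarrow> 'h \<Rightarrow> real" where
  "ou_semigroup M T Y t f x = (\<integral>\<omega>. f (T t x + Y t \<omega>) \<partial>M)"

definition L1 ::
  "('h::{real_inner, banach, second_countable_topology} \<Rightarrow> 'h) \<Rightarrow> 'h \<Rightarrow> 'h measure
     \<Rightarrow> ('h \<Rightarrow> real) \<Rightarrow> 'h \<Rightarrow> real" where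
  "L1 Q a \<nu> f x =
     (\<integral>y. (f (x + y) - f x - indicator (cball 0 1) y * inner y (grad f x)) \<partial>\<nu>)
     + op_trace (Q \<circ> hess f x) / 2 + inner a (grad f x)"

definition L0 ::
  "('h::{real_inner, banach, second_countable_topology} \<Rightarrow> 'h) \<Rightarrow> ('h \<Rightarrow> 'h) \<Rightarrow> 'h
     \<Rightarrow> 'h measure \<Rightarrow> ('h \<Rightarrow> real) \<Rightarrow> 'h \<Rightarrow> real" where
  "L0 A Q a \<nu> f x = inner (A x) (grad f x) + L1 Q a \<nu> f x"

text \<open>\<open>L0\<close> is meant for \<open>x \<in> D(A)\<close> and \<open>f \<in> Cb2\<close> only; \<open>L0_ext\<close> is its extension to all
  \<open>x\<close> when \<open>f \<in> CA2\<close>.\<close>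

definition L0_ext ::
  "'h::{real_inner, banach, second_countable_topology} set \<Rightarrow> ('h \<Rightarrow> 'h) \<Rightarrow> ('h \<Rightarrow> 'h) \<Rightarrow> 'h
     \<Rightarrow> 'h measure \<Rightarrow> ('h \<Rightarrow> real) \<Rightarrow> 'h \<Rightarrow> real" where
  "L0_ext DA A Q a \<nu> f x = inner x (adj_op DA A (grad f x)) + L1 Q a \<nu> f x"

end

theory Submission
  imports Defs
begin

text \<open>
  For a character \<open>f x = cos (\<langle>x, k\<rangle> + \<theta>)\<close> the formula \<open>P t f x = f x + \<integral>\<^sub>0\<^sup>t L0 (P s f) x ds\<close> is the
  fundamental theorem of calculus for the characteristic function of \<open>Y t\<close>, which is read off the
  Riemann sums defining the stochastic convolution. Written as an expectation of the 2-jet of \<open>f\<close>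
  along the flow, \<open>L0 (P s f) x\<close> is linear in \<open>f\<close> and stable under bounded pointwise limits of 2-jets,
  and characters generate all bounded \<open>C\<^sup>2\<close> functions in this sense: first make \<open>f\<close> depend
  periodically on finitely many coordinates, then use trigonometric kernels, one coordinate at a time.

  The formula at \<open>x = 0\<close> shows that \<open>t \<mapsto> E f (Y t)\<close> is continuous for \<open>C\<^sup>2\<close> functions \<open>f\<close>. A partition
  of unity extends this to bounded continuous functions, hence to the second derivatives occurring in
  \<open>L0 (P t f)\<close>. Neither the semigroup property nor tightness of the laws is needed. The case of a
  general \<open>x\<close> follows from the density of the domain of \<open>A\<close>.
\<close>

section \<open>Orthonormal expansions in a separable Hilbert space\<close>

text \<open>The integral formula has to precede any continuity in time. The second derivative of
  \<open>f\<close> is continuous but need not be uniformly continuous, so continuity in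
  \<open>s\<close> of the second-order term needs weak continuity of the laws of \<open>Y s\<close>,
  and convergence of characteristic functions alone does not give that in infinite dimension. Hence
  the formula is carried as a gauge integral (\<open>has_integral\<close>), whose class of
  admissible \<open>f\<close> is closed under bounded limits with no regularity of the integrand in
  \<open>s\<close>; weak continuity is then a consequence.

  Differentiating under the expectation puts \<open>T s\<close> on the direction vectors: the
  derivatives of \<open>P s f\<close> at \<open>x\<close> are expectations of jets of
  \<open>f\<close> at \<open>T s x + Y s\<close> in directions \<open>T s v\<close>. So only strong
  continuity of \<open>T\<close> enters, not that of the adjoint semigroup. A nuclear representation
  of \<open>Q\<close> turns the trace into a series of second derivatives in fixed directions, and
  Taylor's formula bounds the jump integrand by a multiple of
  \<open>min 1 ((norm y)\<^sup>2)\<close>. Both bounds are linear in the jet constant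
  \<open>C\<close>, so the passages to the limit are dominated convergence.\<close>

lemma inner_sum_orthonormal:
  fixes F :: "'h::real_inner set"
  assumes "finite F" "\<forall>e\<in>F. norm e = 1" "pairwise orthogonal F" "e \<in> F"
  shows "inner (\<Sum>d\<in>F. c d *\<^sub>R d) e = c e"
proof -
  have "inner (\<Sum>d\<in>F. c d *\<^sub>R d) e = (\<Sum>d\<in>F. if d = e then c e else 0)"
    unfolding inner_sum_left using assms
    by (intro sum.cong) (auto simp: pairwise_def orthogonal_def norm_eq_1)
  then show ?thesis using assms by simp
qed

lemma norm_sum_orthonormal:
  fixes F :: "'h::real_inner set"
  assumes "finite F" "\<forall>e\<in>F. norm e = 1" "pairwise orthogonal F"
  shows "(norm (\<Sum>d\<in>F. c d *\<^sub>R d))\<^sup>2 = (\<Sum>d\<in>F. (c d)\<^sup>2)"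
proof -
  have "inner s (\<Sum>d\<in>F. c d *\<^sub>R d) = (\<Sum>e\<in>F. c e * inner s e)" for s
    by (simp add: inner_sum_right)
  then have "(norm (\<Sum>d\<in>F. c d *\<^sub>R d))\<^sup>2 = (\<Sum>e\<in>F. c e * inner (\<Sum>d\<in>F. c d *\<^sub>R d) e)"
    unfolding power2_norm_eq_inner .
  also have "\<dots> = (\<Sum>e\<in>F. (c e)\<^sup>2)"
    using inner_sum_orthonormal[OF assms] by (intro sum.cong) (auto simp: power2_eq_square)
  finally show ?thesis .
qed

lemma bessel:
  fixes F :: "'h::real_inner set"
  assumes "finite F" "\<forall>e\<in>F. norm e = 1" "pairwise orthogonal F"
  shows "(\<Sum>e\<in>F. (inner x e)\<^sup>2) \<le> (norm x)\<^sup>2"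
    and "\<And>y. y \<in> span F \<Longrightarrow> norm (x - (\<Sum>e\<in>F. inner x e *\<^sub>R e)) \<le> norm (x - y)"
proof -
  define p where "p = (\<Sum>e\<in>F. inner x e *\<^sub>R e)"
  have orth: "inner (x - p) y = 0" if "y \<in> span F" for y
    using that
  proof (induction rule: span_induct_alt)
    case (step c e y)
    then show ?case
      using inner_sum_orthonormal[OF assms, of e "\<lambda>e. inner x e"]
      by (simp add: inner_diff_left inner_add_right p_def)
  qed auto
  have pF: "p \<in> span F" unfolding p_def by (intro span_sum span_scale span_base)
  have *: "(norm (x - y))\<^sup>2 = (norm (x - p))\<^sup>2 + (norm (p - y))\<^sup>2" if "y \<in> span F" for y
  proof -
    have "inner (x - p) (p - y) = 0" using orth pF that by (simp add: span_diff)
    moreover have "(norm (u + v))\<^sup>2 = (norm u)\<^sup>2 + 2 * inner u v + (norm v)\<^sup>2" for u v :: 'h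
      by (simp add: power2_norm_eq_inner inner_add inner_commute)
    moreover have "x - y = (x - p) + (p - y)" by simp
    ultimately show ?thesis by (metis add.right_neutral mult_zero_right)
  qed
  have "(norm x)\<^sup>2 \<ge> (norm p)\<^sup>2" using *[of 0] by (simp add: span_0)
  then show "(\<Sum>e\<in>F. (inner x e)\<^sup>2) \<le> (norm x)\<^sup>2"
    unfolding p_def norm_sum_orthonormal[OF assms] .
  show "norm (x - (\<Sum>e\<in>F. inner x e *\<^sub>R e)) \<le> norm (x - y)" if "y \<in> span F" for y
  proof (rule power2_le_imp_le)
    show "(norm (x - (\<Sum>e\<in>F. inner x e *\<^sub>R e)))\<^sup>2 \<le> (norm (x - y))\<^sup>2"
      using *[OF that] unfolding p_def by simp
  qed simp
qed

text \<open>A point \<open>y\<close> of the span close to \<open>x\<close> involves only finitely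
  many basis vectors. For every finite set containing them, the partial sum is the best
  approximation from its span, hence at least as close to \<open>x\<close> as \<open>y\<close>; this
  is convergence along the net of finite subsets.\<close>

lemma orthonormal_expansion:
  assumes B: "orthonormal_basis (B :: 'h::real_inner set)"
  shows "((\<lambda>e. inner x e *\<^sub>R e) has_sum x) B"
  unfolding has_sum_def tendsto_iff eventually_finite_subsets_at_top
proof (intro allI impI)
  fix \<epsilon> :: real assume "\<epsilon> > 0"
  have "x \<in> closure (span B)" using B by (simp add: orthonormal_basis_def)
  then obtain y where y: "y \<in> span B" "dist y x < \<epsilon>"
    using \<open>\<epsilon> > 0\<close> unfolding closure_approachable by blast
  then obtain F where F: "finite F" "F \<subseteq> B" "y \<in> span F"
    unfolding span_explicit by (auto intro: span_sum span_scale span_base)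
  show "\<exists>X. finite X \<and> X \<subseteq> B \<and>
     (\<forall>Y. finite Y \<and> X \<subseteq> Y \<and> Y \<subseteq> B \<longrightarrow> dist (\<Sum>e\<in>Y. inner x e *\<^sub>R e) x < \<epsilon>)"
  proof (intro exI conjI allI impI)
    fix Y assume Y: "finite Y \<and> F \<subseteq> Y \<and> Y \<subseteq> B"
    then have "norm (x - (\<Sum>e\<in>Y. inner x e *\<^sub>R e)) \<le> norm (x - y)"
      using B F span_mono[of F Y]
      by (intro bessel(2)) (auto simp: orthonormal_basis_def intro: pairwise_subset)
    then show "dist (\<Sum>e\<in>Y. inner x e *\<^sub>R e) x < \<epsilon>"
      using y by (simp add: dist_norm norm_minus_commute)
  qed (use F in auto)
qed

lemma parseval:
  assumes B: "orthonormal_basis (B :: 'h::real_inner set)"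
  shows "((\<lambda>e. inner x e * inner y e) has_sum inner x y) B"
proof -
  have "((\<lambda>e. inner (inner x e *\<^sub>R e) y) has_sum inner x y) B"
    by (rule has_sum_bounded_linear[OF bounded_linear_inner_left orthonormal_expansion[OF B]])
  then show ?thesis by (simp add: inner_commute)
qed

text \<open>Distinct members lie at distance \<open>sqrt 2 > 1\<close>, so the balls of radius 1/2
  around them are disjoint, and a second countable space has only countably many disjoint nonempty
  open sets.\<close>

lemma countable_orthonormal:
  fixes B :: "'h::{real_inner, second_countable_topology} set"
  assumes n1: "\<forall>e\<in>B. norm e = 1" and po: "pairwise orthogonal B"
  shows "countable B"
proof -
  have far: "dist d e > 1" if "d \<in> B" "e \<in> B" "d \<noteq> e" for d e
  proof -
    have "inner d e = 0" using po that by (auto simp: pairwise_def orthogonal_def)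
    then have "(dist d e)\<^sup>2 = (norm d)\<^sup>2 + (norm e)\<^sup>2"
      unfolding dist_norm power2_norm_eq_inner by (simp add: inner_diff inner_commute)
    then have "(dist d e)\<^sup>2 > 1\<^sup>2" using n1 that by auto
    then show ?thesis by (rule power2_less_imp_less) simp
  qed
  have "countable ((\<lambda>e. ball e (1/2)) ` B)"
  proof (rule countable_disjoint_open_subsets)
    show "pairwise disjnt ((\<lambda>e. ball e (1/2)) ` B)"
      unfolding pairwise_def
    proof (intro ballI impI, elim imageE)
      fix S T d e assume *: "S \<noteq> T" "S = ball d (1/2)" "T = ball e (1/2)" "d \<in> B" "e \<in> B"
      then have "dist d e > 1" using far by metis
      then show "disjnt S T"
        using * dist_triangle_less_add[of d _ "1/2" e "1/2"] by (fastforce simp: disjnt_iff dist_commute)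
    qed
  qed auto
  moreover have "inj_on (\<lambda>e::'h. ball e (1/2)) B"
  proof (rule inj_onI, rule ccontr)
    fix d e :: 'h assume *: "d \<in> B" "e \<in> B" "ball d (1/2) = ball e (1/2)" "d \<noteq> e"
    then have "d \<in> ball e (1/2)" by (metis centre_in_ball half_gt_zero_iff zero_less_one)
    then show False using far[of e d] * by auto
  qed
  ultimately show ?thesis using countable_image_inj_on by blast
qed

text \<open>An exhaustion of the fixed basis by finite sets. It replaces the net of finite subsets
  by a sequence, and it also indexes the coordinates kept by \<open>wrap n\<close>.\<close>

definition hfin :: "nat \<Rightarrow> 'h::{real_inner, second_countable_topology} set" where
  "hfin n = {e \<in> hbasis. to_nat_on hbasis e < n}"

lemma countable_hbasis: "countable (hbasis :: 'h::{real_inner, second_countable_topology} set)"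
proof -
  note * = orthonormal_basis_hbasis[where 'a='h, unfolded orthonormal_basis_def]
  show ?thesis by (rule countable_orthonormal[OF conjunct1[OF *] conjunct1[OF conjunct2[OF *]]])
qed

lemma hfin:
  shows "finite (hfin n)" and "\<forall>e\<in>hfin n. norm e = 1" and "pairwise orthogonal (hfin n)"
    and "hfin n \<subseteq> hbasis" and "m \<le> n \<Longrightarrow> hfin m \<subseteq> hfin n"
proof -
  show sub: "hfin n \<subseteq> hbasis" for n by (auto simp: hfin_def)
  show "finite (hfin n)"
  proof (rule inj_on_finite)
    show "inj_on (to_nat_on hbasis) (hfin n)"
      using inj_on_to_nat_on[OF countable_hbasis] sub by (rule inj_on_subset)
    show "to_nat_on hbasis ` hfin n \<subseteq> {..<n}" by (auto simp: hfin_def)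
  qed simp
  show "\<forall>e\<in>hfin n. norm e = 1" "pairwise orthogonal (hfin n)"
    using orthonormal_basis_hbasis sub[of n] unfolding orthonormal_basis_def
    by (auto intro: pairwise_subset)
  show "m \<le> n \<Longrightarrow> hfin m \<subseteq> hfin n" by (auto simp: hfin_def)
qed

lemma filterlim_hfin: "filterlim hfin (finite_subsets_at_top hbasis) sequentially"
  unfolding filterlim_finite_subsets_at_top
proof (intro allI impI)
  fix X :: "'a set" assume X: "finite X \<and> X \<subseteq> hbasis"
  then obtain N where N: "\<forall>e\<in>X. to_nat_on hbasis e < N"
    using finite_nat_set_iff_bounded[of "to_nat_on hbasis ` X"] by auto
  have "finite (hfin n) \<and> X \<subseteq> hfin n \<and> hfin n \<subseteq> hbasis" if "n \<ge> N" for n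
    using N X that hfin(1,4)[of n] by (force simp: hfin_def)
  then show "\<forall>\<^sub>F n in sequentially. finite (hfin n) \<and> X \<subseteq> hfin n \<and> hfin n \<subseteq> hbasis"
    unfolding eventually_sequentially by blast
qed

lemma has_sum_hfin:
  assumes "(g has_sum s) hbasis"
  shows "(\<lambda>n. \<Sum>e\<in>hfin n. g e) \<longlonglongrightarrow> s"
  using filterlim_compose[OF assms[unfolded has_sum_def] filterlim_hfin] .

lemmas hbasis_expansion = orthonormal_expansion[OF orthonormal_basis_hbasis]
lemmas hbasis_parseval = parseval[OF orthonormal_basis_hbasis]
lemmas hfin_expansion = has_sum_hfin[OF hbasis_expansion]

text \<open>The candidate is the limit of \<open>z n\<close>, the sum of
  \<open>\<phi> e *\<^sub>R e\<close> over \<open>hfin n\<close>. Since \<open>\<phi> (z n)\<close>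
  equals the squared norm \<open>s n\<close> of \<open>z n\<close>, the norms stay below the bound
  of \<open>\<phi>\<close>. So \<open>s\<close> is increasing and bounded, and the identity
  \<open>diff\<close> makes \<open>z\<close> Cauchy.\<close>

lemma riesz_representation:
  fixes \<phi> :: "'h::{real_inner, banach, second_countable_topology} \<Rightarrow> real"
  assumes "bounded_linear \<phi>"
  shows "\<exists>z. \<forall>x. \<phi> x = inner x z"
proof -
  interpret bounded_linear \<phi> by fact
  define z where "z n = (\<Sum>e\<in>hfin n. \<phi> e *\<^sub>R e)" for n
  define s where "s n = (\<Sum>e\<in>hfin n. (\<phi> e)\<^sup>2)" for n
  have zs: "(norm (z n))\<^sup>2 = s n" for n
    unfolding z_def s_def by (rule norm_sum_orthonormal[OF hfin(1-3)])
  have \<phi>z: "\<phi> (z n) = s n" for n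
    unfolding z_def s_def by (simp add: sum scale power2_eq_square)
  obtain K where K: "\<And>x. norm (\<phi> x) \<le> norm x * K" "K > 0" using pos_bounded by blast
  have zK: "norm (z n) \<le> K" for n
  proof (cases "z n = 0")
    case False
    have "norm (z n) * norm (z n) \<le> norm (z n) * K"
      using K(1)[of "z n"] zs[of n] \<phi>z[of n] by (simp add: power2_eq_square)
    then show ?thesis using False by simp
  qed (use K in simp)
  have diff: "(norm (z n - z m))\<^sup>2 = s n - s m" if "m \<le> n" for m n
  proof -
    have sub: "hfin m \<subseteq> (hfin n :: 'h set)" using hfin(5) that by blast
    have "z n - z m = (\<Sum>e\<in>hfin n - hfin m. \<phi> e *\<^sub>R e)"
      unfolding z_def by (rule sum_diff[OF hfin(1) sub, symmetric])
    moreover have "(norm (\<Sum>e\<in>hfin n - hfin m. \<phi> e *\<^sub>R e))\<^sup>2 = (\<Sum>e\<in>hfin n - hfin m. (\<phi> e)\<^sup>2)"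
      by (rule norm_sum_orthonormal[OF finite_Diff[OF hfin(1)] _ pairwise_subset[OF hfin(3) Diff_subset]])
        (use hfin(2) in blast)
    ultimately show ?thesis
      unfolding s_def using sum_diff[OF hfin(1) sub, of "\<lambda>e. (\<phi> e)\<^sup>2"] by simp
  qed
  have "incseq s"
    unfolding incseq_def
  proof (intro allI impI)
    fix m n :: nat assume "m \<le> n"
    then show "s m \<le> s n" using diff[of m n] zero_le_power2[of "norm (z n - z m)"] by linarith
  qed
  moreover have "s n \<le> K\<^sup>2" for n
    unfolding zs[symmetric] using zK[of n] by (intro power_mono) auto
  ultimately have "Cauchy s" using incseq_convergent LIMSEQ_imp_Cauchy by metis
  have "Cauchy z"
    unfolding Cauchy_altdef2
  proof (intro allI impI)
    fix r :: real assume r: "r > 0"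
    then obtain N where N: "\<forall>n\<ge>N. dist (s n) (s N) < r\<^sup>2"
      using \<open>Cauchy s\<close> unfolding Cauchy_altdef2 by (meson zero_less_power)
    have "dist (z n) (z N) < r" if "n \<ge> N" for n
    proof (rule power2_less_imp_less)
      show "(dist (z n) (z N))\<^sup>2 < r\<^sup>2"
        using N that diff[OF that] by (simp add: dist_norm) (metis abs_ge_self order_le_less_trans)
    qed (use r in simp)
    then show "\<exists>N. \<forall>n\<ge>N. dist (z n) (z N) < r" by blast
  qed
  then obtain w where w: "z \<longlonglongrightarrow> w" using Cauchy_convergent convergent_def by blast
  have "\<phi> x = inner x w" for x
  proof (rule LIMSEQ_unique)
    show "(\<lambda>n. \<phi> (\<Sum>e\<in>hfin n. inner x e *\<^sub>R e)) \<longlonglongrightarrow> \<phi> x"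
      by (rule tendsto[OF hfin_expansion])
    have "\<phi> (\<Sum>e\<in>hfin n. inner x e *\<^sub>R e) = inner x (z n)" for n
      unfolding z_def by (simp add: sum scale inner_sum_right mult.commute)
    then show "(\<lambda>n. \<phi> (\<Sum>e\<in>hfin n. inner x e *\<^sub>R e)) \<longlonglongrightarrow> inner x w"
      using w by (auto intro: tendsto_inner)
  qed
  then show ?thesis by blast
qed

text \<open>The Hilbert space adjoint as a total function; the choice is meaningful when
  \<open>B\<close> is bounded and linear, where \<open>inner_hadj\<close> supplies
  existence.\<close>

definition hadj :: "('h::real_inner \<Rightarrow> 'h) \<Rightarrow> 'h \<Rightarrow> 'h" where
  "hadj B = (SOME B'. \<forall>x y. inner (B x) y = inner x (B' y))"

lemma inner_hadj:
  fixes B :: "'h::{real_inner, banach, second_countable_topology} \<Rightarrow> 'h"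
  assumes "bounded_linear B"
  shows "inner (B x) y = inner x (hadj B y)"
proof -
  have "\<exists>z. \<forall>x. inner (B x) y = inner x z" for y
    using riesz_representation[OF bounded_linear_compose[OF bounded_linear_inner_left assms]] .
  then have "\<exists>B'. \<forall>x y. inner (B x) y = inner x (B' y)" by metis
  from someI_ex[OF this] show ?thesis unfolding hadj_def by blast
qed

lemma bounded_linear_hadj:
  fixes B :: "'h::{real_inner, banach, second_countable_topology} \<Rightarrow> 'h"
  assumes "bounded_linear B"
  shows "bounded_linear (hadj B)"
proof -
  interpret bounded_linear B by fact
  note adj = inner_hadj[OF assms]
  obtain K where K: "\<And>x. norm (B x) \<le> norm x * K" "K > 0" using pos_bounded by blast
  show ?thesis
  proof (rule bounded_linear_intro[where K = K])
    show "hadj B (x + y) = hadj B x + hadj B y" for x y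
      using adj by (metis inner_add_right vector_eq_rdot inner_commute)
    show "hadj B (r *\<^sub>R x) = r *\<^sub>R hadj B x" for r x
      using adj by (metis inner_scaleR_right vector_eq_rdot inner_commute)
    show "norm (hadj B x) \<le> norm x * K" for x
    proof (cases "hadj B x = 0")
      case False
      have "norm (hadj B x) * norm (hadj B x) = inner (B (hadj B x)) x"
        by (simp add: adj power2_norm_eq_inner[symmetric] power2_eq_square)
      also have "\<dots> \<le> norm (B (hadj B x)) * norm x" by (rule norm_cauchy_schwarz)
      also have "\<dots> \<le> norm (hadj B x) * (norm x * K)"
        using mult_right_mono[OF K(1)[of "hadj B x"], of "norm x"] by (simp add: mult_ac)
      finally show ?thesis using False by simp
    qed (use K in simp)
  qed
qed

section \<open>Hilbert-Schmidt operators and the trace against a nuclear operator\<close>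

lemma hs_norm_nonneg: "hs_norm T \<ge> 0"
  unfolding hs_norm_def by (intro real_sqrt_ge_zero infsum_nonneg) simp

text \<open>Cauchy-Schwarz and Bessel on the finite partial expansions of \<open>v\<close>, then the
  limit. Through this bound the Hilbert-Schmidt conditions in \<open>Cb2\<close> give operator norm
  bounds and operator norm continuity.\<close>

lemma norm_le_hs_norm:
  fixes T :: "'h::{real_inner, banach, second_countable_topology} \<Rightarrow> 'h"
  assumes "hilbert_schmidt T"
  shows "norm (T v) \<le> hs_norm T * norm v"
proof -
  interpret bounded_linear T using assms by (simp add: hilbert_schmidt_def)
  have "(\<lambda>n. norm (T (\<Sum>e\<in>hfin n. inner v e *\<^sub>R e))) \<longlonglongrightarrow> norm (T v)"
    by (intro tendsto_norm tendsto hfin_expansion)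
  moreover have "norm (T (\<Sum>e\<in>hfin n. inner v e *\<^sub>R e)) \<le> hs_norm T * norm v" for n
  proof -
    have "norm (T (\<Sum>e\<in>hfin n. inner v e *\<^sub>R e)) \<le> (\<Sum>e\<in>hfin n. \<bar>norm (T e)\<bar> * \<bar>inner v e\<bar>)"
      unfolding sum scale by (rule sum_norm_le) (simp add: mult.commute)
    also have "\<dots> \<le> L2_set (\<lambda>e. norm (T e)) (hfin n) * L2_set (inner v) (hfin n)"
      by (rule L2_set_mult_ineq)
    also have "\<dots> \<le> hs_norm T * norm v"
    proof (rule mult_mono)
      show "L2_set (\<lambda>e. norm (T e)) (hfin n) \<le> hs_norm T"
        unfolding L2_set_def hs_norm_def using assms hfin(1,4)
        by (intro real_sqrt_le_mono finite_sum_le_infsum) (auto simp: hilbert_schmidt_def)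
      show "L2_set (inner v) (hfin n) \<le> norm v"
        unfolding L2_set_def by (rule real_le_lsqrt[OF norm_ge_zero bessel(1)[OF hfin(1-3)]])
    qed (auto simp: hs_norm_nonneg L2_set_nonneg)
    finally show ?thesis .
  qed
  ultimately show ?thesis by (meson LIMSEQ_le_const2)
qed

lemma hilbert_schmidt_diff:
  assumes "hilbert_schmidt S" "hilbert_schmidt T"
  shows "hilbert_schmidt (\<lambda>h. S h - T h)"
  unfolding hilbert_schmidt_def
proof
  show "bounded_linear (\<lambda>h. S h - T h)"
    using assms by (auto simp: hilbert_schmidt_def intro: bounded_linear_sub)
  have "(\<lambda>e. 2 * (norm (S e))\<^sup>2 + 2 * (norm (T e))\<^sup>2) summable_on hbasis"
    using assms by (intro summable_on_add summable_on_cmult_right) (auto simp: hilbert_schmidt_def)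
  then show "(\<lambda>e. (norm (S e - T e))\<^sup>2) summable_on hbasis"
  proof (rule summable_on_comparison_test)
    fix e
    have "(norm (S e - T e))\<^sup>2 \<le> (norm (S e) + norm (T e))\<^sup>2"
      by (intro power_mono norm_triangle_ineq4) simp
    also have "\<dots> \<le> 2 * (norm (S e))\<^sup>2 + 2 * (norm (T e))\<^sup>2"
      using sum_squares_bound[of "norm (S e)" "norm (T e)"] by (simp add: power2_sum)
    finally show "(norm (S e - T e))\<^sup>2 \<le> 2 * (norm (S e))\<^sup>2 + 2 * (norm (T e))\<^sup>2" .
  qed auto
qed

text \<open>The trace is a double sum over \<open>k\<close> and the basis. By Cauchy-Schwarz and
  Bessel the absolute sum over the basis is at most \<open>norm (a k) * norm (b k) * K\<close>, so
  the double sum converges absolutely and may be interchanged; Parseval then evaluates the inner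
  sum. The resulting series no longer mentions a basis, and its terms are values of \<open>S\<close>
  in fixed directions, to which dominated convergence applies term by term.\<close>

lemma op_trace_nuclear:
  fixes Q S :: "'h::{real_inner, banach, second_countable_topology} \<Rightarrow> 'h"
  assumes ab: "summable (\<lambda>k. norm (a k) * norm (b k))"
    and Q: "\<And>x. (\<lambda>k. inner (a k) x *\<^sub>R b k) sums Q x"
    and S: "bounded_linear S"
  shows "op_trace (Q \<circ> S) = (\<Sum>k. inner (a k) (S (b k)))"
proof -
  define h where "h k e = inner (hadj S (a k)) e * inner (b k) e" for k :: nat and e
  have adj: "inner (a k) (S e) = inner (hadj S (a k)) e" for k e
    using inner_hadj[OF S, of e "a k"] by (simp add: inner_commute)
  obtain K where K: "\<And>x. norm (hadj S x) \<le> norm x * K" "K > 0"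
    using bounded_linear.pos_bounded[OF bounded_linear_hadj[OF S]] by blast
  have hs: "(h k has_sum inner (a k) (S (b k))) hbasis" for k
    unfolding h_def adj by (rule hbasis_parseval)
  have h_abs: "(\<lambda>e. norm (h k e)) summable_on hbasis"
    "(\<Sum>\<^sub>\<infinity>e\<in>hbasis. norm (h k e)) \<le> norm (a k) * norm (b k) * K" for k
  proof -
    have fin: "(\<Sum>e\<in>F. norm (h k e)) \<le> norm (a k) * norm (b k) * K"
      if "finite F" "F \<subseteq> hbasis" for F
    proof -
      have on: "\<forall>e\<in>F. norm e = 1" "pairwise orthogonal F"
        using orthonormal_basis_hbasis[where 'a='h] that by (auto simp: orthonormal_basis_def intro: pairwise_subset)
      have "(\<Sum>e\<in>F. norm (h k e)) = (\<Sum>e\<in>F. \<bar>inner (hadj S (a k)) e\<bar> * \<bar>inner (b k) e\<bar>)"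
        by (simp add: h_def abs_mult)
      also have "\<dots> \<le> L2_set (inner (hadj S (a k))) F * L2_set (inner (b k)) F"
        by (rule L2_set_mult_ineq)
      also have "\<dots> \<le> norm (hadj S (a k)) * norm (b k)"
        unfolding L2_set_def using bessel(1)[OF that(1) on]
        by (intro mult_mono) (auto intro: real_le_lsqrt sum_nonneg)
      also have "\<dots> \<le> norm (a k) * norm (b k) * K"
        using mult_right_mono[OF K(1)[of "a k"], of "norm (b k)"] by (simp add: mult_ac)
      finally show ?thesis .
    qed
    show *: "(\<lambda>e. norm (h k e)) summable_on hbasis"
      by (rule nonneg_bdd_above_summable_on) (use fin in \<open>auto intro!: bdd_aboveI2\<close>)
    show "(\<Sum>\<^sub>\<infinity>e\<in>hbasis. norm (h k e)) \<le> norm (a k) * norm (b k) * K"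
      by (rule infsum_le_finite_sums[OF * fin])
  qed
  have bnd: "summable (\<lambda>k. norm (a k) * norm (b k) * K)" using ab by (rule summable_mult2)
  have "(\<lambda>k. norm (\<Sum>\<^sub>\<infinity>e\<in>hbasis. norm (h k e))) summable_on UNIV"
  proof (rule norm_summable_imp_summable_on, rule summable_comparison_test[OF _ bnd])
    show "\<exists>N. \<forall>k\<ge>N. norm (norm (norm (\<Sum>\<^sub>\<infinity>e\<in>hbasis. norm (h k e)))) \<le> norm (a k) * norm (b k) * K"
      using h_abs(2) by (simp add: infsum_nonneg)
  qed
  then have abs: "(\<lambda>x. norm (case x of (k, e) \<Rightarrow> h k e)) summable_on UNIV \<times> hbasis"
    by (intro iffD2[OF Infinite_Sum.abs_summable_on_Sigma_iff]) (simp add: h_abs(1)[simplified])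
  have "op_trace (Q \<circ> S) = (\<Sum>\<^sub>\<infinity>e\<in>hbasis. \<Sum>\<^sub>\<infinity>k. h k e)"
    unfolding op_trace_def
  proof (intro infsum_cong)
    fix e :: 'h assume "e \<in> hbasis"
    have s: "(\<lambda>k. h k e) sums inner (Q (S e)) e"
      using bounded_linear.sums[OF bounded_linear_inner_left Q[of "S e"], of e]
      by (simp add: h_def adj)
    have "summable (\<lambda>k. norm (h k e))"
    proof (rule summable_comparison_test[OF _ bnd], intro exI allI impI)
      fix k :: nat
      have "norm (h k e) \<le> (\<Sum>\<^sub>\<infinity>e\<in>hbasis. norm (h k e))"
        using finite_sum_le_infsum[OF h_abs(1)[of k], of "{e}"] \<open>e \<in> hbasis\<close> by simp
      then show "norm (norm (h k e)) \<le> norm (a k) * norm (b k) * K" using h_abs(2)[of k] by simp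
    qed
    then have "((\<lambda>k. h k e) has_sum inner (Q (S e)) e) UNIV"
      using s by (intro norm_summable_imp_has_sum)
    then show "inner ((Q \<circ> S) e) e = (\<Sum>\<^sub>\<infinity>k. h k e)" by (simp add: infsumI)
  qed
  also have "\<dots> = (\<Sum>\<^sub>\<infinity>k. \<Sum>\<^sub>\<infinity>e\<in>hbasis. h k e)"
    using infsum_swap_banach[OF abs_summable_summable[OF abs]] by simp
  also have "\<dots> = (\<Sum>\<^sub>\<infinity>k. inner (a k) (S (b k)))"
    by (intro infsum_cong infsumI hs)
  also have "\<dots> = (\<Sum>k. inner (a k) (S (b k)))"
  proof (rule infsumI[OF norm_summable_imp_has_sum])
    have le: "norm (inner (a k) (S (b k))) \<le> norm (a k) * norm (b k) * K" for k
      using norm_infsum_bound[OF h_abs(1)[of k]] h_abs(2)[of k] infsumI[OF hs[of k]] by simp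
    show "summable (\<lambda>k. norm (inner (a k) (S (b k))))"
      by (rule summable_comparison_test[OF _ bnd]) (use le in auto)
    then show "(\<lambda>k. inner (a k) (S (b k))) sums (\<Sum>k. inner (a k) (S (b k)))"
      by (rule summable_sums[OF summable_norm_cancel])
  qed
  finally show ?thesis .
qed

section \<open>Strongly continuous semigroups\<close>

text \<open>If the conclusion fails, no ball is mapped into a bounded set by all \<open>F n\<close> simultaneously;
  nested balls on which some \<open>F n\<close> exceeds \<open>k\<close> then shrink to a point violating the assumption.\<close>

lemma uniform_boundedness:
  fixes F :: "nat \<Rightarrow> 'a::banach \<Rightarrow> 'b::real_normed_vector"
  assumes bl: "\<And>n. bounded_linear (F n)" and bd: "\<And>x. bounded (range (\<lambda>n. F n x))"
  shows "\<exists>C. \<forall>n x. norm (F n x) \<le> C * norm x"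
proof (rule ccontr)
  assume neg: "\<not> ?thesis"
  have unb: "\<exists>n. \<exists>y\<in>ball x r. norm (F n y) > k" if r: "r > 0" for x r k
  proof (rule ccontr)
    assume "\<not> ?thesis"
    then have le: "norm (F n y) \<le> k" if "y \<in> ball x r" for n y using that by (meson linorder_not_le)
    \<comment> \<open>The points \<open>x\<close> and \<open>x + c h\<close> with
      \<open>c = r / (2 norm h)\<close> both lie in the ball, so \<open>c\<close> times the norm of
      \<open>F n h\<close> is at most \<open>2 * k\<close>; dividing by \<open>c\<close> gives the
      factor \<open>4 * k / r\<close>.\<close>
    have "norm (F n h) \<le> (4 * k / r) * norm h" for n h
    proof (cases "h = 0")
      case True
      then show ?thesis by (simp add: linear_0[OF bounded_linear.linear[OF bl]])
    next
      case False
      interpret bounded_linear "F n" by (rule bl)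
      define c where "c = r / (2 * norm h)"
      have c: "c > 0" using r False by (simp add: c_def)
      have "x + c *\<^sub>R h \<in> ball x r" using r False by (simp add: dist_norm c_def)
      then have "norm (F n (x + c *\<^sub>R h) - F n x) \<le> k + k"
        using le[of "x + c *\<^sub>R h" n] le[of x n] r by (intro norm_triangle_le_diff) simp
      then have "c * norm (F n h) \<le> 2 * k" using c by (simp add: add scale)
      then show ?thesis using c r False by (simp add: c_def field_simps)
    qed
    then show False using neg by blast
  qed
  define P where "P = (\<lambda>n p. snd p > (0::real) \<and> snd p \<le> 1 / Suc n \<and>
      (\<exists>m. \<forall>z\<in>cball (fst p :: 'a) (snd p). norm (F m z) > real n))"
  have step: "\<exists>q. P n q \<and> cball (fst q) (snd q) \<subseteq> ball x r" if r: "r > 0" for n x r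
  proof -
    obtain m y where y: "y \<in> ball x r" "norm (F m y) > real n" using unb[OF r] by blast
    have "open {z. norm (F m z) > real n}"
      by (intro open_Collect_less continuous_intros linear_continuous_on bl)
    then have "open (ball x r \<inter> {z. norm (F m z) > real n})" by blast
    then obtain e where e: "e > 0" "cball y e \<subseteq> ball x r \<inter> {z. norm (F m z) > real n}"
      using y unfolding open_contains_cball by blast
    have "cball y (min e (1 / Suc n)) \<subseteq> cball y e" by auto
    then show ?thesis using e by (intro exI[of _ "(y, min e (1 / Suc n))"]) (auto simp: P_def)
  qed
  have "\<exists>q. \<forall>n. P n (q n) \<and> cball (fst (q (Suc n))) (snd (q (Suc n))) \<subseteq> cball (fst (q n)) (snd (q n))"
  proof (rule dependent_nat_choice)
    show "\<exists>q. P 0 q" using step[OF zero_less_one] by blast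
    show "\<exists>q. P (Suc n) q \<and> cball (fst q) (snd q) \<subseteq> cball (fst p) (snd p)" if "P n p" for p n
    proof -
      have "snd p > 0" using that by (simp add: P_def)
      then show ?thesis using step[of "snd p" "Suc n" "fst p"] ball_subset_cball by blast
    qed
  qed
  then obtain q where q: "\<And>n. P n (q n)"
    "\<And>n. cball (fst (q (Suc n))) (snd (q (Suc n))) \<subseteq> cball (fst (q n)) (snd (q n))" by blast
  define S where "S n = cball (fst (q n)) (snd (q n))" for n
  obtain z where z: "\<And>n. z \<in> S n"
  proof (rule decreasing_closed_nest[of S])
    show "S n \<noteq> {}" for n using q(1)[of n] by (auto simp: S_def P_def)
    show "S n \<subseteq> S m" if "m \<le> n" for m n
      using lift_Suc_antimono_le[of S m n] q(2) that unfolding S_def by blast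
    show "\<exists>n. \<forall>x\<in>S n. \<forall>y\<in>S n. dist x y < e" if e: "e > 0" for e
    proof -
      obtain m :: nat where "2 / e < real m" using reals_Archimedean2 by blast
      then obtain n :: nat where n: "2 / e < real (Suc n)" by (intro that[of m]) simp
      have sn: "snd (q n) \<le> 1 / Suc n" using q(1)[of n] by (simp add: P_def)
      have "2 * (1 / Suc n) < e" using n e by (simp add: field_simps)
      then have "dist x y < e" if "x \<in> S n" "y \<in> S n" for x y
        using that sn dist_triangle2[of x y "fst (q n)"] by (auto simp: S_def dist_commute)
      then show ?thesis by blast
    qed
  qed (auto simp: S_def)
  obtain B where B: "\<And>n. norm (F n z) \<le> B" using bd[of z] unfolding bounded_iff by auto
  obtain n :: nat where "real n > B" using reals_Archimedean2 by blast
  moreover obtain m where "norm (F m z) > real n" using q(1)[of n] z[of n] unfolding P_def S_def by blast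
  ultimately show False using B[of m] by linarith
qed

context
  fixes T :: "real \<Rightarrow> 'h::banach \<Rightarrow> 'h"
  assumes T: "c0_semigroup T"
begin

lemma c0_bounded_linear: "t \<ge> 0 \<Longrightarrow> bounded_linear (T t)"
  and c0_zero: "T 0 x = x"
  and c0_add: "s \<ge> 0 \<Longrightarrow> t \<ge> 0 \<Longrightarrow> T (s + t) x = T s (T t x)"
  using T by (auto simp: c0_semigroup_def)

lemma c0_tendsto_0:
  assumes "(s \<longlongrightarrow> 0) F" "\<forall>\<^sub>F i in F. s i \<ge> 0"
  shows "((\<lambda>i. T (s i) x) \<longlongrightarrow> x) F"
proof -
  have "((\<lambda>t. T t x) \<longlongrightarrow> x) (at_right 0)" using T by (auto simp: c0_semigroup_def)
  moreover have "at 0 within {0..} = at_right (0::real)"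
    by (rule at_within_nhd[of _ UNIV]) auto
  ultimately have "continuous (at 0 within {0..}) (\<lambda>t. T t x)"
    by (simp add: continuous_within c0_zero)
  from continuous_within_tendsto_compose[OF this _ assms(1)] show ?thesis
    using assms(2) by (simp add: c0_zero)
qed

text \<open>If no bound held near 0, times \<open>s n\<close> tending to 0 would exist whose
  operators exceed every multiple of the norm; but strong continuity makes each orbit along
  \<open>s\<close> bounded, contradicting \<open>uniform_boundedness\<close>. The semigroup law
  propagates the bound as \<open>K ^ n\<close>, with \<open>K\<close> at least 1 so that its powers
  increase.\<close>

lemma c0_bound: "\<exists>C>0. \<forall>s\<in>{0..t}. \<forall>x. norm (T s x) \<le> C * norm x"
proof -
  have "\<exists>\<delta>>0. \<exists>C. \<forall>s\<in>{0..\<delta>}. \<forall>x. norm (T s x) \<le> C * norm x"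
  proof (rule ccontr)
    assume neg: "\<not> ?thesis"
    have "\<exists>s\<in>{0..1 / Suc n}. \<exists>x. norm (T s x) > real n * norm x" for n
      using neg by (auto simp: not_le dest: spec[of _ "1 / Suc n"])
    then obtain s where s: "\<And>n. s n \<in> {0..1 / Suc n}" "\<And>n. \<exists>x. norm (T (s n) x) > real n * norm x"
      by metis
    have s0: "s \<longlonglongrightarrow> 0"
      using s(1) by (intro tendsto_sandwich[OF _ _ tendsto_const LIMSEQ_Suc[OF lim_1_over_n]]) auto
    have "\<exists>C. \<forall>n x. norm (T (s n) x) \<le> C * norm x"
    proof (rule uniform_boundedness)
      show "bounded_linear (T (s n))" for n using s(1)[of n] by (intro c0_bounded_linear) auto
      show "bounded (range (\<lambda>n. T (s n) x))" for x
        using s(1) by (intro convergent_imp_bounded[OF c0_tendsto_0[OF s0]]) auto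
    qed
    then obtain C where C: "\<And>n x. norm (T (s n) x) \<le> C * norm x" by blast
    obtain n :: nat where n: "real n > C" using reals_Archimedean2 by blast
    obtain x where "norm (T (s n) x) > real n * norm x" using s(2) by blast
    then show False using C[of n x] mult_right_mono[of C "real n" "norm x"] n by simp
  qed
  then obtain \<delta> C where \<delta>: "\<delta> > 0" and C: "\<And>s x. s \<in> {0..\<delta>} \<Longrightarrow> norm (T s x) \<le> C * norm x" by blast
  define K where "K = max 1 C"
  have "C * norm x \<le> K * norm x" for x :: 'h
    unfolding K_def by (intro mult_right_mono) auto
  then have K: "K \<ge> 1" "\<And>s x. s \<in> {0..\<delta>} \<Longrightarrow> norm (T s x) \<le> K * norm x"
    using C order_trans by (auto simp: K_def) blast
  have *: "norm (T s x) \<le> K ^ n * norm x" if "s \<in> {0..real n * \<delta>}" for n s x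
    using that
  proof (induction n arbitrary: s)
    case (Suc n)
    show ?case
    proof (cases "s \<le> real n * \<delta>")
      case True
      then have "norm (T s x) \<le> K ^ n * norm x" using Suc by auto
      also have "\<dots> \<le> K ^ Suc n * norm x"
        using K by (intro mult_right_mono power_increasing) auto
      finally show ?thesis .
    next
      case False
      define r where "r = real n * \<delta>"
      have r: "0 \<le> r" "r < s" "s - r \<le> \<delta>" using False Suc.prems \<delta> by (auto simp: r_def algebra_simps)
      have "norm (T s x) = norm (T (s - r) (T r x))"
        using c0_add[of "s - r" r x] r by simp
      also have "\<dots> \<le> K * norm (T r x)" using K r by auto
      also have "\<dots> \<le> K * (K ^ n * norm x)"
        using Suc.IH[of r] r K by (intro mult_left_mono) (auto simp: r_def)
      finally show ?thesis by simp
    qed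
  qed (simp add: c0_zero)
  obtain n :: nat where "t / \<delta> < real n" using reals_Archimedean2 by blast
  then have "t \<le> real n * \<delta>" using \<delta> by (simp add: field_simps)
  then show ?thesis using K by (intro exI[of _ "K ^ n"]) (auto intro!: *)
qed

text \<open>Only right continuity at time 0 is known. Factoring out the operator at the smaller of
  \<open>s n\<close> and \<open>t\<close> leaves the increment at time
  \<open>\<bar>s n - t\<bar>\<close>, which treats both sides of \<open>t\<close> at once; local
  boundedness controls the outer operator and the change of the argument.\<close>

lemma c0_continuous: "continuous_on ({0..} \<times> UNIV) (\<lambda>(t, x). T t x)"
  unfolding continuous_on_sequentially
proof (intro allI ballI impI, elim conjE)
  fix z :: "nat \<Rightarrow> real \<times> 'h" and p assume p: "p \<in> {0..} \<times> UNIV" and z: "\<forall>n. z n \<in> {0..} \<times> UNIV" "z \<longlonglongrightarrow> p"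
  obtain t x where tx: "p = (t, x)" by force
  define s y where "s n = fst (z n)" and "y n = snd (z n)" for n
  have s: "s \<longlonglongrightarrow> t" "\<And>n. s n \<ge> 0" "t \<ge> 0" and y: "y \<longlonglongrightarrow> x"
    using z p tendsto_fst[OF z(2)] tendsto_snd[OF z(2)] tx
    by (auto simp: s_def[abs_def] y_def[abs_def] mem_Times_iff)
  obtain C where C: "C > 0" "\<And>r x. r \<in> {0..t + 1} \<Longrightarrow> norm (T r x) \<le> C * norm x" using c0_bound by meson
  have ev: "\<forall>\<^sub>F n in sequentially. s n < t + 1" using s(1) by (rule order_tendstoD) simp
  have "(\<lambda>n. \<bar>s n - t\<bar>) \<longlonglongrightarrow> 0"
    using tendsto_rabs[OF tendsto_diff[OF s(1) tendsto_const[of t]]] by simp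
  then have "(\<lambda>n. T \<bar>s n - t\<bar> x) \<longlonglongrightarrow> x" by (rule c0_tendsto_0) simp
  then have lim: "(\<lambda>n. T \<bar>s n - t\<bar> x - x) \<longlonglongrightarrow> 0" by (auto simp: LIM_zero_iff)
  have "(\<lambda>n. T (s n) (y n) - T t x) \<longlonglongrightarrow> 0"
  proof (rule Lim_null_comparison)
    show "(\<lambda>n. C * norm (y n - x) + C * norm (T \<bar>s n - t\<bar> x - x)) \<longlonglongrightarrow> 0"
      using tendsto_add[OF tendsto_mult[OF tendsto_const tendsto_norm_zero[OF LIM_zero[OF y]]]
          tendsto_mult[OF tendsto_const tendsto_norm_zero[OF lim]], of C C] by simp
    show "\<forall>\<^sub>F n in sequentially. norm (T (s n) (y n) - T t x)
        \<le> C * norm (y n - x) + C * norm (T \<bar>s n - t\<bar> x - x)"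
      using ev
    proof eventually_elim
      case (elim n)
      have 1: "norm (T (s n) (y n) - T (s n) x) \<le> C * norm (y n - x)"
        using C(2)[of "s n" "y n - x"] s elim bounded_linear.linear[OF c0_bounded_linear[of "s n"]]
        by (simp add: linear_diff)
      have 2: "norm (T (s n) x - T t x) \<le> C * norm (T \<bar>s n - t\<bar> x - x)"
      proof (cases "s n \<ge> t")
        case True
        then have "T (s n) x - T t x = T t (T \<bar>s n - t\<bar> x - x)"
          using c0_add[of t "s n - t" x] s bounded_linear.linear[OF c0_bounded_linear[of t]]
          by (simp add: linear_diff)
        then show ?thesis using C(2)[of t] s by auto
      next
        case False
        then have "T (s n) x - T t x = - T (s n) (T \<bar>s n - t\<bar> x - x)"
          using c0_add[of "s n" "t - s n" x] s(2)[of n] bounded_linear.linear[OF c0_bounded_linear[of "s n"]]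
          by (simp add: linear_diff)
        then show ?thesis using C(2)[of "s n"] s elim by auto
      qed
      show ?case using norm_triangle_mono[OF 1 2] by simp
    qed
  qed
  then show "((\<lambda>(t, x). T t x) \<circ> z) \<longlonglongrightarrow> (\<lambda>(t, x). T t x) p"
    by (simp add: tx s_def y_def LIM_zero_iff case_prod_beta' comp_def)
qed

lemma c0_tendsto:
  assumes "(s \<longlongrightarrow> t) F" "\<forall>\<^sub>F i in F. s i \<ge> 0" "t \<ge> 0" "(y \<longlongrightarrow> x) F"
  shows "((\<lambda>i. T (s i) (y i)) \<longlongrightarrow> T t x) F"
proof -
  have "((\<lambda>i. (\<lambda>(t, x). T t x) (s i, y i)) \<longlongrightarrow> (\<lambda>(t, x). T t x) (t, x)) F"
    by (rule continuous_on_tendsto_compose[OF c0_continuous tendsto_Pair[OF assms(1,4)]])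
      (use assms in auto)
  then show ?thesis by simp
qed

lemma c0_continuous_on: "continuous_on {0..} (\<lambda>t. T t x)"
  unfolding continuous_on_def
  by (auto intro!: c0_tendsto tendsto_ident_at eventually_at_filter[THEN iffD2])

end

lemma has_vector_derivative_quotient:
  "((\<lambda>s. (f s - f t) /\<^sub>R (s - t)) \<longlongrightarrow> d) (at t within S) \<longleftrightarrow> (f has_vector_derivative d) (at t within S)"
proof -
  have "\<forall>\<^sub>F s in at t within S. norm ((f s - f t) /\<^sub>R (s - t) - d) = norm ((f s - f t) - (s - t) *\<^sub>R d) / norm (s - t)"
    unfolding eventually_at_filter
  proof (rule always_eventually, intro allI impI)
    fix s assume s: "s \<noteq> t"
    then have "(f s - f t) /\<^sub>R (s - t) - d = ((f s - f t) - (s - t) *\<^sub>R d) /\<^sub>R (s - t)"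
      by (simp add: scaleR_diff_right)
    then show "norm ((f s - f t) /\<^sub>R (s - t) - d) = norm ((f s - f t) - (s - t) *\<^sub>R d) / norm (s - t)"
      by (simp add: divide_inverse mult.commute)
  qed
  from tendsto_cong[OF this, of 0] show ?thesis
    unfolding has_vector_derivative_def has_derivative_iff_norm
    by (simp add: tendsto_norm_zero_iff LIM_zero_iff bounded_linear_scaleR_left)
qed

section \<open>The generator: differentiable orbits and density of the domain\<close>

context
  fixes T :: "real \<Rightarrow> 'h::banach \<Rightarrow> 'h" and A DA
  assumes gen: "generates DA A T"
begin

lemma generates_c0: "c0_semigroup T"
  using gen by (simp add: generates_def)

lemma generator_tendsto: "x \<in> DA \<Longrightarrow> ((\<lambda>t. (T t x - x) /\<^sub>R t) \<longlongrightarrow> A x) (at_right 0)"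
  using gen by (simp add: generates_def)

lemma generatorI:
  assumes "((\<lambda>t. (T t x - x) /\<^sub>R t) \<longlongrightarrow> y) (at_right 0)"
  shows "x \<in> DA" "A x = y"
proof -
  show "x \<in> DA" using gen assms by (auto simp: generates_def)
  from generator_tendsto[OF this] assms show "A x = y"
    by (rule tendsto_unique[rotated]) simp
qed

lemma generator_commute:
  assumes x: "x \<in> DA" and t: "t \<ge> 0"
  shows "T t x \<in> DA" "A (T t x) = T t (A x)"
proof -
  note c0 = generates_c0
  interpret bounded_linear "T t" by (rule c0_bounded_linear[OF c0 t])
  have "((\<lambda>s. T t ((T s x - x) /\<^sub>R s)) \<longlongrightarrow> T t (A x)) (at_right 0)"
    by (intro tendsto generator_tendsto x)
  moreover have "\<forall>\<^sub>F s in at_right 0. T t ((T s x - x) /\<^sub>R s) = (T s (T t x) - T t x) /\<^sub>R s"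
    using eventually_at_right_less[of 0]
  proof eventually_elim
    case (elim s)
    then show ?case
      using c0_add[OF c0, of t s x] c0_add[OF c0, of s t x] t by (simp add: scale diff add.commute)
  qed
  ultimately have "((\<lambda>s. (T s (T t x) - T t x) /\<^sub>R s) \<longlongrightarrow> T t (A x)) (at_right 0)"
    by (rule Lim_transform_eventually)
  then show "T t x \<in> DA" "A (T t x) = T t (A x)" by (rule generatorI)+
qed

text \<open>The generator gives only a right derivative at 0. For \<open>s\<close> on either side of
  \<open>t\<close>, the difference quotient is \<open>T (min s t)\<close> applied to the quotient at
  \<open>\<bar>s - t\<bar>\<close>, and joint continuity of the semigroup handles the moving outer
  operator. This covers left derivatives as well.\<close>

lemma generator_has_vector_derivative:
  assumes x: "x \<in> DA" and t: "t \<ge> 0"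
  shows "((\<lambda>s. T s x) has_vector_derivative T t (A x)) (at t within {0..})"
proof -
  note c0 = generates_c0
  define F where "F = at t within {0..}"
  have ev: "\<forall>\<^sub>F s in F. s \<ge> 0 \<and> s \<noteq> t" unfolding F_def by (simp add: eventually_at_filter)
  have st: "((\<lambda>s. s) \<longlongrightarrow> t) F" unfolding F_def by (rule tendsto_ident_at)
  have "((\<lambda>s. \<bar>s - t\<bar>) \<longlongrightarrow> 0) F"
    using tendsto_rabs[OF tendsto_diff[OF st tendsto_const[of t]]] by simp
  then have "filterlim (\<lambda>s. \<bar>s - t\<bar>) (at_right 0) F"
    unfolding filterlim_at using ev by (auto elim: eventually_mono)
  then have q: "((\<lambda>s. (T \<bar>s - t\<bar> x - x) /\<^sub>R \<bar>s - t\<bar>) \<longlongrightarrow> A x) F"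
    by (rule filterlim_compose[OF generator_tendsto[OF x]])
  have m: "((\<lambda>s. min s t) \<longlongrightarrow> t) F" using tendsto_min[OF st tendsto_const[of t]] by simp
  have "((\<lambda>s. T (min s t) ((T \<bar>s - t\<bar> x - x) /\<^sub>R \<bar>s - t\<bar>)) \<longlongrightarrow> T t (A x)) F"
    using ev t by (intro c0_tendsto[OF c0 m _ t q]) (auto elim: eventually_mono)
  moreover have "\<forall>\<^sub>F s in F. T (min s t) ((T \<bar>s - t\<bar> x - x) /\<^sub>R \<bar>s - t\<bar>) = (T s x - T t x) /\<^sub>R (s - t)"
    using ev
  proof eventually_elim
    case (elim s)
    interpret bounded_linear "T (min s t)" using elim t by (intro c0_bounded_linear[OF c0]) auto
    show ?case
    proof (cases "s \<le> t")
      case True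
      then have "T (min s t) ((T \<bar>s - t\<bar> x - x) /\<^sub>R \<bar>s - t\<bar>) = (T t x - T s x) /\<^sub>R (t - s)"
        using c0_add[OF c0, of s "t - s" x] elim by (simp only: scale diff) (simp add: min_def)
      also have "\<dots> = (- (T t x - T s x)) /\<^sub>R (- (t - s))" by (simp only: inverse_minus_eq scaleR_minus_left scaleR_minus_right minus_minus)
      finally show ?thesis by (simp only: minus_diff_eq)
    next
      case False
      then show ?thesis using c0_add[OF c0, of t "s - t" x] t
        by (simp only: scale diff) (simp add: min_def)
    qed
  qed
  ultimately have "((\<lambda>s. (T s x - T t x) /\<^sub>R (s - t)) \<longlongrightarrow> T t (A x)) F"
    by (rule Lim_transform_eventually)
  then show ?thesis
    unfolding F_def using has_vector_derivative_quotient[where f="\<lambda>s. T s x" and t=t] by blast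
qed

text \<open>The averages \<open>(1/h) \<integral>\<^sub>0\<^sup>h T s x ds\<close> lie in the domain and tend to \<open>x\<close>.\<close>

lemma generator_dense: "\<exists>X. (\<forall>n::nat. X n \<in> DA) \<and> X \<longlonglongrightarrow> x"
proof -
  note c0 = generates_c0
  define J where "J u = integral {0..u} (\<lambda>s. T s x)" for u
  have cont: "continuous_on {a..b} (\<lambda>s. T s x)" if "a \<ge> 0" for a b
    by (rule continuous_on_subset[OF c0_continuous_on[OF c0]]) (use that in auto)
  have int: "(\<lambda>s. T s x) integrable_on {a..b}" if "a \<ge> 0" for a b
    using cont[OF that] by (rule integrable_continuous_real)
  have deriv: "((\<lambda>r. (J r - J u) /\<^sub>R (r - u)) \<longlongrightarrow> T u x) (at_right u)" if "u \<ge> 0" for u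
  proof -
    have "(J has_vector_derivative T u x) (at u within {0..u + 1})"
      unfolding J_def using that by (intro integral_has_vector_derivative cont) auto
    then have "(J has_vector_derivative T u x) (at u within {u<..<u+1})"
      by (rule has_vector_derivative_within_subset) (use that in auto)
    moreover have "at u within {u<..<u+1} = at_right u"
      by (rule at_within_nhd[of _ "{..<u+1}"]) auto
    ultimately show ?thesis using has_vector_derivative_quotient[where f=J and t=u] by simp
  qed
  have mem: "J h \<in> DA" if h: "h \<ge> 0" for h
  proof -
    \<comment> \<open>\<open>T r\<close> shifts the window of integration, so the difference of
      \<open>T r (J h)\<close> and \<open>J h\<close> is the integral over the gained strip at
      \<open>h\<close> minus that over the lost strip at 0. Each quotient is a derivative of
      \<open>J\<close>.\<close>
    have lim: "((\<lambda>r. (J (h + r) - J h) /\<^sub>R r - (J r - J 0) /\<^sub>R r) \<longlongrightarrow> T h x - T 0 x) (at_right 0)"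
    proof (rule tendsto_diff)
      show "((\<lambda>r. (J r - J 0) /\<^sub>R r) \<longlongrightarrow> T 0 x) (at_right 0)" using deriv[of 0] by simp
      show "((\<lambda>r. (J (h + r) - J h) /\<^sub>R r) \<longlongrightarrow> T h x) (at_right 0)"
        using deriv[OF h] by (subst (asm) filterlim_at_right_to_0) (simp add: add.commute)
    qed
    have "\<forall>\<^sub>F r in at_right 0. (J (h + r) - J h) /\<^sub>R r - (J r - J 0) /\<^sub>R r = (T r (J h) - J h) /\<^sub>R r"
      using eventually_at_right_less[of 0]
    proof eventually_elim
      case (elim r)
      have "T r (J h) = integral {0..h} (T r \<circ> (\<lambda>s. T s x))"
        unfolding J_def using elim by (intro integral_linear[symmetric] int c0_bounded_linear[OF c0]) auto
      also have "\<dots> = integral {0..h} (\<lambda>s. T (s + r) x)"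
        using elim by (intro integral_cong) (simp add: c0_add[OF c0, symmetric] add.commute)
      also have "\<dots> = integral {r..h + r} (\<lambda>s. T s x)"
        using integral_shift_real_ivl[of r r "h + r" "\<lambda>s. T s x"] by simp
      also have "\<dots> = J (h + r) - J r"
        unfolding J_def using elim h
        by (subst Henstock_Kurzweil_Integration.integral_combine[of 0 r "h + r", symmetric]) (auto intro: int)
      finally have "J (h + r) = T r (J h) + J r" by simp
      moreover have "J 0 = 0" by (simp add: J_def)
      ultimately show ?case by (simp add: scaleR_diff_right[symmetric] del: scaleR_diff_right)
    qed
    from generatorI(1)[OF Lim_transform_eventually[OF lim this]] show ?thesis .
  qed
  define X where "X n = (J (1 / Suc n) - J 0) /\<^sub>R (1 / Suc n - 0)" for n :: nat
  have "X n \<in> DA" for n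
  proof -
    have "((\<lambda>t. real (Suc n) *\<^sub>R ((T t (J (1 / Suc n)) - J (1 / Suc n)) /\<^sub>R t)) \<longlongrightarrow>
        real (Suc n) *\<^sub>R A (J (1 / Suc n))) (at_right 0)"
      by (intro tendsto_scaleR tendsto_const generator_tendsto mem) simp
    moreover have "\<forall>\<^sub>F t in at_right 0. real (Suc n) *\<^sub>R ((T t (J (1 / Suc n)) - J (1 / Suc n)) /\<^sub>R t) = (T t (X n) - X n) /\<^sub>R t"
      using eventually_at_right_less[of 0]
    proof eventually_elim
      case (elim t)
      interpret bounded_linear "T t" using elim by (intro c0_bounded_linear[OF c0]) auto
      have "X n = real (Suc n) *\<^sub>R J (1 / Suc n)" by (simp add: X_def J_def divide_inverse del: of_nat_Suc)
      then show ?case by (simp add: scale scaleR_diff_right mult.commute del: of_nat_Suc)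
    qed
    ultimately show ?thesis by (rule generatorI(1)[OF Lim_transform_eventually])
  qed
  moreover have "X \<longlonglongrightarrow> T 0 x"
    unfolding X_def
  proof (rule filterlim_compose[OF deriv[OF order_refl]])
    show "filterlim (\<lambda>n. 1 / real (Suc n)) (at_right 0) sequentially"
      unfolding filterlim_at using LIMSEQ_Suc[OF lim_1_over_n] by auto
  qed
  ultimately show ?thesis using c0_zero[OF c0] by auto
qed

end

section \<open>Directional second-order jets\<close>

text \<open>Directional instead of Frechet derivatives, because they pass through averages and
  bounded pointwise limits; \<open>p x\<close> and \<open>q x\<close> are not required to be linear.\<close>

definition jet2 :: "real \<Rightarrow> ('h::real_normed_vector \<Rightarrow> real) \<Rightarrow> ('h \<Rightarrow> 'h \<Rightarrow> real)
    \<Rightarrow> ('h \<Rightarrow> 'h \<Rightarrow> 'h \<Rightarrow> real) \<Rightarrow> bool" where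
  "jet2 C f p q \<longleftrightarrow>
     (\<forall>x v. ((\<lambda>r. f (x + r *\<^sub>R v)) has_real_derivative p x v) (at 0)) \<and>
     (\<forall>x v w. ((\<lambda>r. p (x + r *\<^sub>R w) v) has_real_derivative q x v w) (at 0)) \<and>
     continuous_on UNIV f \<and>
     continuous_on UNIV (\<lambda>(x, v). p x v) \<and>
     continuous_on UNIV (\<lambda>(x, v, w). q x v w) \<and>
     (\<forall>x. \<bar>f x\<bar> \<le> C) \<and> (\<forall>x v. \<bar>p x v\<bar> \<le> C * norm v) \<and>
     (\<forall>x v w. \<bar>q x v w\<bar> \<le> C * norm v * norm w)"

lemma jet2D:
  assumes "jet2 C f p q"
  shows "((\<lambda>r. f (x + r *\<^sub>R v)) has_real_derivative p (x + r0 *\<^sub>R v) v) (at r0)"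
    and "((\<lambda>r. p (x + r *\<^sub>R w) v) has_real_derivative q (x + r0 *\<^sub>R w) v w) (at r0)"
    and "continuous_on UNIV f" "continuous_on UNIV (\<lambda>(x, v). p x v)"
    "continuous_on UNIV (\<lambda>(x, v, w). q x v w)"
    and "\<bar>f x\<bar> \<le> C" "\<bar>p x v\<bar> \<le> C * norm v" "\<bar>q x v w\<bar> \<le> C * norm v * norm w" "C \<ge> 0"
proof -
  have shift: "((\<lambda>r. g (x + r *\<^sub>R v)) has_real_derivative d) (at r0)"
    if "((\<lambda>r. g (x + r0 *\<^sub>R v + r *\<^sub>R v)) has_real_derivative d) (at 0)" for g :: "'a \<Rightarrow> real" and x v d
    using that DERIV_shift[of "\<lambda>r. g (x + r *\<^sub>R v)" d 0 r0]
    by (simp add: scaleR_add_left algebra_simps)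
  show "((\<lambda>r. f (x + r *\<^sub>R v)) has_real_derivative p (x + r0 *\<^sub>R v) v) (at r0)"
    using assms unfolding jet2_def by (intro shift) blast
  show "((\<lambda>r. p (x + r *\<^sub>R w) v) has_real_derivative q (x + r0 *\<^sub>R w) v w) (at r0)"
    using assms unfolding jet2_def by (intro shift[of "\<lambda>x. p x v"]) blast
  show fC: "\<bar>f x\<bar> \<le> C" for x using assms unfolding jet2_def by blast
  show "C \<ge> 0" using fC[of undefined] by linarith
qed (use assms in \<open>unfold jet2_def, blast+\<close>)

text \<open>This lets later statements quantify over some jet of \<open>f\<close>: any concrete jet
  may be substituted afterwards.\<close>

lemma jet2_unique:
  assumes "jet2 C f p q" "jet2 C' f p' q'"
  shows "p' = p" "q' = q"
proof -
  show p: "p' = p"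
    using DERIV_unique[OF jet2D(1)[OF assms(2), of _ _ 0] jet2D(1)[OF assms(1), of _ _ 0]]
    by (intro ext) simp
  show "q' = q"
    using DERIV_unique[OF jet2D(2)[OF assms(2), of _ _ _ 0, unfolded p] jet2D(2)[OF assms(1), of _ _ _ 0]]
    by (intro ext) simp
qed

lemma jet2_continuous_on:
  assumes "jet2 C f p q"
  shows "continuous_on S X \<Longrightarrow> continuous_on S (\<lambda>z. f (X z))"
    and "continuous_on S X \<Longrightarrow> continuous_on S V \<Longrightarrow> continuous_on S (\<lambda>z. p (X z) (V z))"
    and "continuous_on S X \<Longrightarrow> continuous_on S V \<Longrightarrow> continuous_on S W \<Longrightarrow>
      continuous_on S (\<lambda>z. q (X z) (V z) (W z))"
proof -
  show "continuous_on S X \<Longrightarrow> continuous_on S (\<lambda>z. f (X z))"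
    by (rule continuous_on_compose2[OF jet2D(3)[OF assms]]) auto
  show "continuous_on S (\<lambda>z. p (X z) (V z))" if "continuous_on S X" "continuous_on S V"
    using continuous_on_compose2[OF jet2D(4)[OF assms] continuous_on_Pair[OF that]] by simp
  show "continuous_on S (\<lambda>z. q (X z) (V z) (W z))"
    if "continuous_on S X" "continuous_on S V" "continuous_on S W"
    using continuous_on_compose2[OF jet2D(5)[OF assms] continuous_on_Pair[OF that(1) continuous_on_Pair[OF that(2,3)]]]
    by simp
qed

text \<open>The mean value theorem on the segment, used twice for the second estimate. The factor
  1/2 of the sharp remainder is dropped.\<close>

lemma jet2_taylor:
  assumes "jet2 C f p q"
  shows "\<bar>f (x + v) - f x\<bar> \<le> C * norm v" "\<bar>f (x + v) - f x - p x v\<bar> \<le> C * (norm v)\<^sup>2"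
proof -
  have lip: "\<bar>g 1 - g 0\<bar> \<le> B"
    if g: "\<And>r. (g has_real_derivative g' r) (at r)" and B: "\<And>r. 0 \<le> r \<Longrightarrow> r \<le> 1 \<Longrightarrow> \<bar>g' r\<bar> \<le> B" for g g' :: "real \<Rightarrow> real" and B
  proof -
    obtain r where "0 < r" "r < 1" "g 1 - g 0 = (1 - 0) * g' r" using MVT2[of 0 1 g g'] g by auto
    then show ?thesis using B[of r] by simp
  qed
  show "\<bar>f (x + v) - f x\<bar> \<le> C * norm v"
    using lip[of "\<lambda>r. f (x + r *\<^sub>R v)" "\<lambda>r. p (x + r *\<^sub>R v) v" "C * norm v"] jet2D(1,7)[OF assms] by simp
  have pp: "\<bar>p (x + r *\<^sub>R v) v - p x v\<bar> \<le> C * (norm v)\<^sup>2" if r: "0 \<le> r" "r \<le> 1" for r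
  proof -
    have "((\<lambda>s. p (x + (s * r) *\<^sub>R v) v) has_real_derivative q (x + (s * r) *\<^sub>R v) v v * r) (at s)" for s
      by (rule DERIV_chain2[OF jet2D(2)[OF assms]]) (auto intro!: derivative_eq_intros)
    moreover have "\<bar>q (x + (s * r) *\<^sub>R v) v v * r\<bar> \<le> C * (norm v)\<^sup>2" for s
      using mult_mono[OF jet2D(8)[OF assms, of "x + (s * r) *\<^sub>R v" v v] r(2)] r jet2D(9)[OF assms]
      by (simp add: abs_mult power2_eq_square mult.assoc)
    ultimately show ?thesis
      using lip[of "\<lambda>s. p (x + (s * r) *\<^sub>R v) v" "\<lambda>s. q (x + (s * r) *\<^sub>R v) v v * r"] by simp
  qed
  have "((\<lambda>r. f (x + r *\<^sub>R v) - r * p x v) has_real_derivative p (x + r *\<^sub>R v) v - p x v) (at r)" for r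
    by (auto intro!: derivative_eq_intros jet2D(1)[OF assms])
  then show "\<bar>f (x + v) - f x - p x v\<bar> \<le> C * (norm v)\<^sup>2"
    using lip[of "\<lambda>r. f (x + r *\<^sub>R v) - r * p x v" "\<lambda>r. p (x + r *\<^sub>R v) v - p x v" "C * (norm v)\<^sup>2"] pp
    by (simp add: algebra_simps)
qed

lemma jet2_add:
  assumes "jet2 C f p q" "jet2 D g r s"
  shows "jet2 (C + D) (\<lambda>x. f x + g x) (\<lambda>x v. p x v + r x v) (\<lambda>x v w. q x v w + s x v w)"
proof -
  note f = assms(1)[unfolded jet2_def] and g = assms(2)[unfolded jet2_def]
  have b: "\<bar>a + b\<bar> \<le> A + B" if "\<bar>a\<bar> \<le> A" "\<bar>b\<bar> \<le> B" for a b A B :: real using that by linarith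
  show ?thesis
    unfolding jet2_def distrib_right case_prod_beta'
    using f g by (auto intro!: DERIV_add continuous_on_add b simp: case_prod_beta')
qed

text \<open>The 4 counts the terms in the second derivative of a product, each bounded by
  \<open>C * D\<close>.\<close>

lemma jet2_mult:
  assumes f: "jet2 C f p q" and g: "jet2 D g r s"
  shows "jet2 (4 * (C * D)) (\<lambda>x. f x * g x) (\<lambda>x v. p x v * g x + f x * r x v)
    (\<lambda>x v w. q x v w * g x + p x v * r x w + (p x w * r x v + f x * s x v w))"
proof -
  have CD: "C \<ge> 0" "D \<ge> 0" using jet2D(9) assms by auto
  have m: "\<bar>a * b\<bar> \<le> C * D * (m * n)" if "\<bar>a\<bar> \<le> C * m" "\<bar>b\<bar> \<le> D * n" "m \<ge> 0" "n \<ge> 0" for a b m n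
    using mult_mono[OF that(1,2)] CD that by (simp add: abs_mult mult_ac)
  note fb = jet2D(6-8)[OF f] and gb = jet2D(6-8)[OF g]
  show ?thesis
    unfolding jet2_def
  proof (intro conjI allI)
    fix x v w
    show "((\<lambda>t. f (x + t *\<^sub>R v) * g (x + t *\<^sub>R v)) has_real_derivative p x v * g x + f x * r x v) (at 0)"
      using jet2D(1)[OF f, of x v 0] jet2D(1)[OF g, of x v 0]
      by (auto intro!: derivative_eq_intros simp: algebra_simps)
    show "((\<lambda>t. p (x + t *\<^sub>R w) v * g (x + t *\<^sub>R w) + f (x + t *\<^sub>R w) * r (x + t *\<^sub>R w) v) has_real_derivative
        q x v w * g x + p x v * r x w + (p x w * r x v + f x * s x v w)) (at 0)"
      using jet2D(1)[OF f, of x w 0] jet2D(1)[OF g, of x w 0] jet2D(2)[OF f, of x w v 0] jet2D(2)[OF g, of x w v 0]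
      by (auto intro!: derivative_eq_intros simp: algebra_simps)
    show "\<bar>f x * g x\<bar> \<le> 4 * (C * D)"
      using m[of "f x" 1 "g x" 1] fb gb CD by simp
    have 1: "\<bar>p x v * g x\<bar> \<le> C * D * norm v" "\<bar>f x * r x v\<bar> \<le> C * D * norm v"
      using m[of "p x v" "norm v" "g x" 1] m[of "f x" 1 "r x v" "norm v"] fb gb by simp_all
    moreover have "C * D * norm v \<ge> 0" using CD by simp
    ultimately show "\<bar>p x v * g x + f x * r x v\<bar> \<le> 4 * (C * D) * norm v" by simp
    have "\<bar>q x v w * g x\<bar> \<le> C * D * (norm v * norm w * 1)" "\<bar>p x v * r x w\<bar> \<le> C * D * (norm v * norm w)"
      "\<bar>p x w * r x v\<bar> \<le> C * D * (norm w * norm v)" "\<bar>f x * s x v w\<bar> \<le> C * D * (1 * (norm v * norm w))"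
      using fb gb by (intro m; simp add: mult.assoc)+
    then show "\<bar>q x v w * g x + p x v * r x w + (p x w * r x v + f x * s x v w)\<bar> \<le> 4 * (C * D) * norm v * norm w"
      by (simp add: mult_ac)
  qed (auto simp: case_prod_beta' intro!: continuous_intros jet2_continuous_on[OF f] jet2_continuous_on[OF g])
qed

lemma jet2_cos:
  fixes k :: "'h::real_inner"
  shows "jet2 (1 + norm k + (norm k)\<^sup>2) (\<lambda>x. cos (inner x k + \<theta>)) (\<lambda>x v. - sin (inner x k + \<theta>) * inner v k)
    (\<lambda>x v w. - cos (inner x k + \<theta>) * inner v k * inner w k)"
  unfolding jet2_def
proof (intro conjI allI)
  fix x v w :: 'h
  have cs: "\<bar>inner v k\<bar> \<le> norm v * norm k" for v by (rule Cauchy_Schwarz_ineq2)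
  show "\<bar>cos (inner x k + \<theta>)\<bar> \<le> 1 + norm k + (norm k)\<^sup>2"
    using abs_cos_le_one[of "inner x k + \<theta>"] norm_ge_zero[of k] zero_le_power2[of "norm k"] by linarith
  have "\<bar>- sin (inner x k + \<theta>) * inner v k\<bar> \<le> 1 * (norm v * norm k)"
    unfolding abs_mult using abs_sin_le_one cs by (intro mult_mono) auto
  also have "\<dots> \<le> (1 + norm k + (norm k)\<^sup>2) * norm v" by (simp add: algebra_simps)
  finally show "\<bar>- sin (inner x k + \<theta>) * inner v k\<bar> \<le> (1 + norm k + (norm k)\<^sup>2) * norm v" .
  have "\<bar>- cos (inner x k + \<theta>) * inner v k * inner w k\<bar> \<le> 1 * (norm v * norm k) * (norm w * norm k)"
    unfolding abs_mult using abs_cos_le_one cs by (intro mult_mono) auto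
  also have "\<dots> = (norm k)\<^sup>2 * norm v * norm w" by (simp add: power2_eq_square)
  also have "\<dots> \<le> (1 + norm k + (norm k)\<^sup>2) * norm v * norm w"
    by (intro mult_right_mono) auto
  finally show "\<bar>- cos (inner x k + \<theta>) * inner v k * inner w k\<bar> \<le> (1 + norm k + (norm k)\<^sup>2) * norm v * norm w" .
qed (auto simp: case_prod_beta' inner_add_left intro!: derivative_eq_intros continuous_intros)

text \<open>Differentiation under the integral sign. Used with \<open>B\<close> the identity, to
  smooth along a direction, and with \<open>B\<close> the projection that removes a coordinate, to
  form coefficients free of it; \<open>c\<close> moves along that coordinate. Only the mass
  \<open>K\<close> of a majorant of the kernel enters the constant, so averaging against a
  probability density keeps \<open>C\<close>.\<close>

lemma jet2_average:
  fixes f :: "'h::real_normed_vector \<Rightarrow> real" and B :: "'h \<Rightarrow> 'h" and a b :: real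
  assumes f: "jet2 C f p q" and B: "bounded_linear B" "\<And>v. norm (B v) \<le> norm v"
    and c: "continuous_on {a..b} c" and \<kappa>: "continuous_on {a..b} \<kappa>"
    and K: "\<And>z. z \<in> {a..b} \<Longrightarrow> \<bar>\<kappa> z\<bar> \<le> \<kappa>' z" "(\<kappa>' has_integral K) {a..b}"
  shows "jet2 (C * K) (\<lambda>x. integral {a..b} (\<lambda>z. f (B x + c z) * \<kappa> z))
    (\<lambda>x v. integral {a..b} (\<lambda>z. p (B x + c z) (B v) * \<kappa> z))
    (\<lambda>x v w. integral {a..b} (\<lambda>z. q (B x + c z) (B v) (B w) * \<kappa> z))"
proof -
  interpret B: bounded_linear B by fact
  have [continuous_intros]: "continuous_on S (\<lambda>z. B (g z))" if "continuous_on S g" for S :: "'x::topological_space set" and g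
    using that by (rule B.continuous_on)
  note [continuous_intros] = jet2_continuous_on[OF f] c \<kappa>
  have C0: "C \<ge> 0" by (rule jet2D(9)[OF f])
  have comp: "continuous_on (S \<times> {a..b}) (\<lambda>z. c (snd z))" "continuous_on (S \<times> {a..b}) (\<lambda>z. \<kappa> (snd z))"
    for S :: "'x::topological_space set"
    by (auto intro!: continuous_on_compose2[OF c] continuous_on_compose2[OF \<kappa>] continuous_intros)
  note [continuous_intros] = comp
  have bnd: "\<bar>integral {a..b} (\<lambda>z. h z * \<kappa> z)\<bar> \<le> D * K"
    if h: "continuous_on {a..b} h" "\<And>z. \<bar>h z\<bar> \<le> D" for h D
  proof -
    have "norm (integral {a..b} (\<lambda>z. h z * \<kappa> z)) \<le> integral {a..b} (\<lambda>z. D * \<kappa>' z)"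
    proof (rule integral_norm_bound_integral)
      show "(\<lambda>z. h z * \<kappa> z) integrable_on {a..b}"
        using h \<kappa> by (intro integrable_continuous_real continuous_intros)
      show "(\<lambda>z. D * \<kappa>' z) integrable_on {a..b}" using K(2) by (intro integrable_on_mult_right) auto
      show "norm (h z * \<kappa> z) \<le> D * \<kappa>' z" if "z \<in> {a..b}" for z
        using mult_mono[OF h(2)[of z] K(1)[OF that]] h(2)[of z] by (simp add: abs_mult)
    qed
    also have "\<dots> = D * K" using K(2) by (simp add: integral_unique)
    finally show ?thesis by simp
  qed
  show ?thesis
    unfolding jet2_def
  proof (intro conjI allI)
    fix x v w
    have "((\<lambda>r. integral (cbox a b) (\<lambda>z. f (B x + c z + r *\<^sub>R B v) * \<kappa> z)) has_real_derivative
        integral (cbox a b) (\<lambda>z. p (B x + c z + 0 *\<^sub>R B v) (B v) * \<kappa> z)) (at 0 within UNIV)"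
    proof (rule leibniz_rule_field_derivative)
      show "((\<lambda>r. f (B x + c z + r *\<^sub>R B v) * \<kappa> z) has_real_derivative p (B x + c z + r *\<^sub>R B v) (B v) * \<kappa> z)
        (at r within UNIV)" for r z
        by (rule DERIV_cmult_right[OF jet2D(1)[OF f]])
    qed (auto simp: case_prod_beta' intro!: integrable_continuous_real continuous_intros)
    then show "((\<lambda>r. integral {a..b} (\<lambda>z. f (B (x + r *\<^sub>R v) + c z) * \<kappa> z)) has_real_derivative
        integral {a..b} (\<lambda>z. p (B x + c z) (B v) * \<kappa> z)) (at 0)"
      by (simp add: B.add B.scale add_ac)
    have "((\<lambda>r. integral (cbox a b) (\<lambda>z. p (B x + c z + r *\<^sub>R B w) (B v) * \<kappa> z)) has_real_derivative
        integral (cbox a b) (\<lambda>z. q (B x + c z + 0 *\<^sub>R B w) (B v) (B w) * \<kappa> z)) (at 0 within UNIV)"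
    proof (rule leibniz_rule_field_derivative)
      show "((\<lambda>r. p (B x + c z + r *\<^sub>R B w) (B v) * \<kappa> z) has_real_derivative q (B x + c z + r *\<^sub>R B w) (B v) (B w) * \<kappa> z)
        (at r within UNIV)" for r z
        by (rule DERIV_cmult_right[OF jet2D(2)[OF f]])
    qed (auto simp: case_prod_beta' intro!: integrable_continuous_real continuous_intros)
    then show "((\<lambda>r. integral {a..b} (\<lambda>z. p (B (x + r *\<^sub>R w) + c z) (B v) * \<kappa> z)) has_real_derivative
        integral {a..b} (\<lambda>z. q (B x + c z) (B v) (B w) * \<kappa> z)) (at 0)"
      by (simp add: B.add B.scale add_ac)
    show "\<bar>integral {a..b} (\<lambda>z. f (B x + c z) * \<kappa> z)\<bar> \<le> C * K"
      by (intro bnd continuous_intros jet2D(6)[OF f])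
    have "\<bar>p (B x + c z) (B v)\<bar> \<le> C * norm v" for z
      using jet2D(7)[OF f, of "B x + c z" "B v"] mult_left_mono[OF B(2)[of v] C0] by linarith
    then have "\<bar>integral {a..b} (\<lambda>z. p (B x + c z) (B v) * \<kappa> z)\<bar> \<le> C * norm v * K"
      by (intro bnd continuous_intros)
    then show "\<bar>integral {a..b} (\<lambda>z. p (B x + c z) (B v) * \<kappa> z)\<bar> \<le> C * K * norm v" by (simp add: mult_ac)
    have "\<bar>q (B x + c z) (B v) (B w)\<bar> \<le> C * norm v * norm w" for z
    proof -
      have "\<bar>q (B x + c z) (B v) (B w)\<bar> \<le> C * norm (B v) * norm (B w)" by (rule jet2D(8)[OF f])
      also have "\<dots> \<le> C * norm v * norm w" using C0 B(2) by (intro mult_mono) auto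
      finally show ?thesis .
    qed
    then have "\<bar>integral {a..b} (\<lambda>z. q (B x + c z) (B v) (B w) * \<kappa> z)\<bar> \<le> C * norm v * norm w * K"
      by (intro bnd continuous_intros)
    then show "\<bar>integral {a..b} (\<lambda>z. q (B x + c z) (B v) (B w) * \<kappa> z)\<bar> \<le> C * K * norm v * norm w" by (simp add: mult_ac)
  next
    have "continuous_on (UNIV \<times> cbox a b) (\<lambda>(x, z). f (B x + c z) * \<kappa> z)"
      unfolding case_prod_beta' box_real by (intro continuous_intros)
    from integral_continuous_on_param[OF this]
    show "continuous_on UNIV (\<lambda>x. integral {a..b} (\<lambda>z. f (B x + c z) * \<kappa> z))" by simp
    have "continuous_on (UNIV \<times> cbox a b) (\<lambda>(x, z). p (B (fst x) + c z) (B (snd x)) * \<kappa> z)"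
      unfolding case_prod_beta' box_real by (intro continuous_intros)
    from integral_continuous_on_param[OF this]
    show "continuous_on UNIV (\<lambda>(x, v). integral {a..b} (\<lambda>z. p (B x + c z) (B v) * \<kappa> z))"
      by (simp add: case_prod_beta')
    have "continuous_on (UNIV \<times> cbox a b)
        (\<lambda>(x, z). q (B (fst x) + c z) (B (fst (snd x))) (B (snd (snd x))) * \<kappa> z)"
      unfolding case_prod_beta' box_real by (intro continuous_intros)
    from integral_continuous_on_param[OF this]
    show "continuous_on UNIV (\<lambda>(x, v, w). integral {a..b} (\<lambda>z. q (B x + c z) (B v) (B w) * \<kappa> z))"
      by (simp add: case_prod_beta')
  qed
qed

section \<open>Riemann sums and convergence of characteristic functions\<close>

text \<open>Uniform continuity on the compact interval. Right endpoints are what the partition sums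
  of the stochastic convolution produce once their order is reversed.\<close>

lemma riemann_sum_right_endpoints:
  fixes g :: "real \<Rightarrow> 'b::banach"
  assumes g: "continuous_on {0..t} g" and t: "t \<ge> 0"
  shows "(\<lambda>n. (t / Suc n) *\<^sub>R (\<Sum>i<Suc n. g (t * Suc i / Suc n))) \<longlonglongrightarrow> integral {0..t} g"
proof (rule metric_LIMSEQ_I)
  fix r :: real assume r: "r > 0"
  \<comment> \<open>The summand 1 keeps the denominator positive when \<open>t = 0\<close>.\<close>
  define e where "e = r / (2 * (t + 1))"
  have e: "e > 0" "e * t < r" using r t by (auto simp: e_def field_simps intro: add_nonneg_pos)
  have "uniformly_continuous_on {0..t} g" by (rule compact_uniformly_continuous[OF g]) simp
  then obtain d where d: "d > 0" "\<And>x y. x \<in> {0..t} \<Longrightarrow> y \<in> {0..t} \<Longrightarrow> dist y x < d \<Longrightarrow> dist (g y) (g x) < e"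
    using e unfolding uniformly_continuous_on_def by meson
  obtain m :: nat where m: "t / d < real m" using reals_Archimedean2 by blast
  have "dist ((t / Suc n) *\<^sub>R (\<Sum>i<Suc n. g (t * Suc i / Suc n))) (integral {0..t} g) < r" if "n \<ge> m" for n
  proof -
    define N where "N = real (Suc n)"
    have N: "N > 0" "t / N < d"
    proof -
      show "N > 0" by (simp add: N_def)
      have "t / d < N" using m that by (simp add: N_def)
      then show "t / N < d" using d \<open>N > 0\<close> by (simp add: field_simps)
    qed
    define q where "q i = t * real i / N" for i
    have q: "0 \<le> q i" "q i \<le> q (Suc i)" "q (Suc i) - q i = t / N" for i
      using t N by (auto simp: q_def field_simps)
    have qt: "q i \<le> t" if "i \<le> Suc n" for i
    proof -
      have "real i \<le> N" using that unfolding N_def by (simp del: of_nat_Suc)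
      then show ?thesis using t N mult_left_mono[of "real i" N t] by (simp add: q_def field_simps)
    qed
    have int: "g integrable_on {x..y}" if "0 \<le> x" "y \<le> t" for x y
      using g that by (intro integrable_continuous_real continuous_on_subset[OF g]) auto
    have split: "integral {0..q j} g = (\<Sum>i<j. integral {q i..q (Suc i)} g)" if "j \<le> Suc n" for j
      using that
    proof (induction j)
      case (Suc j)
      have "integral {0..q (Suc j)} g = integral {0..q j} g + integral {q j..q (Suc j)} g"
        by (rule Henstock_Kurzweil_Integration.integral_combine[symmetric]) (use q qt[OF Suc.prems] in \<open>auto intro: int\<close>)
      then show ?case using Suc by simp
    qed (simp add: q_def)
    have piece: "norm ((t / N) *\<^sub>R g (q (Suc i)) - integral {q i..q (Suc i)} g) \<le> e * (t / N)" if "i < Suc n" for i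
    proof -
      have qi: "q (Suc i) \<le> t" using qt that by simp
      have "(t / N) *\<^sub>R g (q (Suc i)) - integral {q i..q (Suc i)} g
          = integral {q i..q (Suc i)} (\<lambda>s. g (q (Suc i)) - g s)"
        using q[of i] qi by (subst Henstock_Kurzweil_Integration.integral_diff) (auto intro: int)
      also have "norm \<dots> \<le> e * (q (Suc i) - q i)"
      proof (rule integral_bound[OF q(2)])
        show "continuous_on {q i..q (Suc i)} (\<lambda>s. g (q (Suc i)) - g s)"
          using q[of i] qi by (intro continuous_intros continuous_on_subset[OF g]) auto
        fix s assume s: "s \<in> {q i..q (Suc i)}"
        then have "dist (q (Suc i)) s < d" using q(3)[of i] N by (auto simp: dist_real_def)
        then have "dist (g (q (Suc i))) (g s) < e"
          using s q(1)[of i] q(2)[of i] qi by (intro d(2)) auto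
        then show "norm (g (q (Suc i)) - g s) \<le> e" by (simp add: dist_norm)
      qed
      finally show ?thesis by (simp add: q(3))
    qed
    have "q (Suc n) = t" using N by (simp add: q_def N_def)
    then have "integral {0..t} g = (\<Sum>i<Suc n. integral {q i..q (Suc i)} g)"
      using split[of "Suc n"] by simp
    then have "(t / N) *\<^sub>R (\<Sum>i<Suc n. g (q (Suc i))) - integral {0..t} g
        = (\<Sum>i<Suc n. (t / N) *\<^sub>R g (q (Suc i)) - integral {q i..q (Suc i)} g)"
      by (simp only: scaleR_sum_right sum_subtractf)
    also have "norm \<dots> \<le> (\<Sum>i<Suc n. e * (t / N))"
      by (rule sum_norm_le) (use piece in auto)
    also have "\<dots> = e * t" using N by (simp add: N_def field_simps)
    also have "\<dots> < r" by (rule e)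
    finally show ?thesis unfolding dist_norm q_def N_def .
  qed
  then show "\<exists>no. \<forall>n\<ge>no. dist ((t / Suc n) *\<^sub>R (\<Sum>i<Suc n. g (t * Suc i / Suc n))) (integral {0..t} g) < r"
    by blast
qed

lemma cmod_iexp_minus_1: "cmod (iexp u - 1) \<le> \<bar>u\<bar>"
  using iexp_approx1[of u 0] by simp

lemma cmod_iexp_taylor: "cmod (iexp u - 1 - \<i> * complex_of_real u) \<le> u\<^sup>2"
proof -
  have "2 * cmod (iexp u - 1 - \<i> * complex_of_real u) \<le> u\<^sup>2"
    using iexp_approx1[of u 1] by (simp add: algebra_simps power2_eq_square)
  then show ?thesis
    using norm_ge_zero[of "iexp u - 1 - \<i> * complex_of_real u"] by linarith
qed

text \<open>Off the exceptional set the characters differ by at most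
  \<open>\<epsilon> * norm k\<close>; on it they differ by at most 2, with probability below
  \<open>\<epsilon>\<close>. The hypothesis uses one \<open>\<epsilon>\<close> for distance and
  probability, as \<open>stoch_convolution\<close> does.\<close>

lemma char_tendsto_in_probability:
  fixes R :: "nat \<Rightarrow> 'w \<Rightarrow> 'h::{real_inner, banach, second_countable_topology}"
  assumes "prob_space M" and R: "\<And>n. R n \<in> borel_measurable M" and Y: "Y \<in> borel_measurable M"
    and conv: "\<And>\<epsilon>. \<epsilon> > 0 \<Longrightarrow> \<forall>\<^sub>F n in sequentially. measure M {\<omega> \<in> space M. norm (R n \<omega> - Y \<omega>) > \<epsilon>} < \<epsilon>"
  shows "(\<lambda>n. \<integral>\<omega>. iexp (inner (R n \<omega>) k) \<partial>M)
    \<longlonglongrightarrow> (\<integral>\<omega>. iexp (inner (Y \<omega>) k) \<partial>M)"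
proof (rule metric_LIMSEQ_I)
  interpret prob_space M by fact
  note [measurable] = R Y
  fix r :: real assume r: "r > 0"
  \<comment> \<open>The total error is \<open>\<epsilon> * (norm k + 2)\<close>, made smaller than
    \<open>r\<close>.\<close>
  define \<epsilon> where "\<epsilon> = r / (2 * (norm k + 2))"
  have nk: "norm k + 2 > 0" by (rule add_nonneg_pos) auto
  have \<epsilon>: "\<epsilon> > 0" "\<epsilon> * (norm k + 2) < r" using r nk by (auto simp: \<epsilon>_def field_simps intro: add_nonneg_pos)
  obtain n0 where n0: "\<And>n. n \<ge> n0 \<Longrightarrow> measure M {\<omega> \<in> space M. norm (R n \<omega> - Y \<omega>) > \<epsilon>} < \<epsilon>"
    using conv[OF \<epsilon>(1)] unfolding eventually_sequentially by blast
  show "\<exists>no. \<forall>n\<ge>no. dist (\<integral>\<omega>. iexp (inner (R n \<omega>) k) \<partial>M)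
    (\<integral>\<omega>. iexp (inner (Y \<omega>) k) \<partial>M) < r"
  proof (intro exI allI impI)
    fix n assume "n0 \<le> n"
    define S where "S = {\<omega> \<in> space M. norm (R n \<omega> - Y \<omega>) > \<epsilon>}"
    have [measurable]: "S \<in> sets M" unfolding S_def by measurable
    have int: "integrable M (\<lambda>\<omega>. iexp (inner (X \<omega>) k))"
      if [measurable]: "X \<in> borel_measurable M" for X
      by (rule integrable_const_bound[where B=1]) (auto simp: norm_exp_i_times)
    have "dist (\<integral>\<omega>. iexp (inner (R n \<omega>) k) \<partial>M)
        (\<integral>\<omega>. iexp (inner (Y \<omega>) k) \<partial>M)
      = norm (\<integral>\<omega>. iexp (inner (R n \<omega>) k) - iexp (inner (Y \<omega>) k) \<partial>M)"
      unfolding dist_norm by (subst Bochner_Integration.integral_diff) (auto intro: int)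
    also have "\<dots> \<le> (\<integral>\<omega>. norm (iexp (inner (R n \<omega>) k) - iexp (inner (Y \<omega>) k)) \<partial>M)"
      by (rule integral_norm_bound)
    also have "\<dots> \<le> (\<integral>\<omega>. \<epsilon> * norm k + 2 * indicator S \<omega> \<partial>M)"
    proof (rule integral_mono)
      fix \<omega> assume \<omega>: "\<omega> \<in> space M"
      let ?x = "inner (R n \<omega>) k" and ?y = "inner (Y \<omega>) k"
      have "iexp ?x - iexp ?y
          = iexp ?y * (iexp (?x - ?y) - 1)"
        by (simp add: algebra_simps exp_add[symmetric])
      then have le: "norm (iexp ?x - iexp ?y) \<le> \<bar>?x - ?y\<bar>"
        using cmod_iexp_minus_1[of "?x - ?y"] by (simp add: norm_mult)
      show "norm (iexp ?x - iexp ?y) \<le> \<epsilon> * norm k + 2 * indicator S \<omega>"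
      proof (cases "\<omega> \<in> S")
        case True
        have "norm (iexp ?x - iexp ?y) \<le> 1 + 1"
          by (rule norm_triangle_le_diff) simp
        moreover have "\<epsilon> * norm k \<ge> 0" using \<epsilon> by simp
        ultimately show ?thesis using True by simp
      next
        case False
        have "\<bar>?x - ?y\<bar> \<le> norm (R n \<omega> - Y \<omega>) * norm k"
          using Cauchy_Schwarz_ineq2[of "R n \<omega> - Y \<omega>" k] by (simp add: inner_diff_left)
        also have "\<dots> \<le> \<epsilon> * norm k" using False \<omega> by (intro mult_right_mono) (auto simp: S_def)
        finally show ?thesis using le False by simp
      qed
    next
      show "integrable M (\<lambda>\<omega>. norm (iexp (inner (R n \<omega>) k) - iexp (inner (Y \<omega>) k)))"
        by (intro integrable_norm Bochner_Integration.integrable_diff int) auto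
      show "integrable M (\<lambda>\<omega>. \<epsilon> * norm k + 2 * indicat_real S \<omega>)"
        by (intro Bochner_Integration.integrable_add integrable_const integrable_mult_right integrable_real_indicator)
          (auto simp: emeasure_eq_measure)
    qed
    also have "\<dots> = \<epsilon> * norm k + 2 * measure M S"
      by (subst Bochner_Integration.integral_add) (auto simp: emeasure_eq_measure prob_space)
    also have "\<dots> < r" using n0[OF \<open>n0 \<le> n\<close>] \<epsilon> unfolding S_def[symmetric] by (simp add: algebra_simps)
    finally show "dist (\<integral>\<omega>. iexp (inner (R n \<omega>) k) \<partial>M)
      (\<integral>\<omega>. iexp (inner (Y \<omega>) k) \<partial>M) < r" .
  qed
qed

lemma suminf_dominated:
  fixes c :: "nat \<Rightarrow> 'b \<Rightarrow> real"
  assumes "\<And>k. ((\<lambda>n. c k n) \<longlongrightarrow> b k) F" "\<And>k n. \<bar>c k n\<bar> \<le> M k" "summable M" "F \<noteq> bot"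
  shows "((\<lambda>n. \<Sum>k. c k n) \<longlongrightarrow> (\<Sum>k. b k)) F"
proof -
  have "\<forall>\<^sub>F (k, n) in at_top \<times>\<^sub>F F. norm (c k n) \<le> M k"
    by (rule always_eventually) (use assms(2) in auto)
  from tannerys_theorem[OF assms(1) this assms(3,4)] show ?thesis by blast
qed

text \<open>A function that is not integrable has Bochner integral 0 by convention, and the
  pointwise bound forces \<open>B\<close> to be nonnegative, so both cases give the
  estimate.\<close>

lemma (in prob_space) integral_norm_le:
  fixes X :: "'a \<Rightarrow> 'c::{banach, second_countable_topology}"
  assumes "\<And>\<omega>. norm (X \<omega>) \<le> B"
  shows "norm (\<integral>\<omega>. X \<omega> \<partial>M) \<le> B"
proof (cases "integrable M X")
  case True
  have "norm (\<integral>\<omega>. X \<omega> \<partial>M) \<le> (\<integral>\<omega>. norm (X \<omega>) \<partial>M)" by (rule integral_norm_bound)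
  also have "\<dots> \<le> (\<integral>\<omega>. B \<partial>M)" using True assms by (intro integral_mono) auto
  finally show ?thesis by (simp add: prob_space)
next
  case False
  then show ?thesis using assms[of undefined] by (simp add: not_integrable_integral_eq order_trans[OF norm_ge_zero])
qed

lemma (in prob_space) tendsto_expectation:
  fixes X :: "nat \<Rightarrow> 'a \<Rightarrow> 'c::{banach, second_countable_topology}"
  assumes "\<And>n. random_variable borel (X n)" "random_variable borel Y"
    and "\<And>\<omega>. (\<lambda>n. X n \<omega>) \<longlonglongrightarrow> Y \<omega>" "\<And>n \<omega>. norm (X n \<omega>) \<le> B"
  shows "(\<lambda>n. \<integral>\<omega>. X n \<omega> \<partial>M) \<longlonglongrightarrow> (\<integral>\<omega>. Y \<omega> \<partial>M)"
  by (rule integral_dominated_convergence[where w = "\<lambda>_. B"]) (use assms in auto)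

section \<open>The Levy exponent along the semigroup\<close>

text \<open>The vectors \<open>qa\<close> and \<open>qb\<close> fix one nuclear representation of
  \<open>Q\<close>, so that every trace becomes a series in these fixed directions.\<close>

locale ou_setting =
  fixes Q A :: "'h::{real_inner, banach, second_countable_topology} \<Rightarrow> 'h"
    and DA :: "'h set" and a :: 'h and \<nu> :: "'h measure" and T :: "real \<Rightarrow> 'h \<Rightarrow> 'h"
    and M :: "'w measure" and Z Y :: "real \<Rightarrow> 'w \<Rightarrow> 'h" and qa qb :: "nat \<Rightarrow> 'h"
  assumes Q_summable: "summable (\<lambda>k. norm (qa k) * norm (qb k))"
    and Q_sums: "\<And>x. (\<lambda>k. inner (qa k) x *\<^sub>R qb k) sums Q x"
    and nu_sets: "sets \<nu> = sets borel"
    and nu_int: "(\<integral>\<^sup>+y. ennreal (min 1 ((norm y)\<^sup>2)) \<partial>\<nu>) < \<infinity>"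
    and Z_levy: "levy_process M Z"
    and Z_char: "\<And>t h. t \<ge> 0 \<Longrightarrow> (\<integral>\<omega>. iexp (inner (Z t \<omega>) h) \<partial>M)
                   = exp (- of_real t * levy_exponent Q a \<nu> h)"
    and A_gen: "generates DA A T"
    and Y_conv: "\<And>t. t \<ge> 0 \<Longrightarrow> stoch_convolution M T Z t (Y t)"
begin

lemma T_c0: "c0_semigroup T"
  by (rule generates_c0[OF A_gen])

lemmas T_bounded_linear = c0_bounded_linear[OF T_c0]
lemmas T_tendsto = c0_tendsto[OF T_c0]

lemma T_linear:
  assumes "s \<ge> 0"
  shows "T s (x + y) = T s x + T s y" "T s (r *\<^sub>R x) = r *\<^sub>R T s x" "T s (x - y) = T s x - T s y" "T s 0 = 0"
proof -
  interpret bounded_linear "T s" by (rule T_bounded_linear[OF assms])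
  show "T s (x + y) = T s x + T s y" "T s (r *\<^sub>R x) = r *\<^sub>R T s x" "T s (x - y) = T s x - T s y" "T s 0 = 0"
    by (fact add scale diff zero)+
qed

lemma T_measurable [measurable]: "s \<ge> 0 \<Longrightarrow> T s \<in> borel_measurable borel"
  by (intro borel_measurable_continuous_onI linear_continuous_on T_bounded_linear)

lemma T_bound_seq:
  assumes "s \<longlonglongrightarrow> t" "\<And>n. s n \<ge> 0"
  obtains C where "C > 0" "\<And>n x. norm (T (s n) x) \<le> C * norm x" "\<And>x. norm (T t x) \<le> C * norm x"
proof -
  have "Bseq s" using assms(1) convergentI convergent_imp_Bseq by blast
  then obtain K where K: "\<And>n. \<bar>s n\<bar> \<le> K" unfolding Bseq_def by auto
  have "t \<ge> 0" "t \<le> K"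
    using LIMSEQ_le_const[OF assms(1), of 0] LIMSEQ_le_const2[OF assms(1), of K] assms(2) K abs_le_D1
    by auto
  then show ?thesis using c0_bound[OF T_c0, of K] that assms(2) abs_le_D1[OF K] by (metis atLeastAtMost_iff)
qed

lemma Y_measurable [measurable]: "t \<ge> 0 \<Longrightarrow> Y t \<in> borel_measurable M"
  using Y_conv by (simp add: stoch_convolution_def)

lemma Z_measurable [measurable]: "t \<ge> 0 \<Longrightarrow> Z t \<in> borel_measurable M"
  using Z_levy by (simp add: levy_process_def)

lemma prob_space_M: "prob_space M"
  using Z_levy by (simp add: levy_process_def)

sublocale prob_space M by (rule prob_space_M)

lemma measurable_nu: "measurable \<nu> N = measurable borel N"
  by (rule measurable_cong_sets) (simp_all add: nu_sets)

lemma nu_weight_integrable: "integrable \<nu> (\<lambda>y. min 1 ((norm y)\<^sup>2))"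
  unfolding integrable_iff_bounded using nu_int by (simp add: measurable_nu)

lemma nu_integrable:
  fixes h :: "'h \<Rightarrow> 'c::{banach, second_countable_topology}"
  assumes "h \<in> borel_measurable borel" "\<And>y. norm (h y) \<le> K * min 1 ((norm y)\<^sup>2)"
  shows "integrable \<nu> h"
  by (rule Bochner_Integration.integrable_bound[OF integrable_mult_right[OF nu_weight_integrable, of K]])
    (use assms in \<open>auto simp: measurable_nu intro!: AE_I2 order_trans[OF assms(2)]\<close>)

text \<open>The measure may be infinite near 0, so constants cannot serve as majorants; the weight
  \<open>min 1 ((norm y)\<^sup>2)\<close> is the integrable function against which all integrands in
  \<open>y\<close> are compared.\<close>

lemma nu_tendsto:
  fixes h :: "nat \<Rightarrow> 'h \<Rightarrow> 'c::{banach, second_countable_topology}"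
  assumes "\<And>n. h n \<in> borel_measurable borel" "h' \<in> borel_measurable borel"
    and "\<And>y. (\<lambda>n. h n y) \<longlonglongrightarrow> h' y" "\<And>n y. norm (h n y) \<le> K * min 1 ((norm y)\<^sup>2)"
  shows "(\<lambda>n. \<integral>y. h n y \<partial>\<nu>) \<longlonglongrightarrow> (\<integral>y. h' y \<partial>\<nu>)"
  by (rule integral_dominated_convergence[where w = "\<lambda>y. K * min 1 ((norm y)\<^sup>2)"])
    (use assms in \<open>auto simp: measurable_nu intro: nu_weight_integrable\<close>)

text \<open>The integrand of the Levy-Khintchine exponent at the adjoint of \<open>T s\<close>
  applied to \<open>k\<close>. The truncation stays at \<open>norm y \<le> 1\<close> and does not
  follow \<open>T s y\<close>.\<close>

definition jump :: "real \<Rightarrow> 'h \<Rightarrow> 'h \<Rightarrow> complex" where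
  "jump s k y = iexp (inner (T s y) k) - 1
     - \<i> * of_real (inner (T s y) k * indicator (cball 0 1) y)"

text \<open>The exponent along the adjoint flow, identified in \<open>Psi_levy_exponent\<close>.
  With \<open>T s\<close> placed on the vectors, continuity in \<open>s\<close> follows from strong
  continuity of \<open>T\<close>.\<close>

definition Psi :: "real \<Rightarrow> 'h \<Rightarrow> complex" where
  "Psi s k = of_real ((\<Sum>j. inner (T s (qa j)) k * inner (T s (qb j)) k) / 2)
     - \<i> * of_real (inner (T s a) k) - (\<integral>y. jump s k y \<partial>\<nu>)"

lemma jump_measurable: "s \<ge> 0 \<Longrightarrow> jump s k \<in> borel_measurable borel"
proof -
  have [measurable]: "cball (0::'h) 1 \<in> sets borel" by simp
  show "s \<ge> 0 \<Longrightarrow> jump s k \<in> borel_measurable borel" unfolding jump_def by measurable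
qed

text \<open>Small jumps: the linear term is subtracted and the second-order Taylor bound applies.
  Large jumps: a difference of two complex numbers of modulus 1.\<close>

lemma jump_bound:
  assumes "C \<ge> 0" "\<And>x. norm (T s x) \<le> C * norm x"
  shows "norm (jump s k y) \<le> (2 + (C * norm k)\<^sup>2) * min 1 ((norm y)\<^sup>2)"
proof -
  let ?u = "inner (T s y) k"
  have u: "\<bar>?u\<bar> \<le> C * norm k * norm y"
    using Cauchy_Schwarz_ineq2[of "T s y" k] mult_right_mono[OF assms(2)[of y], of "norm k"] by (simp add: mult_ac)
  show ?thesis
  proof (cases "norm y \<le> 1")
    case True
    have "norm (jump s k y) \<le> ?u\<^sup>2" using cmod_iexp_taylor[of ?u] True by (simp add: jump_def)
    also have "\<dots> \<le> (C * norm k * norm y)\<^sup>2" using u by (rule abs_le_square_iff[THEN iffD1, OF order_trans]) simp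
    also have "\<dots> \<le> (2 + (C * norm k)\<^sup>2) * (norm y)\<^sup>2" by (simp add: power_mult_distrib algebra_simps)
    also have "(norm y)\<^sup>2 = min 1 ((norm y)\<^sup>2)" using True by (simp add: power_le_one min_absorb2)
    finally show ?thesis .
  next
    case False
    have "norm (jump s k y) \<le> 1 + 1"
      using False norm_triangle_le_diff[of "iexp ?u" 1 "1 + 1"] by (simp add: jump_def)
    moreover have "min 1 ((norm y)\<^sup>2) = 1" using False by (simp add: min_def one_le_power)
    ultimately show ?thesis using zero_le_power2[of "C * norm k"] by (simp only: mult_1_right)
  qed
qed

lemma jump_integrable: "s \<ge> 0 \<Longrightarrow> integrable \<nu> (jump s k)"
proof -
  assume s: "s \<ge> 0"
  obtain C where C: "C > 0" "\<And>x. norm (T s x) \<le> C * norm x" using c0_bound[OF T_c0, of s] s by auto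
  show ?thesis by (rule nu_integrable[OF jump_measurable[OF s] jump_bound[where C=C]]) (use C in auto)
qed

lemma Psi_levy_exponent: "s \<ge> 0 \<Longrightarrow> Psi s k = levy_exponent Q a \<nu> (hadj (T s) k)"
proof -
  assume s: "s \<ge> 0"
  note adj = inner_hadj[OF T_bounded_linear[OF s], symmetric]
  let ?h = "hadj (T s) k"
  have "(\<lambda>j. inner (inner (qa j) ?h *\<^sub>R qb j) ?h) sums inner (Q ?h) ?h"
    by (rule bounded_linear.sums[OF bounded_linear_inner_left Q_sums])
  then have "inner (Q ?h) ?h = (\<Sum>j. inner (T s (qa j)) k * inner (T s (qb j)) k)"
    by (simp add: adj T_linear[OF s] sums_iff)
  moreover have "inner a ?h = inner (T s a) k" "inner ?h y = inner (T s y) k" for y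
    by (simp_all add: adj inner_commute[of ?h])
  ultimately show ?thesis unfolding Psi_def levy_exponent_def jump_def by simp
qed

lemma Psi_continuous: "continuous_on {0..} (\<lambda>s. Psi s k)"
  unfolding continuous_on_sequentially
proof (intro allI ballI impI, elim conjE)
  fix s :: "nat \<Rightarrow> real" and t assume t: "t \<in> {0..}" and s0: "\<forall>n. s n \<in> {0..}" and s: "s \<longlonglongrightarrow> t"
  then have sn: "s n \<ge> 0" and t: "t \<ge> 0" for n by auto
  obtain C where C: "C > 0" "\<And>n x. norm (T (s n) x) \<le> C * norm x" "\<And>x. norm (T t x) \<le> C * norm x"
    by (rule T_bound_seq[OF s sn]) blast
  have T: "(\<lambda>n. T (s n) x) \<longlonglongrightarrow> T t x" for x
    using sn t by (intro T_tendsto s tendsto_const) auto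
  have "(\<lambda>n. \<Sum>j. inner (T (s n) (qa j)) k * inner (T (s n) (qb j)) k)
      \<longlonglongrightarrow> (\<Sum>j. inner (T t (qa j)) k * inner (T t (qb j)) k)"
  proof (rule suminf_dominated)
    show "summable (\<lambda>j. (C * norm k)\<^sup>2 * (norm (qa j) * norm (qb j)))"
      by (rule summable_mult[OF Q_summable])
    have le: "\<bar>inner (T (s n) x) k\<bar> \<le> C * norm k * norm x" for n x
      using Cauchy_Schwarz_ineq2[of "T (s n) x" k] mult_right_mono[OF C(2)[of n x], of "norm k"] by (simp add: mult_ac)
    show "\<bar>inner (T (s n) (qa j)) k * inner (T (s n) (qb j)) k\<bar> \<le> (C * norm k)\<^sup>2 * (norm (qa j) * norm (qb j))" for j n
      using mult_mono[OF le[of n "qa j"] le[of n "qb j"]] C(1) by (simp add: abs_mult power2_eq_square mult_ac)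
  qed (auto intro!: tendsto_intros T)
  moreover have "(\<lambda>n. \<integral>y. jump (s n) k y \<partial>\<nu>) \<longlonglongrightarrow> (\<integral>y. jump t k y \<partial>\<nu>)"
  proof (rule nu_tendsto)
    show "norm (jump (s n) k y) \<le> (2 + (C * norm k)\<^sup>2) * min 1 ((norm y)\<^sup>2)" for n y
      using C by (intro jump_bound) auto
    show "(\<lambda>n. jump (s n) k y) \<longlonglongrightarrow> jump t k y" for y
      unfolding jump_def by (intro tendsto_intros T)
  qed (use sn t jump_measurable in auto)
  ultimately show "((\<lambda>s. Psi s k) \<circ> s) \<longlonglongrightarrow> Psi t k"
    unfolding Psi_def comp_def by (intro tendsto_intros T) auto
qed

section \<open>The characteristic function of the stochastic convolution\<close>

lemma char_increment:
  assumes "0 \<le> s" "0 \<le> u" "0 \<le> r"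
  shows "(\<integral>\<omega>. iexp (inner (T r (Z (s + u) \<omega> - Z s \<omega>)) k) \<partial>M) = exp (- (of_real u * Psi r k))"
proof -
  have [measurable]: "Z (s + u) \<in> borel_measurable M" "Z s \<in> borel_measurable M" "Z u \<in> borel_measurable M"
    using assms by auto
  let ?h = "hadj (T r) k"
  let ?e = "\<lambda>x. iexp (inner x ?h)"
  have "(\<integral>\<omega>. iexp (inner (T r (Z (s + u) \<omega> - Z s \<omega>)) k) \<partial>M)
      = (\<integral>\<omega>. ?e (Z (s + u) \<omega> - Z s \<omega>) \<partial>M)"
    by (simp add: inner_hadj[OF T_bounded_linear[OF assms(3)]])
  also have "\<dots> = (\<integral>x. ?e x \<partial>distr M borel (\<lambda>\<omega>. Z (s + u) \<omega> - Z s \<omega>))"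
    by (subst integral_distr) auto
  also have "distr M borel (\<lambda>\<omega>. Z (s + u) \<omega> - Z s \<omega>) = distr M borel (Z u)"
    using Z_levy assms by (simp add: levy_process_def)
  also have "(\<integral>x. ?e x \<partial>distr M borel (Z u)) = (\<integral>\<omega>. ?e (Z u \<omega>) \<partial>M)"
    by (subst integral_distr) auto
  also have "\<dots> = exp (- (of_real u * Psi r k))"
    using Z_char[OF assms(2), of ?h] by (simp add: Psi_levy_exponent[OF assms(3)])
  finally show ?thesis .
qed

text \<open>Independence and stationarity of the increments turn the characteristic function of the
  partition sum into a product of exponentials, that is, the exponential of a Riemann sum for
  \<open>Psi\<close>.\<close>

lemma char_riemann_sum:
  assumes t: "t > 0"
  defines "p \<equiv> \<lambda>n i. t * real i / real (Suc n)"
  shows "(\<integral>\<omega>. iexp (inner (\<Sum>i<Suc n. T (t - p n i) (Z (p n (Suc i)) \<omega> - Z (p n i) \<omega>)) k) \<partial>M)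
    = exp (- ((t / Suc n) *\<^sub>R (\<Sum>i<Suc n. Psi (t * Suc i / Suc n) k)))"
proof -
  define N where "N = real (Suc n)"
  have N: "N > 0" by (simp add: N_def)
  have pn: "p n i = t * real i / N" for i by (simp add: p_def N_def)
  have p0: "p n i \<ge> 0" for i using t by (simp add: p_def)
  have pS: "p n (Suc i) = p n i + t / N" for i using N by (simp add: pn field_simps)
  have pt: "t - p n i \<ge> 0" if "i < Suc n" for i
  proof -
    have "real i \<le> N" using that by (simp add: N_def)
    then have "t * real i \<le> t * N" using t by simp
    then show ?thesis using N by (simp add: pn field_simps)
  qed
  define X where "X i \<omega> = iexp (inner (T (t - p n i) (Z (p n (Suc i)) \<omega> - Z (p n i) \<omega>)) k)" for i \<omega>
  have "0 \<le> p n 0 \<and> (\<forall>i<Suc n. p n i < p n (Suc i)) \<longrightarrow>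
      indep_vars (\<lambda>_. borel) (\<lambda>i \<omega>. Z (p n (Suc i)) \<omega> - Z (p n i) \<omega>) {..<Suc n}"
    using Z_levy unfolding levy_process_def by blast
  moreover have "p n i < p n (Suc i)" for i using t N by (simp add: pS)
  ultimately have "indep_vars (\<lambda>_. borel) (\<lambda>i \<omega>. Z (p n (Suc i)) \<omega> - Z (p n i) \<omega>) {..<Suc n}"
    using p0 by blast
  then have "indep_vars (\<lambda>_. borel) (\<lambda>i \<omega>. (\<lambda>z. iexp (inner (T (t - p n i) z) k)) (Z (p n (Suc i)) \<omega> - Z (p n i) \<omega>)) {..<Suc n}"
    by (rule indep_vars_compose2) (use pt in auto)
  then have ind: "indep_vars (\<lambda>_. borel) X {..<Suc n}" unfolding X_def .
  have "X i \<in> borel_measurable M" if "i < Suc n" for i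
    unfolding X_def using p0 pt[OF that] by measurable
  then have "integrable M (X i)" if "i \<in> {..<Suc n}" for i
    using that by (intro integrable_const_bound[where B=1]) (auto simp: X_def)
  then have "(\<integral>\<omega>. (\<Prod>i<Suc n. X i \<omega>) \<partial>M) = (\<Prod>i<Suc n. \<integral>\<omega>. X i \<omega> \<partial>M)"
    by (intro indep_vars_lebesgue_integral ind) auto
  also have "\<dots> = (\<Prod>i<Suc n. exp (- (of_real (t / N) * Psi (t - p n i) k)))"
  proof (rule prod.cong[OF refl])
    fix i assume "i \<in> {..<Suc n}"
    then show "(\<integral>\<omega>. X i \<omega> \<partial>M) = exp (- (of_real (t / N) * Psi (t - p n i) k))"
      unfolding X_def pS using p0 pt t N by (intro char_increment) auto
  qed
  also have "\<dots> = exp (\<Sum>i<Suc n. - (of_real (t / N) * Psi (t - p n i) k))"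
    by (rule exp_sum[symmetric]) simp
  also have "(\<Sum>i<Suc n. - (of_real (t / N) * Psi (t - p n i) k)) = - ((t / N) *\<^sub>R (\<Sum>i<Suc n. Psi (t - p n i) k))"
    by (simp only: sum_negf scaleR_conv_of_real sum_distrib_left)
  \<comment> \<open>Left endpoints \<open>p n i\<close> enter through \<open>t - p n i\<close>, so
    reversing the order of summation yields right endpoints of the same uniform partition.\<close>
  also have "(\<Sum>i<Suc n. Psi (t - p n i) k) = (\<Sum>i<Suc n. Psi (t * Suc i / N) k)"
  proof -
    have "t - p n i = t * real (Suc (Suc n - Suc i)) / N" if "i < Suc n" for i
      using that N by (simp add: pn N_def of_nat_diff field_simps)
    then have "(\<Sum>i<Suc n. Psi (t - p n i) k) = (\<Sum>i<Suc n. Psi (t * real (Suc (Suc n - Suc i)) / N) k)"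
      by (intro sum.cong) auto
    also have "\<dots> = (\<Sum>i<Suc n. Psi (t * real (Suc i) / N) k)"
      by (rule sum.nat_diff_reindex)
    finally show ?thesis .
  qed
  finally have "(\<integral>\<omega>. (\<Prod>i<Suc n. X i \<omega>) \<partial>M) = exp (- ((t / N) *\<^sub>R (\<Sum>i<Suc n. Psi (t * Suc i / N) k)))" .
  moreover have "(\<Prod>i<Suc n. X i \<omega>) = iexp (inner (\<Sum>i<Suc n. T (t - p n i) (Z (p n (Suc i)) \<omega> - Z (p n i) \<omega>)) k)" for \<omega>
    unfolding X_def by (subst exp_sum[symmetric]) (simp_all add: inner_sum_left sum_distrib_left del: sum.lessThan_Suc)
  ultimately show ?thesis by (simp add: N_def del: sum.lessThan_Suc of_nat_Suc)
qed

lemma char_Y: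
  assumes t: "t \<ge> 0"
  shows "(\<integral>\<omega>. iexp (inner (Y t \<omega>) k) \<partial>M) = exp (- integral {0..t} (\<lambda>s. Psi s k))"
proof (cases "t = 0")
  case True
  \<comment> \<open>A strictly increasing partition of the interval from 0 to 0 has
    \<open>n = 0\<close> steps. Its sum is empty, which forces \<open>Y 0\<close> to vanish in
    probability.\<close>
  have "(\<lambda>n::nat. \<integral>\<omega>. iexp (inner 0 k) \<partial>M) \<longlonglongrightarrow> (\<integral>\<omega>. iexp (inner (Y t \<omega>) k) \<partial>M)"
  proof (rule char_tendsto_in_probability[OF prob_space_M])
    fix \<epsilon> :: real assume "\<epsilon> > 0"
    then obtain \<delta> where \<delta>: "\<And>n p. p 0 = 0 \<and> p n = 0 \<and> (\<forall>i<n. p i < p (Suc i) \<and> p (Suc i) - p i < \<delta>) \<longrightarrow>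
        measure M {\<omega>\<in>space M. norm ((\<Sum>i<n. T (0 - p i) (Z (p (Suc i)) \<omega> - Z (p i) \<omega>)) - Y 0 \<omega>) > \<epsilon>} < \<epsilon>"
      using Y_conv[of 0] unfolding stoch_convolution_def by blast
    show "\<forall>\<^sub>F n::nat in sequentially. measure M {\<omega> \<in> space M. norm (0 - Y t \<omega>) > \<epsilon>} < \<epsilon>"
      using \<delta>[of "\<lambda>_. 0" 0] True by simp
  qed (use t in auto)
  then show ?thesis using True by (simp add: LIMSEQ_const_iff prob_space)
next
  case False
  then have t0: "t > 0" using t by simp
  define p where "p n i = t * real i / real (Suc n)" for n i
  define R where "R n \<omega> = (\<Sum>i<Suc n. T (t - p n i) (Z (p n (Suc i)) \<omega> - Z (p n i) \<omega>))" for n \<omega>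
  have p0: "p n i \<ge> 0" for n i using t0 by (simp add: p_def)
  have pt: "t - p n i \<ge> 0" if "i < Suc n" for n i
  proof -
    have "t * real i \<le> t * real (Suc n)" using that t0 by simp
    then show ?thesis by (simp add: p_def field_simps)
  qed
  have "(\<lambda>n. \<integral>\<omega>. iexp (inner (R n \<omega>) k) \<partial>M) \<longlonglongrightarrow> (\<integral>\<omega>. iexp (inner (Y t \<omega>) k) \<partial>M)"
  proof (rule char_tendsto_in_probability[OF prob_space_M])
    show "R n \<in> borel_measurable M" for n
      unfolding R_def
    proof (rule borel_measurable_sum)
      fix i assume "i \<in> {..<Suc n}"
      then show "(\<lambda>\<omega>. T (t - p n i) (Z (p n (Suc i)) \<omega> - Z (p n i) \<omega>)) \<in> borel_measurable M"
        using p0 pt[of i n] by (intro measurable_compose[OF _ T_measurable]) auto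
    qed
    fix \<epsilon> :: real assume "\<epsilon> > 0"
    then obtain \<delta> where "\<delta> > 0" and \<delta>: "\<And>n p. p 0 = 0 \<and> p n = t \<and> (\<forall>i<n. p i < p (Suc i) \<and> p (Suc i) - p i < \<delta>) \<longrightarrow>
        measure M {\<omega>\<in>space M. norm ((\<Sum>i<n. T (t - p i) (Z (p (Suc i)) \<omega> - Z (p i) \<omega>)) - Y t \<omega>) > \<epsilon>} < \<epsilon>"
      using Y_conv[OF t] unfolding stoch_convolution_def by blast
    obtain m :: nat where m: "t / \<delta> < real m" using reals_Archimedean2 by blast
    have "measure M {\<omega> \<in> space M. norm (R n \<omega> - Y t \<omega>) > \<epsilon>} < \<epsilon>" if "n \<ge> m" for n
    proof -
      have "t / \<delta> < real (Suc n)" using m that by simp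
      then have "t / real (Suc n) < \<delta>" using \<open>\<delta> > 0\<close> by (simp add: field_simps)
      moreover have "p n (Suc i) - p n i = t / real (Suc n)" for i
        by (simp add: p_def diff_divide_distrib[symmetric] algebra_simps)
      moreover have "t / real (Suc n) > 0" using t0 by simp
      ultimately have "p n i < p n (Suc i) \<and> p n (Suc i) - p n i < \<delta>" for i by (metis diff_gt_0_iff_gt)
      moreover have "p n 0 = 0" "p n (Suc n) = t" by (simp_all add: p_def del: of_nat_Suc)
      ultimately show ?thesis unfolding R_def using \<delta>[of "p n" "Suc n"] by blast
    qed
    then show "\<forall>\<^sub>F n in sequentially. measure M {\<omega> \<in> space M. norm (R n \<omega> - Y t \<omega>) > \<epsilon>} < \<epsilon>"
      unfolding eventually_sequentially by blast
  qed (use t in auto)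
  moreover have "(\<lambda>n. exp (- ((t / Suc n) *\<^sub>R (\<Sum>i<Suc n. Psi (t * Suc i / Suc n) k)))) \<longlonglongrightarrow> exp (- integral {0..t} (\<lambda>s. Psi s k))"
    by (intro tendsto_intros riemann_sum_right_endpoints continuous_on_subset[OF Psi_continuous] t) auto
  ultimately show ?thesis
    unfolding R_def p_def char_riemann_sum[OF t0] by (rule LIMSEQ_unique)
qed

end

lemma jet2_cmult:
  assumes f: "jet2 C f p q"
  shows "jet2 (\<bar>c\<bar> * C) (\<lambda>x. c * f x) (\<lambda>x v. c * p x v) (\<lambda>x v w. c * q x v w)"
proof -
  note f' = f[unfolded jet2_def]
  show ?thesis
    unfolding jet2_def case_prod_beta' abs_mult mult.assoc
    using f' by (auto intro!: DERIV_cmult continuous_intros mult_left_mono simp: case_prod_beta' mult.assoc)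
qed

context ou_setting
begin

section \<open>The generator along the Ornstein-Uhlenbeck flow\<close>

abbreviation P :: "real \<Rightarrow> ('h \<Rightarrow> real) \<Rightarrow> 'h \<Rightarrow> real" where
  "P t f x \<equiv> ou_semigroup M T Y t f x"

text \<open>The values expected for the derivatives of \<open>P s f\<close> after differentiating
  under the expectation, taken as definitions. They depend on the jet alone, so they make sense
  before \<open>P s f\<close> is known to be differentiable and for jets that are not Frechet
  derivatives; \<open>inner_grad_P\<close> and \<open>L1_P\<close> make the identification.\<close>

definition Pd1 :: "('h \<Rightarrow> 'h \<Rightarrow> real) \<Rightarrow> real \<Rightarrow> 'h \<Rightarrow> 'h \<Rightarrow> real" where
  "Pd1 p s x v = (\<integral>\<omega>. p (T s x + Y s \<omega>) (T s v) \<partial>M)"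

definition Pd2 :: "('h \<Rightarrow> 'h \<Rightarrow> 'h \<Rightarrow> real) \<Rightarrow> real \<Rightarrow> 'h \<Rightarrow> 'h \<Rightarrow> 'h \<Rightarrow> real" where
  "Pd2 q s x v w = (\<integral>\<omega>. q (T s x + Y s \<omega>) (T s v) (T s w) \<partial>M)"

definition Pjump :: "('h \<Rightarrow> real) \<Rightarrow> ('h \<Rightarrow> 'h \<Rightarrow> real) \<Rightarrow> real \<Rightarrow> 'h \<Rightarrow> 'h \<Rightarrow> real" where
  "Pjump f p s x y = P s f (x + y) - P s f x - indicator (cball 0 1) y * Pd1 p s x y"

text \<open>\<open>gen1\<close> and \<open>gen0\<close> are \<open>L1\<close> and \<open>L0\<close> applied to \<open>P s f\<close>, written in terms of the jets of \<open>f\<close>.\<close>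

definition gen1 :: "('h \<Rightarrow> real) \<Rightarrow> ('h \<Rightarrow> 'h \<Rightarrow> real) \<Rightarrow> ('h \<Rightarrow> 'h \<Rightarrow> 'h \<Rightarrow> real) \<Rightarrow> real \<Rightarrow> 'h \<Rightarrow> real" where
  "gen1 f p q s x = (\<integral>y. Pjump f p s x y \<partial>\<nu>) + (\<Sum>j. Pd2 q s x (qa j) (qb j)) / 2 + Pd1 p s x a"

definition gen0 :: "('h \<Rightarrow> real) \<Rightarrow> ('h \<Rightarrow> 'h \<Rightarrow> real) \<Rightarrow> ('h \<Rightarrow> 'h \<Rightarrow> 'h \<Rightarrow> real) \<Rightarrow> real \<Rightarrow> 'h \<Rightarrow> real" where
  "gen0 f p q s x = Pd1 p s x (A x) + gen1 f p q s x"

text \<open>The gauge integral is part of the predicate and nothing is said about continuity in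
  \<open>s\<close>. This is what makes the class closed under bounded limits of jets, and continuity
  in time is derived from it later.\<close>

definition dynkin :: "'h \<Rightarrow> ('h \<Rightarrow> real) \<Rightarrow> bool" where
  "dynkin x f \<longleftrightarrow> (\<exists>C p q. jet2 C f p q \<and>
     (\<forall>t\<ge>0. ((\<lambda>s. gen0 f p q s x) has_integral (P t f x - f x)) {0..t}))"

lemma measurable_flow:
  assumes "s \<ge> 0" "continuous_on UNIV g"
  shows "(\<lambda>\<omega>. g (T s x + Y s \<omega>)) \<in> borel_measurable M"
  using assms(1) by (intro measurable_compose[OF _ borel_measurable_continuous_onI[OF assms(2)]]) measurable

lemma jet2_measurable:
  assumes "jet2 C f p q" "s \<ge> 0"
  shows "(\<lambda>\<omega>. f (T s x + Y s \<omega>)) \<in> borel_measurable M"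
    "(\<lambda>\<omega>. p (T s x + Y s \<omega>) v) \<in> borel_measurable M"
    "(\<lambda>\<omega>. q (T s x + Y s \<omega>) v w) \<in> borel_measurable M"
  by (intro measurable_flow assms jet2_continuous_on[OF assms(1)] continuous_intros)+

lemma jet2_integrable:
  assumes "jet2 C f p q" "s \<ge> 0"
  shows "integrable M (\<lambda>\<omega>. f (T s x + Y s \<omega>))"
    "integrable M (\<lambda>\<omega>. p (T s x + Y s \<omega>) v)"
    "integrable M (\<lambda>\<omega>. q (T s x + Y s \<omega>) v w)"
  using jet2D(6-8)[OF assms(1)] jet2_measurable[OF assms]
  by (auto intro: integrable_const_bound[where B = C] integrable_const_bound[where B = "C * norm v"]
      integrable_const_bound[where B = "C * norm v * norm w"])

text \<open>All four bounds are linear in \<open>C\<close> and otherwise depend only on the operator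
  bound \<open>K\<close>; this is the uniformity needed when the function varies.\<close>

lemma jet2_bounds:
  assumes f: "jet2 C f p q" and s: "s \<ge> 0" and K: "K \<ge> 0" "\<And>x. norm (T s x) \<le> K * norm x"
  shows "\<bar>P s f x\<bar> \<le> C" "\<bar>Pd1 p s x v\<bar> \<le> C * K * norm v" "\<bar>Pd2 q s x v w\<bar> \<le> C * K\<^sup>2 * (norm v * norm w)"
    "\<bar>Pjump f p s x y\<bar> \<le> C * (2 + K\<^sup>2) * min 1 ((norm y)\<^sup>2)"
proof -
  have C: "C \<ge> 0" by (rule jet2D(9)[OF f])
  show P: "\<bar>P s f x\<bar> \<le> C" for x
    unfolding ou_semigroup_def using integral_norm_le[of "\<lambda>\<omega>. f (T s x + Y s \<omega>)" C] jet2D(6)[OF f] by simp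
  have "\<bar>p z (T s v)\<bar> \<le> C * K * norm v" for z
    using jet2D(7)[OF f, of z "T s v"] mult_left_mono[OF K(2)[of v] C] by (simp add: mult.assoc)
  then show "\<bar>Pd1 p s x v\<bar> \<le> C * K * norm v"
    unfolding Pd1_def using integral_norm_le[of "\<lambda>\<omega>. p (T s x + Y s \<omega>) (T s v)" "C * K * norm v"] by simp
  have "\<bar>q z (T s v) (T s w)\<bar> \<le> C * K\<^sup>2 * (norm v * norm w)" for z
  proof -
    have "\<bar>q z (T s v) (T s w)\<bar> \<le> C * norm (T s v) * norm (T s w)" by (rule jet2D(8)[OF f])
    also have "\<dots> \<le> C * (K * norm v) * (K * norm w)" using C K by (intro mult_mono) auto
    finally show ?thesis by (simp add: power2_eq_square mult_ac)
  qed
  then show "\<bar>Pd2 q s x v w\<bar> \<le> C * K\<^sup>2 * (norm v * norm w)"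
    unfolding Pd2_def using integral_norm_le[of "\<lambda>\<omega>. q (T s x + Y s \<omega>) (T s v) (T s w)" "C * K\<^sup>2 * (norm v * norm w)"] by simp
  show "\<bar>Pjump f p s x y\<bar> \<le> C * (2 + K\<^sup>2) * min 1 ((norm y)\<^sup>2)"
  proof (cases "norm y \<le> 1")
    case True
    \<comment> \<open>By linearity of \<open>T s\<close> the increment under the expectation is
      \<open>T s y\<close>, so the three integrals merge and the Taylor bound for \<open>f\<close>
      applies for each outcome.\<close>
    have "Pjump f p s x y = (\<integral>\<omega>. f ((T s x + Y s \<omega>) + T s y) - f (T s x + Y s \<omega>) - p (T s x + Y s \<omega>) (T s y) \<partial>M)"
      using True jet2_integrable[OF f s, of "x + y"] jet2_integrable[OF f s, of x]
      by (simp add: Pjump_def ou_semigroup_def Pd1_def T_linear[OF s] add_ac)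
    also have "\<bar>\<dots>\<bar> \<le> C * (K\<^sup>2 * (norm y)\<^sup>2)"
      unfolding real_norm_def[symmetric]
    proof (rule integral_norm_le)
      fix \<omega>
      have "norm (f (T s x + Y s \<omega> + T s y) - f (T s x + Y s \<omega>) - p (T s x + Y s \<omega>) (T s y)) \<le> C * (norm (T s y))\<^sup>2"
        using jet2_taylor(2)[OF f] by simp
      also have "\<dots> \<le> C * (K * norm y)\<^sup>2" by (intro mult_left_mono power_mono K C) auto
      finally show "norm (f (T s x + Y s \<omega> + T s y) - f (T s x + Y s \<omega>) - p (T s x + Y s \<omega>) (T s y)) \<le> C * (K\<^sup>2 * (norm y)\<^sup>2)"
        by (simp add: power_mult_distrib)
    qed
    also have "\<dots> \<le> C * (2 + K\<^sup>2) * (norm y)\<^sup>2" using C by (simp add: algebra_simps)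
    also have "(norm y)\<^sup>2 = min 1 ((norm y)\<^sup>2)" using True by (simp add: power_le_one min_absorb2)
    finally show ?thesis .
  next
    case False
    then have "\<bar>Pjump f p s x y\<bar> \<le> 2 * C" using P[of "x + y"] P[of x] by (simp add: Pjump_def)
    also have "\<dots> \<le> C * (2 + K\<^sup>2)" using C by (simp add: algebra_simps)
    finally show ?thesis using False by (simp add: min_def one_le_power)
  qed
qed

text \<open>Continuity in space at a fixed time, which makes \<open>Pjump\<close> measurable in
  \<open>y\<close>. Continuity in time is a different matter, since there the law of
  \<open>Y s\<close> moves.\<close>

lemma jet2_P_tendsto:
  assumes f: "jet2 C f p q" and s: "s \<ge> 0" and x: "x \<longlonglongrightarrow> x'" and v: "v \<longlonglongrightarrow> v'"
  shows "(\<lambda>n. P s f (x n)) \<longlonglongrightarrow> P s f x'" "(\<lambda>n. Pd1 p s (x n) (v n)) \<longlonglongrightarrow> Pd1 p s x' v'"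
    "(\<lambda>n. Pd2 q s (x n) (v n) w) \<longlonglongrightarrow> Pd2 q s x' v' w"
proof -
  have Tc: "(\<lambda>n. T s (z n)) \<longlonglongrightarrow> T s z'" if "z \<longlonglongrightarrow> z'" for z z'
    by (rule bounded_linear.tendsto[OF T_bounded_linear[OF s] that])
  have C: "C \<ge> 0" by (rule jet2D(9)[OF f])
  obtain B where B: "\<And>n. norm (T s (v n)) \<le> B"
    using convergent_imp_bounded[OF Tc[OF v]] unfolding bounded_iff by auto
  have pB: "norm (p z (T s (v n))) \<le> C * B" for z n
    using jet2D(7)[OF f, of z "T s (v n)"] mult_left_mono[OF B[of n] C] by simp
  have qB: "norm (q z (T s (v n)) (T s w)) \<le> C * B * norm (T s w)" for z n
    using jet2D(8)[OF f, of z "T s (v n)" "T s w"] mult_right_mono[OF mult_left_mono[OF B[of n] C], of "norm (T s w)"] by simp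
  note m = jet2_measurable[OF f s]
  have pt: "(\<lambda>n. p (z n) (u n)) \<longlonglongrightarrow> p z' u'" if "z \<longlonglongrightarrow> z'" "u \<longlonglongrightarrow> u'" for z u z' u'
    using continuous_on_tendsto_compose[OF jet2D(4)[OF f] tendsto_Pair[OF that]] by simp
  have qt: "(\<lambda>n. q (z n) (u n) (T s w)) \<longlonglongrightarrow> q z' u' (T s w)" if "z \<longlonglongrightarrow> z'" "u \<longlonglongrightarrow> u'" for z u z' u'
    using continuous_on_tendsto_compose[OF jet2D(5)[OF f] tendsto_Pair[OF that(1) tendsto_Pair[OF that(2) tendsto_const]]] by simp
  show "(\<lambda>n. P s f (x n)) \<longlonglongrightarrow> P s f x'"
    unfolding ou_semigroup_def using jet2D(6)[OF f]
    by (intro tendsto_expectation m continuous_on_tendsto_compose[OF jet2D(3)[OF f]] tendsto_intros Tc x) auto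
  show "(\<lambda>n. Pd1 p s (x n) (v n)) \<longlonglongrightarrow> Pd1 p s x' v'"
    unfolding Pd1_def by (intro tendsto_expectation[where B = "C * B"] m pt tendsto_intros Tc x v pB)
  show "(\<lambda>n. Pd2 q s (x n) (v n) w) \<longlonglongrightarrow> Pd2 q s x' v' w"
    unfolding Pd2_def by (intro tendsto_expectation[where B = "C * B * norm (T s w)"] m qt tendsto_intros Tc x v qB)
qed

lemma Pjump_measurable:
  assumes f: "jet2 C f p q" and s: "s \<ge> 0"
  shows "Pjump f p s x \<in> borel_measurable borel"
proof -
  have [measurable]: "cball (0::'h) 1 \<in> sets borel" by simp
  have "continuous_on UNIV (\<lambda>y. P s f (x + y))" "continuous_on UNIV (Pd1 p s x)"
    unfolding continuous_on_sequentially comp_def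
    by (auto intro!: jet2_P_tendsto[OF f s] tendsto_intros)
  then have [measurable]: "(\<lambda>y. P s f (x + y)) \<in> borel_measurable borel" "Pd1 p s x \<in> borel_measurable borel"
    by (auto intro: borel_measurable_continuous_onI)
  show ?thesis unfolding Pjump_def[abs_def] by measurable
qed

lemma Pjump_integrable: "jet2 C f p q \<Longrightarrow> s \<ge> 0 \<Longrightarrow> integrable \<nu> (Pjump f p s x)"
proof -
  assume *: "jet2 C f p q" "s \<ge> 0"
  obtain K where K: "K > 0" "\<And>x. norm (T s x) \<le> K * norm x" using c0_bound[OF T_c0, of s] * by auto
  show ?thesis
    by (rule nu_integrable[OF Pjump_measurable[OF *]])
      (use jet2_bounds(4)[OF * less_imp_le[OF K(1)] K(2)] in simp)
qed

lemma Pd2_summable: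
  assumes "jet2 C f p q" "s \<ge> 0"
  shows "summable (\<lambda>j. Pd2 q s x (qa j) (qb j))"
proof -
  obtain K where K: "K > 0" "\<And>x. norm (T s x) \<le> K * norm x" using c0_bound[OF T_c0, of s] assms by auto
  show ?thesis
    by (rule summable_comparison_test[OF _ summable_mult[OF Q_summable, of "C * K\<^sup>2"]])
      (use jet2_bounds(3)[OF assms less_imp_le[OF K(1)] K(2)] in simp)
qed

text \<open>The constant \<open>B\<close> depends on \<open>t\<close> and \<open>x\<close> but not
  on the jet, and the second bound is uniform in the space point, because the drift term occurs only
  in \<open>gen0\<close>. The first bound supplies the majorant when the function varies, the second
  when the point varies.\<close>

lemma gen_bound:
  obtains B where "\<And>C f p q s. jet2 C f p q \<Longrightarrow> s \<in> {0..t} \<Longrightarrow> \<bar>gen0 f p q s x\<bar> \<le> C * B"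
    "\<And>C f p q s x. jet2 C f p q \<Longrightarrow> s \<in> {0..t} \<Longrightarrow> \<bar>gen1 f p q s x\<bar> \<le> C * B" "B \<ge> 0"
proof -
  obtain K where K: "K > 0" "\<And>s x. s \<in> {0..t} \<Longrightarrow> norm (T s x) \<le> K * norm x"
    using c0_bound[OF T_c0, of t] by blast
  define W where "W = (\<integral>y. min 1 ((norm y)\<^sup>2) \<partial>\<nu>)"
  define S where "S = (\<Sum>j. norm (qa j) * norm (qb j))"
  define B1 where "B1 = (2 + K\<^sup>2) * W + K\<^sup>2 * S + K * norm a"
  have pos: "W \<ge> 0" "S \<ge> 0"
    unfolding W_def S_def by (auto intro!: Bochner_Integration.integral_nonneg suminf_nonneg Q_summable)
  have B1: "B1 \<ge> 0" using pos K by (simp add: B1_def)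
  have g1: "\<bar>gen1 f p q s x\<bar> \<le> C * B1" if f: "jet2 C f p q" and s: "s \<in> {0..t}" for C f p q s x
  proof -
    have s0: "s \<ge> 0" using s by simp
    note b = jet2_bounds[OF f s0 less_imp_le[OF K(1)] K(2)[OF s]]
    have C: "C \<ge> 0" by (rule jet2D(9)[OF f])
    have "\<bar>\<integral>y. Pjump f p s x y \<partial>\<nu>\<bar> \<le> (\<integral>y. \<bar>Pjump f p s x y\<bar> \<partial>\<nu>)"
      using integral_norm_bound[of \<nu> "Pjump f p s x"] by simp
    also have "\<dots> \<le> (\<integral>y. C * (2 + K\<^sup>2) * min 1 ((norm y)\<^sup>2) \<partial>\<nu>)"
      using Pjump_integrable[OF f s0] nu_weight_integrable b(4) by (intro integral_mono) auto
    finally have 1: "\<bar>\<integral>y. Pjump f p s x y \<partial>\<nu>\<bar> \<le> C * (2 + K\<^sup>2) * W" by (simp add: W_def)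
    have "\<bar>\<Sum>j. Pd2 q s x (qa j) (qb j)\<bar> \<le> (\<Sum>j. C * K\<^sup>2 * (norm (qa j) * norm (qb j)))"
      unfolding real_norm_def[symmetric] using b(3)
      by (intro norm_suminf_le summable_mult Q_summable) simp
    then have 2: "\<bar>\<Sum>j. Pd2 q s x (qa j) (qb j)\<bar> \<le> C * K\<^sup>2 * S"
      unfolding S_def by (simp add: suminf_mult[OF Q_summable])
    have 3: "\<bar>Pd1 p s x a\<bar> \<le> C * K * norm a" by (rule b)
    have "0 \<le> C * K\<^sup>2 * S" using C pos by simp
    then show ?thesis using 1 2 3 unfolding gen1_def B1_def
      by (simp add: algebra_simps)
  qed
  have "\<bar>gen0 f p q s x\<bar> \<le> C * (B1 + K * norm (A x))" if f: "jet2 C f p q" and s: "s \<in> {0..t}" for C f p q s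
    using g1[OF that, of x] jet2_bounds(2)[OF f _ less_imp_le[OF K(1)] K(2)[OF s], of x "A x"] s
    unfolding gen0_def by (simp add: algebra_simps)
  moreover have "\<bar>gen1 f p q s x\<bar> \<le> C * (B1 + K * norm (A x'))" if f: "jet2 C f p q" and s: "s \<in> {0..t}" for C f p q s x x'
  proof -
    have "0 \<le> C * (K * norm (A x'))" using jet2D(9)[OF f] K by simp
    then show ?thesis using g1[OF that, of x] by (simp add: distrib_left)
  qed
  ultimately show ?thesis using that[of "B1 + K * norm (A x)"] B1 K by simp
qed

text \<open>Reduces convergence of the nonlocal and trace terms to convergence at fixed directions.
  It serves both a varying function at fixed time and point, and a fixed function at varying time
  and point.\<close>

lemma gen1_tendsto:
  assumes f: "\<And>n. jet2 C (f n) (p n) (q n)" and f': "jet2 C f' p' q'"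
    and s: "s \<longlonglongrightarrow> s'" "\<And>n. s n \<ge> 0" "s' \<ge> 0"
    and P: "\<And>y. (\<lambda>n. P (s n) (f n) (x n + y)) \<longlonglongrightarrow> P s' f' (x' + y)"
    and Pd1: "\<And>v. (\<lambda>n. Pd1 (p n) (s n) (x n) v) \<longlonglongrightarrow> Pd1 p' s' x' v"
    and Pd2: "\<And>v w. (\<lambda>n. Pd2 (q n) (s n) (x n) v w) \<longlonglongrightarrow> Pd2 q' s' x' v w"
  shows "(\<lambda>n. gen1 (f n) (p n) (q n) (s n) (x n)) \<longlonglongrightarrow> gen1 f' p' q' s' x'"
proof -
  obtain K where K: "K > 0" "\<And>n x. norm (T (s n) x) \<le> K * norm x"
    by (rule T_bound_seq[OF s(1,2)]) blast
  note b = jet2_bounds[OF f s(2) less_imp_le[OF K(1)] K(2)]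
  have P0: "(\<lambda>n. P (s n) (f n) (x n)) \<longlonglongrightarrow> P s' f' x'" using P[of 0] by simp
  have "(\<lambda>n. \<integral>y. Pjump (f n) (p n) (s n) (x n) y \<partial>\<nu>) \<longlonglongrightarrow> (\<integral>y. Pjump f' p' s' x' y \<partial>\<nu>)"
  proof (rule nu_tendsto[where K = "C * (2 + K\<^sup>2)"])
    show "(\<lambda>n. Pjump (f n) (p n) (s n) (x n) y) \<longlonglongrightarrow> Pjump f' p' s' x' y" for y
      unfolding Pjump_def by (intro tendsto_intros P P0 Pd1)
    show "norm (Pjump (f n) (p n) (s n) (x n) y) \<le> C * (2 + K\<^sup>2) * min 1 ((norm y)\<^sup>2)" for n y
      using b(4) by simp
  qed (auto intro!: Pjump_measurable[OF f s(2)] Pjump_measurable[OF f' s(3)])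
  moreover have "(\<lambda>n. \<Sum>j. Pd2 (q n) (s n) (x n) (qa j) (qb j)) \<longlonglongrightarrow> (\<Sum>j. Pd2 q' s' x' (qa j) (qb j))"
    by (rule suminf_dominated[OF Pd2 b(3) summable_mult[OF Q_summable]]) simp
  ultimately show ?thesis unfolding gen1_def by (intro tendsto_intros Pd1) auto
qed

text \<open>The common constant \<open>C\<close> is essential: it yields dominated convergence first
  under the expectation, then against \<nu> and in the trace series, and finally in time on
  \<open>{0..t}\<close>.\<close>

lemma dynkin_limit:
  assumes f: "\<And>n. jet2 C (f n) (p n) (q n)" and f': "jet2 C f' p' q'"
    and conv: "\<And>z. (\<lambda>n. f n z) \<longlonglongrightarrow> f' z" "\<And>z v. (\<lambda>n. p n z v) \<longlonglongrightarrow> p' z v"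
      "\<And>z v w. (\<lambda>n. q n z v w) \<longlonglongrightarrow> q' z v w"
    and dyn: "\<And>n. dynkin x (f n)"
  shows "dynkin x f'"
proof -
  have Pc: "(\<lambda>n. P s (f n) z) \<longlonglongrightarrow> P s f' z" if "s \<ge> 0" for s z
    unfolding ou_semigroup_def using jet2D(6)[OF f]
    by (intro tendsto_expectation conv jet2_measurable[OF f that] jet2_measurable[OF f' that]) auto
  have P1c: "(\<lambda>n. Pd1 (p n) s z v) \<longlonglongrightarrow> Pd1 p' s z v" if "s \<ge> 0" for s z v
    unfolding Pd1_def using jet2D(7)[OF f]
    by (intro tendsto_expectation conv jet2_measurable[OF f that] jet2_measurable[OF f' that]) auto
  have P2c: "(\<lambda>n. Pd2 (q n) s z v w) \<longlonglongrightarrow> Pd2 q' s z v w" if "s \<ge> 0" for s z v w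
    unfolding Pd2_def using jet2D(8)[OF f]
    by (intro tendsto_expectation conv jet2_measurable[OF f that] jet2_measurable[OF f' that]) auto
  have "((\<lambda>s. gen0 f' p' q' s x) has_integral (P t f' x - f' x)) {0..t}" if t: "t \<ge> 0" for t
  proof -
    obtain B where B: "\<And>C f p q s. jet2 C f p q \<Longrightarrow> s \<in> {0..t} \<Longrightarrow> \<bar>gen0 f p q s x\<bar> \<le> C * B"
      by (rule gen_bound[of t x]) blast
    show ?thesis
    proof (rule has_integral_dominated_convergence)
      show "((\<lambda>s. gen0 (f n) (p n) (q n) s x) has_integral (P t (f n) x - f n x)) {0..t}" for n
        using dyn[of n] jet2_unique[OF f[of n]] t unfolding dynkin_def by metis
      show "(\<lambda>s. C * B) integrable_on {0..t}" by (intro integrable_const_ivl)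
      show "\<forall>s\<in>{0..t}. norm (gen0 (f n) (p n) (q n) s x) \<le> C * B" for n using B[OF f] by simp
      show "\<forall>s\<in>{0..t}. (\<lambda>n. gen0 (f n) (p n) (q n) s x) \<longlonglongrightarrow> gen0 f' p' q' s x"
        unfolding gen0_def by (auto intro!: tendsto_intros gen1_tendsto[OF f f'] Pc P1c P2c)
      show "(\<lambda>n. P t (f n) x - f n x) \<longlonglongrightarrow> P t f' x - f' x" by (intro tendsto_intros Pc conv t)
    qed
  qed
  then show ?thesis using f' unfolding dynkin_def by blast
qed

lemma dynkin_add:
  assumes "dynkin x f" "dynkin x g"
  shows "dynkin x (\<lambda>z. f z + g z)"
proof -
  obtain C p q where f: "jet2 C f p q" "\<And>t. t \<ge> 0 \<Longrightarrow> ((\<lambda>s. gen0 f p q s x) has_integral (P t f x - f x)) {0..t}"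
    using assms(1) unfolding dynkin_def by blast
  obtain D r u where g: "jet2 D g r u" "\<And>t. t \<ge> 0 \<Longrightarrow> ((\<lambda>s. gen0 g r u s x) has_integral (P t g x - g x)) {0..t}"
    using assms(2) unfolding dynkin_def by blast
  let ?p = "\<lambda>z v. p z v + r z v" and ?q = "\<lambda>z v w. q z v w + u z v w"
  have Pa: "P s (\<lambda>z. f z + g z) z = P s f z + P s g z" if "s \<ge> 0" for s z
    unfolding ou_semigroup_def by (intro Bochner_Integration.integral_add jet2_integrable[OF f(1) that] jet2_integrable[OF g(1) that])
  have P1a: "Pd1 ?p s z v = Pd1 p s z v + Pd1 r s z v" if "s \<ge> 0" for s z v
    unfolding Pd1_def by (intro Bochner_Integration.integral_add jet2_integrable[OF f(1) that] jet2_integrable[OF g(1) that])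
  have P2a: "Pd2 ?q s z v w = Pd2 q s z v w + Pd2 u s z v w" if "s \<ge> 0" for s z v w
    unfolding Pd2_def by (intro Bochner_Integration.integral_add jet2_integrable[OF f(1) that] jet2_integrable[OF g(1) that])
  have Pja: "Pjump (\<lambda>z. f z + g z) ?p s z y = Pjump f p s z y + Pjump g r s z y" if "s \<ge> 0" for s z y
    unfolding Pjump_def Pa[OF that] P1a[OF that] by (simp add: algebra_simps)
  have g0: "gen0 (\<lambda>z. f z + g z) ?p ?q s x = gen0 f p q s x + gen0 g r u s x" if "s \<ge> 0" for s
    unfolding gen0_def gen1_def Pja[OF that] P1a[OF that] P2a[OF that]
      Bochner_Integration.integral_add[OF Pjump_integrable[OF f(1) that] Pjump_integrable[OF g(1) that]]
      suminf_add[OF Pd2_summable[OF f(1) that] Pd2_summable[OF g(1) that], symmetric]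
    by (simp add: field_simps)
  have "((\<lambda>s. gen0 (\<lambda>z. f z + g z) ?p ?q s x) has_integral (P t (\<lambda>z. f z + g z) x - (f x + g x))) {0..t}" if t: "t \<ge> 0" for t
  proof (rule has_integral_eq)
    show "((\<lambda>s. gen0 f p q s x + gen0 g r u s x) has_integral (P t (\<lambda>z. f z + g z) x - (f x + g x))) {0..t}"
      using has_integral_add[OF f(2)[OF t] g(2)[OF t]] by (simp add: Pa[OF t] algebra_simps)
  qed (use g0 in auto)
  then show ?thesis unfolding dynkin_def using jet2_add[OF f(1) g(1)] by blast
qed

lemma dynkin_cmult:
  assumes "dynkin x f"
  shows "dynkin x (\<lambda>z. c * f z)"
proof -
  obtain C p q where f: "jet2 C f p q" "\<And>t. t \<ge> 0 \<Longrightarrow> ((\<lambda>s. gen0 f p q s x) has_integral (P t f x - f x)) {0..t}"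
    using assms(1) unfolding dynkin_def by blast
  have Pa: "P s (\<lambda>z. c * f z) z = c * P s f z" for s z
    unfolding ou_semigroup_def by simp
  have P1a: "Pd1 (\<lambda>z v. c * p z v) s z v = c * Pd1 p s z v" for s z v
    unfolding Pd1_def by simp
  have P2a: "Pd2 (\<lambda>z v w. c * q z v w) s z v w = c * Pd2 q s z v w" for s z v w
    unfolding Pd2_def by simp
  have Pja: "Pjump (\<lambda>z. c * f z) (\<lambda>z v. c * p z v) s z y = c * Pjump f p s z y" for s z y
    unfolding Pjump_def Pa P1a by (simp add: algebra_simps)
  have g0: "gen0 (\<lambda>z. c * f z) (\<lambda>z v. c * p z v) (\<lambda>z v w. c * q z v w) s x = c * gen0 f p q s x" if "s \<ge> 0" for s
    unfolding gen0_def gen1_def Pja P1a P2a suminf_mult[OF Pd2_summable[OF f(1) that]]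
    by (simp add: field_simps)
  have "((\<lambda>s. gen0 (\<lambda>z. c * f z) (\<lambda>z v. c * p z v) (\<lambda>z v w. c * q z v w) s x) has_integral (P t (\<lambda>z. c * f z) x - c * f x)) {0..t}" if t: "t \<ge> 0" for t
  proof (rule has_integral_eq)
    show "((\<lambda>s. c * gen0 f p q s x) has_integral (P t (\<lambda>z. c * f z) x - c * f x)) {0..t}"
      using has_integral_mult_right[OF f(2)[OF t], of c] by (simp add: Pa algebra_simps)
  qed (use g0 in auto)
  then show ?thesis unfolding dynkin_def using jet2_cmult[OF f(1)] by blast
qed

lemma Psi_summable:
  assumes "s \<ge> 0"
  shows "summable (\<lambda>j. inner (T s (qa j)) k * inner (T s (qb j)) k)"
proof -
  obtain K where K: "K > 0" "\<And>x. norm (T s x) \<le> K * norm x" using c0_bound[OF T_c0, of s] assms by auto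
  have le: "\<bar>inner (T s x) k\<bar> \<le> K * norm k * norm x" for x
    using Cauchy_Schwarz_ineq2[of "T s x" k] mult_right_mono[OF K(2)[of x], of "norm k"] by (simp add: mult_ac)
  have "norm (inner (T s (qa j)) k * inner (T s (qb j)) k) \<le> (K * norm k)\<^sup>2 * (norm (qa j) * norm (qb j))" for j
    using mult_mono[OF le[of "qa j"] le[of "qb j"]] K(1) by (simp add: abs_mult power2_eq_square mult_ac)
  then show ?thesis
    by (intro summable_comparison_test[OF _ summable_mult[OF Q_summable, of "(K * norm k)\<^sup>2"]]) blast
qed

text \<open>Let \<open>\<phi> s z\<close> be the expected complex character along the flow. By
  \<open>char_Y\<close> it is an explicit exponential, and its derivative in \<open>s\<close> at
  \<open>z = x\<close> is \<open>\<phi> s x\<close> times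
  \<open>\<i> * of_real (inner (T s (A x)) k) - Psi s k\<close>. The real part of this product is
  exactly \<open>gen0\<close>, so the fundamental theorem of calculus applies.\<close>

lemma dynkin_cos:
  assumes x: "x \<in> DA"
  shows "dynkin x (\<lambda>z. cos (inner z k + \<theta>))"
proof -
  let ?f = "\<lambda>z. cos (inner z k + \<theta>)" and ?p = "\<lambda>z v. - sin (inner z k + \<theta>) * inner v k"
    and ?q = "\<lambda>z v w. - cos (inner z k + \<theta>) * inner v k * inner w k"
  define \<phi> where "\<phi> s z = (\<integral>\<omega>. iexp (inner (T s z + Y s \<omega>) k + \<theta>) \<partial>M)" for s z
  have int: "integrable M (\<lambda>\<omega>. iexp (inner (T s z + Y s \<omega>) k + \<theta>))" if "s \<ge> 0" for s z
    using that by (intro integrable_const_bound[where B=1]) (auto simp del: of_real_add)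
  have \<phi>_eq: "\<phi> s z = exp (\<i> * complex_of_real (inner (T s z) k + \<theta>) - integral {0..s} (\<lambda>s. Psi s k))" if "s \<ge> 0" for s z
  proof -
    have "\<phi> s z = (\<integral>\<omega>. iexp (inner (T s z) k + \<theta>) * iexp (inner (Y s \<omega>) k) \<partial>M)"
      unfolding \<phi>_def by (simp add: exp_add[symmetric] inner_add_left algebra_simps)
    then show ?thesis using char_Y[OF that, of k] by (simp add: exp_diff exp_minus field_simps)
  qed
  have \<phi>_add: "\<phi> s (z + y) = \<phi> s z * iexp (inner (T s y) k)" if "s \<ge> 0" for s z y
    unfolding \<phi>_eq[OF that] by (simp add: T_linear[OF that] inner_add_left exp_add[symmetric] algebra_simps)
  have cosE: "(\<integral>\<omega>. cos (inner (T s z + Y s \<omega>) k + \<theta>) \<partial>M) = Re (\<phi> s z)"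
    and sinE: "(\<integral>\<omega>. sin (inner (T s z + Y s \<omega>) k + \<theta>) \<partial>M) = Im (\<phi> s z)" if "s \<ge> 0" for s z
    using integral_Re[OF int[OF that, of z]] integral_Im[OF int[OF that, of z]]
    unfolding \<phi>_def by (simp_all add: Re_exp Im_exp del: of_real_add)
  have P: "P s ?f z = Re (\<phi> s z)" if "s \<ge> 0" for s z
    unfolding ou_semigroup_def by (rule cosE[OF that])
  have P1: "Pd1 ?p s z v = - Im (\<phi> s z) * inner (T s v) k" if "s \<ge> 0" for s z v
    unfolding Pd1_def using sinE[OF that, of z] by simp
  have P2: "Pd2 ?q s z v w = - Re (\<phi> s z) * (inner (T s v) k * inner (T s w) k)" if "s \<ge> 0" for s z v w
    unfolding Pd2_def using cosE[OF that, of z] by (simp add: mult.assoc)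
  \<comment> \<open>Moving the starting point by \<open>y\<close> multiplies \<open>\<phi>\<close>
    by one character, which makes the jump term a multiple of the Levy-Khintchine integrand.\<close>
  have Pj: "Pjump ?f ?p s z y = Re (\<phi> s z * jump s k y)" if "s \<ge> 0" for s z y
    unfolding Pjump_def P[OF that] P1[OF that] \<phi>_add[OF that] jump_def
    by (simp add: algebra_simps)
  have g0: "gen0 ?f ?p ?q s x = Re (\<phi> s x * (\<i> * of_real (inner (T s (A x)) k) - Psi s k))" if s: "s \<ge> 0" for s
  proof -
    have 1: "(\<integral>y. Pjump ?f ?p s x y \<partial>\<nu>) = Re (\<phi> s x * (\<integral>y. jump s k y \<partial>\<nu>))"
      unfolding Pj[OF s] using jump_integrable[OF s, of k]
      by (subst integral_Re) simp_all
    have sm: "summable (\<lambda>j. inner (T s (qa j)) k * inner (T s (qb j)) k)"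
      by (rule Psi_summable[OF s])
    show ?thesis
      unfolding gen0_def gen1_def 1 P1[OF s] P2[OF s] suminf_mult[OF sm] Psi_def
      by (simp add: algebra_simps)
  qed
  have "((\<lambda>s. gen0 ?f ?p ?q s x) has_integral (P t ?f x - ?f x)) {0..t}" if t: "t \<ge> 0" for t
  proof -
    have d: "((\<lambda>s. Re (\<phi> s x)) has_vector_derivative gen0 ?f ?p ?q s x) (at s within {0..t})" if s: "s \<in> {0..t}" for s
    proof -
      have "((\<lambda>s. T s x) has_vector_derivative T s (A x)) (at s within {0..t})"
        by (rule has_vector_derivative_within_subset[OF generator_has_vector_derivative[OF A_gen x]]) (use s in auto)
      from bounded_linear.has_vector_derivative[OF bounded_linear_inner_left this, of k]
      have "((\<lambda>s. inner (T s x) k + \<theta>) has_real_derivative inner (T s (A x)) k + 0) (at s within {0..t})"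
        by (intro DERIV_add DERIV_const) (simp add: has_real_derivative_iff_has_vector_derivative)
      then have "((\<lambda>s. \<i> * complex_of_real (inner (T s x) k + \<theta>)) has_vector_derivative \<i> * of_real (inner (T s (A x)) k + 0)) (at s within {0..t})"
        by (intro has_vector_derivative_mult_right has_vector_derivative_of_real)
      moreover have "((\<lambda>u. integral {0..u} (\<lambda>s. Psi s k)) has_vector_derivative Psi s k) (at s within {0..t})"
        by (rule integral_has_vector_derivative[OF continuous_on_subset[OF Psi_continuous] s]) auto
      ultimately have "((\<lambda>s. \<i> * complex_of_real (inner (T s x) k + \<theta>) - integral {0..s} (\<lambda>s. Psi s k)) has_vector_derivative
          \<i> * of_real (inner (T s (A x)) k) - Psi s k) (at s within {0..t})"
        using has_vector_derivative_diff by fastforce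
      from field_vector_diff_chain_within[OF this DERIV_subset[OF DERIV_exp]]
      have "((\<lambda>s. exp (\<i> * complex_of_real (inner (T s x) k + \<theta>) - integral {0..s} (\<lambda>s. Psi s k))) has_vector_derivative
          (\<i> * of_real (inner (T s (A x)) k) - Psi s k) * \<phi> s x) (at s within {0..t})"
        using \<phi>_eq[of s x] s by (simp add: comp_def)
      then have "((\<lambda>s. \<phi> s x) has_vector_derivative (\<i> * of_real (inner (T s (A x)) k) - Psi s k) * \<phi> s x) (at s within {0..t})"
        by (rule has_vector_derivative_transform[rotated 2]) (use s \<phi>_eq in auto)
      from bounded_linear.has_vector_derivative[OF bounded_linear_Re this] show ?thesis
        using g0[of s] s by (simp only: mult.commute atLeastAtMost_iff)
    qed
    have "\<phi> 0 x = iexp (inner x k + \<theta>)"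
      using \<phi>_eq[of 0 x] by (simp add: c0_zero[OF T_c0])
    then have "Re (\<phi> 0 x) = ?f x" by (simp add: Re_exp del: of_real_add)
    then show ?thesis
      using fundamental_theorem_of_calculus[OF t d] P[OF t] by simp
  qed
  then show ?thesis unfolding dynkin_def using jet2_cos by blast
qed

end

section \<open>An approximate identity of trigonometric polynomials\<close>

lemma periodic_integral_shift:
  fixes F :: "real \<Rightarrow> real"
  assumes cont: "continuous_on UNIV F" and per: "\<And>u. F (u + 2 * pi) = F u"
  shows "integral {-pi..pi} (\<lambda>u. F (u + r)) = integral {-pi..pi} F"
proof -
  have int: "F integrable_on {a..b}" for a b
    using cont by (intro integrable_continuous_real continuous_on_subset[OF cont]) auto
  have comb: "integral {a..b} F + integral {b..c} F = integral {a..c} F" if "a \<le> b" "b \<le> c" for a b c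
    by (rule Henstock_Kurzweil_Integration.integral_combine[OF that int])
  have shift: "integral {a + d..b + d} F = integral {a..b} (\<lambda>u. F (u + d))" for a b d
    using integral_shift_real_ivl[of "a + d" d "b + d" F] by simp
  have per': "integral {a + 2 * pi..b + 2 * pi} F = integral {a..b} F" for a b
    by (simp add: shift per)
  have window: "integral {-pi + r..pi + r} F = integral {-pi..pi} F" if "0 \<le> r" for r
  proof (cases "r \<le> 2 * pi")
    case True
    then show ?thesis
      using comb[of "-pi" "-pi + r" "pi + r"] comb[of "-pi" pi "pi + r"] per'[of "-pi" "-pi + r"] that
      by (simp add: add.commute)
  next
    case False
    have "integral {-pi..-pi + r} F + integral {-pi + r..pi + r} F = integral {-pi..pi} F + integral {pi..pi + r} F"
      using comb[of "-pi" "-pi + r" "pi + r"] comb[of "-pi" pi "pi + r"] that by simp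
    then show ?thesis using per'[of "-pi" "-pi + r"] by (simp add: add.commute)
  qed
  have "integral {-pi + r..pi + r} F = integral {-pi..pi} F"
  proof (cases "0 \<le> r")
    case False
    \<comment> \<open>Since \<open>2 * pi\<close> exceeds 1, this many periods make the shift
      nonnegative.\<close>
    define n where "n = nat \<lceil>\<bar>r\<bar>\<rceil>"
    have n: "0 \<le> r + real n * (2 * pi)"
    proof -
      have "\<bar>r\<bar> \<le> real n" by (simp add: n_def)
      also have "real n * 1 \<le> real n * (2 * pi)" using pi_gt3 by (intro mult_left_mono) auto
      finally show ?thesis by simp
    qed
    have "integral {a + real m * (2 * pi)..b + real m * (2 * pi)} F = integral {a..b} F" for a b m
    proof (induction m)
      case (Suc m)
      then show ?case using per'[of "a + real m * (2 * pi)" "b + real m * (2 * pi)"] by (simp add: algebra_simps)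
    qed simp
    from this[of "-pi + r" n "pi + r"] show ?thesis using window[OF n] by (simp only: add.assoc)
  qed (rule window)
  then show ?thesis by (simp only: shift)
qed

text \<open>The de la Vallee Poussin kernel, since
  \<open>(1 + cos u) / 2 = (cos (u / 2)) ^ 2\<close>. It is nonnegative, has mass 1 and is a
  trigonometric polynomial of degree \<open>N\<close>, so it separates into finitely many
  characters.\<close>

definition cos_kernel :: "nat \<Rightarrow> real \<Rightarrow> real" where
  "cos_kernel N u = ((1 + cos u) / 2) ^ N / integral {-pi..pi} (\<lambda>u. ((1 + cos u) / 2) ^ N)"

lemma half_one_plus_cos_nonneg: "0 \<le> (1 + cos (u::real)) / 2"
  using add_left_mono[OF cos_ge_minus_one[of u], of 1] by simp

lemma cos_kernel_mass:
  assumes "0 < d" "d \<le> pi"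
  shows "integral {-pi..pi} (\<lambda>u. ((1 + cos u) / 2) ^ N) \<ge> d * ((1 + cos d) / 2) ^ N"
proof -
  have "d * ((1 + cos d) / 2) ^ N = integral {0..d} (\<lambda>u. ((1 + cos d) / 2) ^ N)"
    using assms by simp
  also have "\<dots> \<le> integral {0..d} (\<lambda>u. ((1 + cos u) / 2) ^ N)"
  proof (intro integral_le integrable_continuous_real continuous_intros power_mono)
    fix u assume "u \<in> {0..d}"
    then have "cos d \<le> cos u" using assms by (intro cos_monotone_0_pi_le) auto
    then show "(1 + cos d) / 2 \<le> (1 + cos u) / 2" by simp
    show "0 \<le> (1 + cos d) / 2" by (rule half_one_plus_cos_nonneg)
  qed auto
  also have "\<dots> \<le> integral {-pi..pi} (\<lambda>u. ((1 + cos u) / 2) ^ N)"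
  proof (intro integral_subset_le integrable_continuous_real continuous_intros)
    show "\<forall>u\<in>{-pi..pi}. 0 \<le> ((1 + cos u) / 2) ^ N"
      by (intro ballI zero_le_power half_one_plus_cos_nonneg)
  qed (use assms in auto)
  finally show ?thesis .
qed

lemma cos_kernel:
  shows "continuous_on S (cos_kernel N)" "cos_kernel N u \<ge> 0" "(cos_kernel N has_integral 1) {-pi..pi}"
proof -
  let ?I = "integral {-pi..pi} (\<lambda>u. ((1 + cos u) / 2) ^ N)"
  have I: "?I > 0"
    using cos_kernel_mass[of "pi / 2" N] pi_gt_zero
    by (intro less_le_trans[OF _ cos_kernel_mass[of "pi / 2" N]]) auto
  show "continuous_on S (cos_kernel N)"
    unfolding cos_kernel_def[abs_def] using I by (intro continuous_intros) auto
  show "cos_kernel N u \<ge> 0"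
  proof -
    show ?thesis unfolding cos_kernel_def
      using I by (intro divide_nonneg_pos zero_le_power half_one_plus_cos_nonneg)
  qed
  have "((\<lambda>u. ((1 + cos u) / 2) ^ N) has_integral ?I) {-pi..pi}"
    by (intro integrable_integral integrable_continuous_real continuous_intros) auto
  from has_integral_divide[OF this, of ?I] show "(cos_kernel N has_integral 1) {-pi..pi}"
    unfolding cos_kernel_def[abs_def] using I by simp
qed

text \<open>Near 0 continuity of \<open>h\<close> suffices. Away from 0 the kernel is compared with
  its normalising integral, which decays at a strictly slower geometric rate.\<close>

lemma cos_kernel_tendsto:
  fixes h :: "real \<Rightarrow> real"
  assumes h: "continuous_on {-pi..pi} h"
  shows "(\<lambda>N. integral {-pi..pi} (\<lambda>u. h u * cos_kernel N u)) \<longlonglongrightarrow> h 0"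
proof (rule metric_LIMSEQ_I)
  fix r :: real assume r: "r > 0"
  obtain B where B: "\<And>u. u \<in> {-pi..pi} \<Longrightarrow> \<bar>h u - h 0\<bar> \<le> B" "B > 0"
  proof -
    have "bounded ((\<lambda>u. h u - h 0) ` {-pi..pi})"
      by (intro compact_imp_bounded compact_continuous_image continuous_intros h) auto
    then obtain b where "b > 0" "\<forall>y\<in>(\<lambda>u. h u - h 0) ` {-pi..pi}. norm y \<le> b" unfolding bounded_pos by blast
    then show ?thesis by (intro that[of b]) auto
  qed
  have "continuous (at 0 within {-pi..pi}) h" using h by (simp add: continuous_on_eq_continuous_within)
  then obtain d0 where d0: "d0 > 0" "\<And>u. u \<in> {-pi..pi} \<Longrightarrow> \<bar>u\<bar> < d0 \<Longrightarrow> \<bar>h u - h 0\<bar> < r / 2"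
    using r unfolding continuous_within_eps_delta by (metis abs_minus_commute diff_0_right dist_real_def half_gt_zero_iff)
  define d where "d = min d0 pi"
  have d: "0 < d" "d \<le> pi" "\<And>u. u \<in> {-pi..pi} \<Longrightarrow> \<bar>u\<bar> < d \<Longrightarrow> \<bar>h u - h 0\<bar> < r / 2"
    using d0 by (auto simp: d_def)
  \<comment> \<open>Beyond distance \<open>d\<close> the unnormalised kernel is at most
    \<open>q ^ N\<close>, while the mass on \<open>[0, d / 2]\<close> is at least
    \<open>(d / 2) * q' ^ N\<close>. Their ratio times \<open>B\<close> and the length
    \<open>2 * pi\<close> gives the factor \<open>4 * pi * B / d\<close>.\<close>
  define q q' where "q = (1 + cos d) / 2" and "q' = (1 + cos (d / 2)) / 2"
  have q: "0 \<le> q" "q < q'"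
    using half_one_plus_cos_nonneg[of d] cos_monotone_0_pi[of "d / 2" d] d(1,2) by (simp_all add: q_def q'_def)
  define I where "I N = integral {-pi..pi} (\<lambda>u. ((1 + cos u) / 2) ^ N)" for N
  have I: "I N \<ge> (d / 2) * q' ^ N" for N unfolding I_def q'_def using d by (intro cos_kernel_mass) auto
  have I0: "I N > 0" for N using less_le_trans[OF _ I[of N]] q d by simp
  have bound: "\<bar>integral {-pi..pi} (\<lambda>u. h u * cos_kernel N u) - h 0\<bar> \<le> r / 2 + (4 * pi * B / d) * (q / q') ^ N" for N
  proof -
    note cont = cos_kernel(1)[of "{-pi..pi}" N]
    have "((\<lambda>u. h u * cos_kernel N u - h 0 * cos_kernel N u) has_integral
        integral {-pi..pi} (\<lambda>u. h u * cos_kernel N u) - h 0 * 1) {-pi..pi}"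
      by (intro has_integral_diff has_integral_mult_right cos_kernel(3) integrable_integral
          integrable_continuous_real continuous_on_mult h cont)
    then have "integral {-pi..pi} (\<lambda>u. h u * cos_kernel N u) - h 0
        = integral {-pi..pi} (\<lambda>u. (h u - h 0) * cos_kernel N u)"
      by (simp add: left_diff_distrib integral_unique)
    also have "\<bar>\<dots>\<bar> \<le> integral {-pi..pi} (\<lambda>u. r / 2 * cos_kernel N u + B * q ^ N / I N)"
      unfolding real_norm_def[symmetric]
    proof (rule integral_norm_bound_integral)
      show "(\<lambda>u. (h u - h 0) * cos_kernel N u) integrable_on {-pi..pi}"
        by (intro integrable_continuous_real continuous_intros h cont)
      show "(\<lambda>u. r / 2 * cos_kernel N u + B * q ^ N / I N) integrable_on {-pi..pi}"
        by (intro integrable_continuous_real continuous_on_add continuous_on_mult continuous_on_const cont)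
      fix u assume u: "u \<in> {-pi..pi}"
      have ck: "cos_kernel N u \<ge> 0" by (rule cos_kernel(2))
      have Bq: "B * q ^ N / I N \<ge> 0" using B q I0[of N] by simp
      show "norm ((h u - h 0) * cos_kernel N u) \<le> r / 2 * cos_kernel N u + B * q ^ N / I N"
      proof (cases "\<bar>u\<bar> < d")
        case True
        have "\<bar>h u - h 0\<bar> * cos_kernel N u \<le> r / 2 * cos_kernel N u"
          using d(3)[OF u True] ck by (intro mult_right_mono) auto
        then show ?thesis using ck Bq by (simp add: abs_mult)
      next
        case False
        have "cos u \<le> cos d"
          using cos_monotone_0_pi_le[of d "\<bar>u\<bar>"] False u d by auto
        then have "((1 + cos u) / 2) ^ N \<le> q ^ N"
          unfolding q_def by (intro power_mono half_one_plus_cos_nonneg) simp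
        then have "cos_kernel N u \<le> q ^ N / I N"
          unfolding cos_kernel_def I_def[symmetric] using I0[of N] by (intro divide_right_mono) auto
        then have "\<bar>h u - h 0\<bar> * cos_kernel N u \<le> B * (q ^ N / I N)"
          using B u ck by (intro mult_mono) auto
        moreover have "r / 2 * cos_kernel N u \<ge> 0" using r ck by simp
        ultimately show ?thesis using ck by (simp add: abs_mult)
      qed
    qed
    also have "\<dots> = r / 2 + 2 * pi * (B * q ^ N / I N)"
      using has_integral_add[OF has_integral_mult_right[OF cos_kernel(3)[of N], of "r / 2"] has_integral_const_real[of "B * q ^ N / I N" "-pi" pi]]
      by (simp add: integral_unique)
    also have "\<dots> \<le> r / 2 + 2 * pi * (B * q ^ N / ((d / 2) * q' ^ N))"
      using B q d I[of N] I0[of N] by (intro add_left_mono mult_left_mono divide_left_mono) auto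
    also have "\<dots> = r / 2 + (4 * pi * B / d) * (q / q') ^ N" by (simp add: power_divide field_simps)
    finally show ?thesis .
  qed
  have "(\<lambda>N. (4 * pi * B / d) * (q / q') ^ N) \<longlonglongrightarrow> (4 * pi * B / d) * 0"
    using q by (intro tendsto_mult tendsto_const LIMSEQ_realpow_zero) auto
  then have "\<forall>\<^sub>F N in sequentially. (4 * pi * B / d) * (q / q') ^ N < r / 2"
    using r by (intro order_tendstoD) auto
  then obtain N0 where N0: "\<And>N. N \<ge> N0 \<Longrightarrow> (4 * pi * B / d) * (q / q') ^ N < r / 2"
    unfolding eventually_sequentially by blast
  have "dist (integral {-pi..pi} (\<lambda>u. h u * cos_kernel N u)) (h 0) < r" if "N \<ge> N0" for N
    using bound[of N] N0[OF that] by (simp add: dist_real_def)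
  then show "\<exists>no. \<forall>n\<ge>no. dist (integral {-pi..pi} (\<lambda>u. h u * cos_kernel n u)) (h 0) < r" by blast
qed

context ou_setting
begin

section \<open>From characters to bounded twice differentiable functions\<close>

text \<open>The kernel argument mixes the integration variable with the coordinate of
  \<open>z\<close> along \<open>e\<close>. Addition theorems separate them: the integrals then see
  \<open>z\<close> only through its component orthogonal to \<open>e\<close>, and the remaining
  factors are characters of \<open>z\<close>. The free frequency \<open>b\<close> and phase
  \<open>c\<close> are needed for the induction on \<open>N\<close>.\<close>

lemma dynkin_kernel:
  fixes x e :: 'h
  assumes g: "continuous_on UNIV g" and R: "R > 0"
    and IH: "\<And>\<kappa> k \<theta>. continuous_on UNIV \<kappa> \<Longrightarrow>
      dynkin x (\<lambda>z. integral {-pi..pi} (\<lambda>u. g (z - inner z e *\<^sub>R e + (R * u) *\<^sub>R e) * \<kappa> u) * cos (inner z k + \<theta>))"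
  shows "dynkin x (\<lambda>z. integral {-pi..pi} (\<lambda>u. g (z - inner z e *\<^sub>R e + (R * u) *\<^sub>R e)
      * (((1 + cos (u - inner z e / R)) / 2) ^ N * cos (b * (u - inner z e / R) + c))) * cos (inner z k + \<theta>))"
proof (induction N arbitrary: b c)
  case 0
  let ?G = "\<lambda>z u. g (z - inner z e *\<^sub>R e + (R * u) *\<^sub>R e)"
  let ?c = "\<lambda>u. cos (b * u + c)" and ?s = "\<lambda>u. sin (b * u + c)"
  let ?kp = "k + (b / R) *\<^sub>R e" and ?km = "k - (b / R) *\<^sub>R e"
  \<comment> \<open>The factors in \<open>inner z e\<close> merge with the character of frequency
    \<open>k\<close> into characters of frequencies \<open>k \<plusminus> (b / R) e\<close>; the
    phase shift by \<open>pi/2\<close> writes sines as cosines.\<close>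
  have split: "integral {-pi..pi} (\<lambda>u. ?G z u * cos (b * (u - inner z e / R) + c)) * cos (inner z k + \<theta>)
      = 1/2 * (integral {-pi..pi} (\<lambda>u. ?G z u * ?c u) * cos (inner z ?kp + \<theta>))
      + 1/2 * (integral {-pi..pi} (\<lambda>u. ?G z u * ?c u) * cos (inner z ?km + \<theta>))
      + (1/2 * (integral {-pi..pi} (\<lambda>u. ?G z u * ?s u) * cos (inner z ?kp + (\<theta> - pi/2)))
      + (-1/2) * (integral {-pi..pi} (\<lambda>u. ?G z u * ?s u) * cos (inner z ?km + (\<theta> - pi/2))))" for z
  proof -
    let ?br = "b * inner z e / R" and ?A = "inner z k + \<theta>"
    have [continuous_intros]: "continuous_on {-pi..pi} (?G z)"
      by (intro continuous_on_compose2[OF g] continuous_intros) auto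
    have "cos (b * (u - inner z e / R) + c) = cos ?br * ?c u + sin ?br * ?s u" for u
      using cos_diff[of "b * u + c" ?br] by (simp add: algebra_simps)
    then have "integral {-pi..pi} (\<lambda>u. ?G z u * cos (b * (u - inner z e / R) + c))
        = integral {-pi..pi} (\<lambda>u. cos ?br * (?G z u * ?c u) + sin ?br * (?G z u * ?s u))"
      by (simp add: algebra_simps)
    also have "\<dots> = cos ?br * integral {-pi..pi} (\<lambda>u. ?G z u * ?c u) + sin ?br * integral {-pi..pi} (\<lambda>u. ?G z u * ?s u)"
      by (subst Henstock_Kurzweil_Integration.integral_add) (auto intro!: integrable_continuous_real continuous_intros)
    finally have "integral {-pi..pi} (\<lambda>u. ?G z u * cos (b * (u - inner z e / R) + c)) * cos ?A
        = (cos ?br * cos ?A) * integral {-pi..pi} (\<lambda>u. ?G z u * ?c u) + (sin ?br * cos ?A) * integral {-pi..pi} (\<lambda>u. ?G z u * ?s u)"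
      by (simp add: algebra_simps)
    moreover have "cos ?br * cos ?A = (cos (inner z ?kp + \<theta>) + cos (inner z ?km + \<theta>)) / 2"
      using cos_times_cos[of ?A ?br] by (simp add: inner_add_right inner_diff_right algebra_simps)
    moreover have "sin ?br * cos ?A = (cos (inner z ?kp + (\<theta> - pi/2)) - cos (inner z ?km + (\<theta> - pi/2))) / 2"
    proof -
      have "cos (inner z ?kp + (\<theta> - pi/2)) = sin (?A + ?br)" "cos (inner z ?km + (\<theta> - pi/2)) = sin (?A - ?br)"
        using cos_diff[of "?A + ?br" "pi/2"] cos_diff[of "?A - ?br" "pi/2"]
        by (simp_all add: inner_add_right inner_diff_right algebra_simps)
      then show ?thesis by (simp add: sin_add sin_diff)
    qed
    moreover have "X = 1/2 * (I1 * a) + 1/2 * (I1 * b) + (1/2 * (I2 * d) + (-1/2) * (I2 * d'))"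
      if "X = cc * I1 + sc * I2" "cc = (a + b) / 2" "sc = (d - d') / 2" for X cc sc I1 I2 a b d d' :: real
      using that by (simp add: field_simps)
    ultimately show ?thesis by blast
  qed
  have cont: "continuous_on UNIV ?c" "continuous_on UNIV ?s" by (intro continuous_intros)+
  show ?case
    unfolding power_0 mult_1 split by (intro dynkin_add dynkin_cmult IH cont)
next
  case (Suc N)
  let ?G = "\<lambda>z u. g (z - inner z e *\<^sub>R e + (R * u) *\<^sub>R e)"
  let ?K = "\<lambda>b z u. ?G z u * (((1 + cos (u - inner z e / R)) / 2) ^ N * cos (b * (u - inner z e / R) + c))"
  \<comment> \<open>One further factor \<open>(1 + cos v) / 2\<close> keeps frequency
    \<open>b\<close> with weight 1/2 and moves to \<open>b + 1\<close> and \<open>b - 1\<close> with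
    weight 1/4 each.\<close>
  have split: "integral {-pi..pi} (\<lambda>u. ?G z u * (((1 + cos (u - inner z e / R)) / 2) ^ Suc N * cos (b * (u - inner z e / R) + c))) * cos (inner z k + \<theta>)
      = 1/2 * (integral {-pi..pi} (?K b z) * cos (inner z k + \<theta>))
      + (1/4 * (integral {-pi..pi} (?K (b + 1) z) * cos (inner z k + \<theta>))
      + 1/4 * (integral {-pi..pi} (?K (b - 1) z) * cos (inner z k + \<theta>)))" for z
  proof -
    have [continuous_intros]: "continuous_on {-pi..pi} (?G z)"
      by (intro continuous_on_compose2[OF g] continuous_intros) auto
    have i: "?K b' z integrable_on {-pi..pi}" for b'
      using R by (intro integrable_continuous_real continuous_intros) auto
    have "?G z u * (((1 + cos v) / 2) ^ Suc N * cos (b * v + c))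
        = 1/2 * (?G z u * (((1 + cos v) / 2) ^ N * cos (b * v + c)))
        + (1/4 * (?G z u * (((1 + cos v) / 2) ^ N * cos ((b + 1) * v + c)))
        + 1/4 * (?G z u * (((1 + cos v) / 2) ^ N * cos ((b - 1) * v + c))))" for u v
    proof -
      have "cos v * cos (b * v + c) = (cos ((b + 1) * v + c) + cos ((b - 1) * v + c)) / 2"
        using cos_times_cos[of "b * v + c" v] by (simp add: algebra_simps)
      then have "(1 + cos v) / 2 * cos (b * v + c) = 1/2 * cos (b * v + c) + (1/4 * cos ((b + 1) * v + c) + 1/4 * cos ((b - 1) * v + c))"
        by (simp add: field_simps)
      then have "?G z u * ((1 + cos v) / 2) ^ N * ((1 + cos v) / 2 * cos (b * v + c))
          = ?G z u * ((1 + cos v) / 2) ^ N * (1/2 * cos (b * v + c) + (1/4 * cos ((b + 1) * v + c) + 1/4 * cos ((b - 1) * v + c)))"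
        by simp
      then show ?thesis by (simp only: power_Suc2 mult.assoc distrib_left mult.left_commute)
    qed
    then have "integral {-pi..pi} (\<lambda>u. ?G z u * (((1 + cos (u - inner z e / R)) / 2) ^ Suc N * cos (b * (u - inner z e / R) + c)))
      = integral {-pi..pi} (\<lambda>u. 1/2 * ?K b z u + (1/4 * ?K (b + 1) z u + 1/4 * ?K (b - 1) z u))"
      by (simp only:)
    also have "\<dots> = 1/2 * integral {-pi..pi} (?K b z) + (1/4 * integral {-pi..pi} (?K (b + 1) z) + 1/4 * integral {-pi..pi} (?K (b - 1) z))"
      by (intro integral_unique has_integral_add has_integral_mult_right integrable_integral i)
    finally show ?thesis by (simp add: algebra_simps)
  qed
  show ?case unfolding split by (intro dynkin_add dynkin_cmult Suc.IH)
qed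

text \<open>Averaging \<open>g\<close> along \<open>e\<close> against the kernel converges together
  with both derivatives, with the same constant because the kernel has mass 1. Periodicity allows
  the average to be recentred so that it falls under \<open>dynkin_kernel\<close>.\<close>

lemma dynkin_periodic:
  fixes x e :: 'h
  assumes g: "jet2 C g p q" and e: "norm e = 1" and R: "R > 0" and per: "\<And>z. g (z + (2 * pi * R) *\<^sub>R e) = g z"
    and IH: "\<And>\<kappa> k \<theta>. continuous_on UNIV \<kappa> \<Longrightarrow>
      dynkin x (\<lambda>z. integral {-pi..pi} (\<lambda>u. g (z - inner z e *\<^sub>R e + (R * u) *\<^sub>R e) * \<kappa> u) * cos (inner z k + \<theta>))"
  shows "dynkin x (\<lambda>z. g z * cos (inner z k + \<theta>))"
proof -
  let ?avg = "\<lambda>N z. integral {-pi..pi} (\<lambda>u. g (z + (R * u) *\<^sub>R e) * cos_kernel N u)"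
  note gc = jet2D(3)[OF g]
  have kp: "cos_kernel N (u + 2 * pi) = cos_kernel N u" for N u by (simp add: cos_kernel_def)
  have avg: "jet2 C (?avg N) (\<lambda>z v. integral {-pi..pi} (\<lambda>u. p (z + (R * u) *\<^sub>R e) v * cos_kernel N u))
      (\<lambda>z v w. integral {-pi..pi} (\<lambda>u. q (z + (R * u) *\<^sub>R e) v w * cos_kernel N u))" for N
  proof -
    have "\<bar>cos_kernel N u\<bar> \<le> cos_kernel N u" for u using cos_kernel(2)[of N u] by simp
    then have "jet2 (C * 1) (?avg N) (\<lambda>z v. integral {-pi..pi} (\<lambda>u. p (z + (R * u) *\<^sub>R e) v * cos_kernel N u))
      (\<lambda>z v w. integral {-pi..pi} (\<lambda>u. q (z + (R * u) *\<^sub>R e) v w * cos_kernel N u))"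
      by (intro jet2_average[OF g bounded_linear_ident _ _ cos_kernel(1) _ cos_kernel(3)] continuous_intros) auto
    then show ?thesis by simp
  qed
  show ?thesis
  proof (rule dynkin_limit[OF jet2_mult[OF avg jet2_cos] jet2_mult[OF g jet2_cos]])
    fix N
    have "?avg N z = integral {-pi..pi} (\<lambda>u. g (z - inner z e *\<^sub>R e + (R * u) *\<^sub>R e) * cos_kernel N (u - inner z e / R))" for z
    proof -
      \<comment> \<open>Shifting the integration variable by \<open>inner z e / R\<close> over a
        full period moves the dependence on this coordinate from \<open>g\<close> into the
        trigonometric kernel.\<close>
      define F where "F u = g (z - inner z e *\<^sub>R e + (R * u) *\<^sub>R e) * cos_kernel N (u - inner z e / R)" for u
      have "continuous_on UNIV F"
        unfolding F_def using R
        by (intro continuous_intros continuous_on_compose2[OF gc] continuous_on_compose2[OF cos_kernel(1)[of UNIV]]) auto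
      moreover have "F (u + 2 * pi) = F u" for u
      proof -
        have "g (z - inner z e *\<^sub>R e + (R * (u + 2 * pi)) *\<^sub>R e) = g (z - inner z e *\<^sub>R e + (R * u) *\<^sub>R e)"
          using per[of "z - inner z e *\<^sub>R e + (R * u) *\<^sub>R e"] by (simp add: algebra_simps scaleR_add_left)
        then show ?thesis using kp[of N "u - inner z e / R"] by (simp add: F_def add_diff_eq algebra_simps)
      qed
      ultimately have "integral {-pi..pi} (\<lambda>u. F (u + inner z e / R)) = integral {-pi..pi} F"
        by (rule periodic_integral_shift)
      moreover have "F (u + inner z e / R) = g (z + (R * u) *\<^sub>R e) * cos_kernel N u" for u
      proof -
        have "R * (u + inner z e / R) = R * u + inner z e" using R by (simp add: field_simps)
        then show ?thesis by (simp add: F_def scaleR_add_left)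
      qed
      ultimately have "?avg N z = integral {-pi..pi} F" by simp
      then show ?thesis unfolding F_def .
    qed
    moreover have "integral {-pi..pi} (\<lambda>u. g (z - inner z e *\<^sub>R e + (R * u) *\<^sub>R e) * cos_kernel N (u - inner z e / R))
        = 1 / integral {-pi..pi} (\<lambda>u. ((1 + cos u) / 2) ^ N) * integral {-pi..pi} (\<lambda>u. g (z - inner z e *\<^sub>R e + (R * u) *\<^sub>R e)
      * (((1 + cos (u - inner z e / R)) / 2) ^ N * cos (0 * (u - inner z e / R) + 0)))" for z
      \<comment> \<open>The factor \<open>cos (0 * ... + 0)\<close> is 1; it only matches the shape
        of \<open>dynkin_kernel\<close> with \<open>b = c = 0\<close>.\<close>
      by (subst Henstock_Kurzweil_Integration.integral_mult_right[symmetric]) (simp add: cos_kernel_def)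
    ultimately show "dynkin x (\<lambda>z. ?avg N z * cos (inner z k + \<theta>))"
      using dynkin_cmult[OF dynkin_kernel[OF gc R IH, of N 0 0 k \<theta>], of "1 / integral {-pi..pi} (\<lambda>u. ((1 + cos u) / 2) ^ N)"]
      by (simp add: mult.assoc)
  next
    have lim: "(\<lambda>N. integral {-pi..pi} (\<lambda>u. h (R * u) * cos_kernel N u)) \<longlonglongrightarrow> h 0" if "continuous_on UNIV h" for h
    proof -
      have "continuous_on {-pi..pi} (\<lambda>u. h (R * u))"
        by (intro continuous_on_compose2[OF that] continuous_intros) auto
      from cos_kernel_tendsto[OF this] show ?thesis by simp
    qed
    have L0: "(\<lambda>N. ?avg N z) \<longlonglongrightarrow> g z" for z
      using lim[of "\<lambda>r. g (z + r *\<^sub>R e)"] by (simp add: jet2_continuous_on[OF g] continuous_intros)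
    have L1: "(\<lambda>N. integral {-pi..pi} (\<lambda>u. p (z + (R * u) *\<^sub>R e) v * cos_kernel N u)) \<longlonglongrightarrow> p z v" for z v
      using lim[of "\<lambda>r. p (z + r *\<^sub>R e) v"] by (simp add: jet2_continuous_on[OF g] continuous_intros)
    have L2: "(\<lambda>N. integral {-pi..pi} (\<lambda>u. q (z + (R * u) *\<^sub>R e) v w * cos_kernel N u)) \<longlonglongrightarrow> q z v w" for z v w
      using lim[of "\<lambda>r. q (z + r *\<^sub>R e) v w"] by (simp add: jet2_continuous_on[OF g] continuous_intros)
    fix z v w
    show "(\<lambda>N. ?avg N z * cos (inner z k + \<theta>)) \<longlonglongrightarrow> g z * cos (inner z k + \<theta>)" by (intro tendsto_intros L0)
    show "(\<lambda>N. integral {-pi..pi} (\<lambda>u. p (z + (R * u) *\<^sub>R e) v * cos_kernel N u) * cos (inner z k + \<theta>)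
        + ?avg N z * (- sin (inner z k + \<theta>) * inner v k))
      \<longlonglongrightarrow> p z v * cos (inner z k + \<theta>) + g z * (- sin (inner z k + \<theta>) * inner v k)"
      by (intro tendsto_intros L0 L1)
    show "(\<lambda>N. integral {-pi..pi} (\<lambda>u. q (z + (R * u) *\<^sub>R e) v w * cos_kernel N u) * cos (inner z k + \<theta>)
        + integral {-pi..pi} (\<lambda>u. p (z + (R * u) *\<^sub>R e) v * cos_kernel N u) * (- sin (inner z k + \<theta>) * inner w k)
        + (integral {-pi..pi} (\<lambda>u. p (z + (R * u) *\<^sub>R e) w * cos_kernel N u) * (- sin (inner z k + \<theta>) * inner v k)
        + ?avg N z * (- cos (inner z k + \<theta>) * inner v k * inner w k)))
      \<longlonglongrightarrow> q z v w * cos (inner z k + \<theta>) + p z v * (- sin (inner z k + \<theta>) * inner w k)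
        + (p z w * (- sin (inner z k + \<theta>) * inner v k) + g z * (- cos (inner z k + \<theta>) * inner v k * inner w k))"
      by (intro tendsto_intros L0 L1 L2)
  qed
qed

text \<open>Averaging in the coordinate \<open>e\<close> against a trigonometric kernel writes \<open>g\<close>, up to a small
  error, as a finite sum of characters with coefficients that no longer depend on \<open>e\<close>.\<close>

lemma dynkin_cylindrical:
  assumes x: "x \<in> DA" and R: "R > 0"
    and "finite E" "\<forall>e\<in>E. norm e = 1" "pairwise orthogonal E" "jet2 C g p q"
    and "\<And>e z. e \<in> E \<Longrightarrow> g (z + (2 * pi * R) *\<^sub>R e) = g z"
    and "\<And>v z. (\<And>e. e \<in> E \<Longrightarrow> inner v e = 0) \<Longrightarrow> g (z + v) = g z"
  shows "dynkin x (\<lambda>z. g z * cos (inner z k + \<theta>))"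
  using assms(3-)
proof (induction E arbitrary: C g p q k \<theta> rule: finite_induct)
  case empty
  have "g z = g 0" for z using empty(5)[of z 0] by simp
  then have "(\<lambda>z. g z * cos (inner z k + \<theta>)) = (\<lambda>z. g 0 * cos (inner z k + \<theta>))" by (intro ext) metis
  then show ?case using dynkin_cmult[OF dynkin_cos[OF x]] by metis
next
  case (insert e E)
  note g = insert.prems(3) and per = insert.prems(4) and inv = insert.prems(5)
  have e: "norm e = 1" "inner e e = 1" "\<And>d. d \<in> E \<Longrightarrow> inner d e = 0"
    using insert.prems(1,2) insert.hyps by (auto simp: pairwise_def orthogonal_def norm_eq_1)
  define B where "B v = v - inner v e *\<^sub>R e" for v
  have B: "bounded_linear B"
    unfolding B_def by (intro bounded_linear_intros)
  have Be: "inner (B v) e = 0" for v by (simp add: B_def inner_diff_left e)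
  have Bn: "norm (B v) \<le> norm v" for v
  proof -
    have "(norm (B v + inner v e *\<^sub>R e))\<^sup>2 = (norm (B v))\<^sup>2 + (norm (inner v e *\<^sub>R e))\<^sup>2"
      by (rule norm_add_Pythagorean) (simp add: orthogonal_def Be)
    then have "(norm v)\<^sup>2 = (norm (B v))\<^sup>2 + (inner v e)\<^sup>2" by (simp add: B_def e)
    then have "(norm (B v))\<^sup>2 \<le> (norm v)\<^sup>2" by simp
    then show ?thesis by (rule power2_le_imp_le) simp
  qed
  show ?case
  proof (rule dynkin_periodic[OF g e(1) R])
    \<comment> \<open>The coefficient is again periodic and cylindrical, now over \<open>E\<close>
      without \<open>e\<close>, so the induction hypothesis applies. The character factor in the
      statement is needed here: eliminating \<open>e\<close> creates new frequencies, which must be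
      carried to the next coordinate.\<close>
    fix \<kappa> :: "real \<Rightarrow> real" and k \<theta> assume \<kappa>: "continuous_on UNIV \<kappa>"
    let ?c = "\<lambda>z. integral {-pi..pi} (\<lambda>u. g (B z + (R * u) *\<^sub>R e) * \<kappa> u)"
    have \<kappa>': "continuous_on {-pi..pi} \<kappa>" using \<kappa> by (rule continuous_on_subset) simp
    have i: "((\<lambda>u. \<bar>\<kappa> u\<bar>) has_integral integral {-pi..pi} (\<lambda>u. \<bar>\<kappa> u\<bar>)) {-pi..pi}"
      using \<kappa>' by (intro integrable_integral integrable_continuous_real continuous_intros)
    have j: "jet2 (C * integral {-pi..pi} (\<lambda>u. \<bar>\<kappa> u\<bar>)) ?c
        (\<lambda>z v. integral {-pi..pi} (\<lambda>u. p (B z + (R * u) *\<^sub>R e) (B v) * \<kappa> u))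
        (\<lambda>z v w. integral {-pi..pi} (\<lambda>u. q (B z + (R * u) *\<^sub>R e) (B v) (B w) * \<kappa> u))"
      by (rule jet2_average[OF g B Bn _ \<kappa>' _ i]) (auto intro!: continuous_intros)
    have "dynkin x (\<lambda>z. ?c z * cos (inner z k + \<theta>))"
    proof (rule insert.IH[OF _ _ j])
      show "\<forall>e\<in>E. norm e = 1" "pairwise orthogonal E"
        using insert.prems(1,2) by (auto simp: pairwise_insert)
      fix d z assume d: "d \<in> E"
      have "B (z + (2 * pi * R) *\<^sub>R d) = B z + (2 * pi * R) *\<^sub>R d"
        using e(3)[OF d] by (simp add: B_def inner_add_left)
      then have "g (B (z + (2 * pi * R) *\<^sub>R d) + (R * u) *\<^sub>R e) = g (B z + (R * u) *\<^sub>R e)" for u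
        using per[of d "B z + (R * u) *\<^sub>R e"] d by (simp add: add_ac)
      then show "?c (z + (2 * pi * R) *\<^sub>R d) = ?c z" by simp
    next
      fix v z assume v: "\<And>d. d \<in> E \<Longrightarrow> inner v d = 0"
      have "inner (B v) d = 0" if "d \<in> insert e E" for d
      proof (cases "d = e")
        case False
        then have "inner v d = 0" "inner e d = 0" using that v e(3)[of d] by (auto simp: inner_commute[of e])
        then show ?thesis by (simp add: B_def inner_diff_left)
      qed (simp add: Be)
      then have "g (B z + (R * u) *\<^sub>R e + B v) = g (B z + (R * u) *\<^sub>R e)" for u by (rule inv)
      moreover have "B (z + v) = B z + B v" by (rule linear_add[OF bounded_linear.linear[OF B]])
      ultimately show "?c (z + v) = ?c z" by (simp add: add_ac)
    qed
    then show "dynkin x (\<lambda>z. integral {-pi..pi} (\<lambda>u. g (z - inner z e *\<^sub>R e + (R * u) *\<^sub>R e) * \<kappa> u) * cos (inner z k + \<theta>))"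
      by (simp add: B_def)
  qed (use per in auto)
qed

end

section \<open>Bounded twice Frechet differentiable functions\<close>

text \<open>The second derivative is only jointly continuous in point and direction, with an
  operator norm bound. A Hilbert-Schmidt condition would be too strong in infinite dimension: the
  Hessian of \<open>bump\<close> contains a multiple of the identity, yet the bumps must belong to
  the class.\<close>

definition C2b :: "real \<Rightarrow> ('h::real_inner \<Rightarrow> real) \<Rightarrow> ('h \<Rightarrow> 'h) \<Rightarrow> ('h \<Rightarrow> 'h \<Rightarrow> 'h) \<Rightarrow> bool" where
  "C2b C f f' f'' \<longleftrightarrow>
     (\<forall>x. (f has_derivative (\<lambda>v. inner (f' x) v)) (at x)) \<and>
     (\<forall>x. (f' has_derivative f'' x) (at x)) \<and>
     continuous_on UNIV (\<lambda>(x, v). f'' x v) \<and>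
     (\<forall>x. \<bar>f x\<bar> \<le> C) \<and> (\<forall>x. norm (f' x) \<le> C) \<and> (\<forall>x v. norm (f'' x v) \<le> C * norm v)"

lemma C2bD:
  assumes "C2b C f f' f''"
  shows "(f has_derivative (\<lambda>v. inner (f' x) v)) (at x)" "(f' has_derivative f'' x) (at x)"
    "continuous_on UNIV (\<lambda>(x, v). f'' x v)"
    "\<bar>f x\<bar> \<le> C" "norm (f' x) \<le> C" "norm (f'' x v) \<le> C * norm v" "C \<ge> 0"
    "continuous_on S X \<Longrightarrow> continuous_on S (\<lambda>z. f (X z))"
    "continuous_on S X \<Longrightarrow> continuous_on S (\<lambda>z. f' (X z))"
    "continuous_on S X \<Longrightarrow> continuous_on S V \<Longrightarrow> continuous_on S (\<lambda>z. f'' (X z) (V z))"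
proof -
  show d: "(f has_derivative (\<lambda>v. inner (f' x) v)) (at x)" "(f' has_derivative f'' x) (at x)" for x
    using assms unfolding C2b_def by blast+
  show c: "continuous_on UNIV (\<lambda>(x, v). f'' x v)" using assms unfolding C2b_def by blast
  show "\<bar>f x\<bar> \<le> C" "norm (f' x) \<le> C" "norm (f'' x v) \<le> C * norm v" for x
    using assms unfolding C2b_def by blast+
  from this(1)[of x] show "C \<ge> 0" by simp
  have "continuous_on UNIV f" "continuous_on UNIV f'"
    by (auto simp: continuous_on_eq_continuous_at intro: has_derivative_continuous[OF d(1)] has_derivative_continuous[OF d(2)])
  then show "continuous_on S X \<Longrightarrow> continuous_on S (\<lambda>z. f (X z))" "continuous_on S X \<Longrightarrow> continuous_on S (\<lambda>z. f' (X z))"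
    by (auto elim: continuous_on_compose2)
  show "continuous_on S (\<lambda>z. f'' (X z) (V z))" if "continuous_on S X" "continuous_on S V"
    using continuous_on_compose2[OF c continuous_on_Pair[OF that]] by simp
qed

lemma has_derivative_directional:
  fixes F :: "'h::real_normed_vector \<Rightarrow> real"
  assumes "(F has_derivative F') (at x)"
  shows "((\<lambda>r. F (x + r *\<^sub>R v)) has_real_derivative F' v) (at 0)"
proof -
  have "((\<lambda>r. x + r *\<^sub>R v) has_derivative (\<lambda>r. r *\<^sub>R v)) (at 0)"
    by (auto intro!: derivative_eq_intros)
  then have "((\<lambda>r. F (x + r *\<^sub>R v)) has_derivative (\<lambda>r. F' (r *\<^sub>R v))) (at 0)"
    by (rule has_derivative_compose) (use assms in simp)
  moreover have "(\<lambda>r. F' (r *\<^sub>R v)) = (*) (F' v)"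
    using linear_scale[OF has_derivative_linear[OF assms]] by (auto simp: mult.commute)
  ultimately show ?thesis by (simp add: has_field_derivative_def)
qed

text \<open>The composite is described by directional derivatives, so no adjoint of
  \<open>\<Theta>'\<close> is needed to form a gradient. The factor 2 counts the two terms of the
  second-order chain rule.\<close>

lemma C2b_compose_jet2:
  fixes f :: "'h::real_inner \<Rightarrow> real"
  assumes f: "C2b C f f' f''"
    and \<Theta>: "\<And>x. (\<Theta> has_derivative \<Theta>' x) (at x)" "\<And>x v. ((\<lambda>x. \<Theta>' x v) has_derivative \<Theta>'' x v) (at x)"
    and cont: "continuous_on UNIV (\<lambda>(x, v). \<Theta>' x v)" "continuous_on UNIV (\<lambda>(x, v, w). \<Theta>'' x v w)"
    and bnd: "\<And>x v. norm (\<Theta>' x v) \<le> norm v" "\<And>x v w. norm (\<Theta>'' x v w) \<le> norm v * norm w"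
  shows "jet2 (2 * C) (\<lambda>x. f (\<Theta> x)) (\<lambda>x v. inner (f' (\<Theta> x)) (\<Theta>' x v))
    (\<lambda>x v w. inner (f'' (\<Theta> x) (\<Theta>' x w)) (\<Theta>' x v) + inner (f' (\<Theta> x)) (\<Theta>'' x v w))"
proof -
  note D = C2bD[OF f]
  have \<Theta>c: "continuous_on UNIV \<Theta>"
    by (auto simp: continuous_on_eq_continuous_at intro: has_derivative_continuous[OF \<Theta>(1)])
  have [continuous_intros]: "continuous_on S (\<lambda>z. \<Theta> (X z))" "continuous_on S (\<lambda>z. f' (\<Theta> (X z)))"
    if "continuous_on S X" for S :: "'x::topological_space set" and X
    using that by (auto intro!: D continuous_on_compose2[OF \<Theta>c])
  have [continuous_intros]: "continuous_on S (\<lambda>z. \<Theta>' (X z) (V z))"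
    if "continuous_on S X" "continuous_on S V" for S :: "'x::topological_space set" and X V
    using continuous_on_compose2[OF cont(1) continuous_on_Pair[OF that]] by simp
  have [continuous_intros]: "continuous_on S (\<lambda>z. \<Theta>'' (X z) (V z) (W z))"
    if "continuous_on S X" "continuous_on S V" "continuous_on S W" for S :: "'x::topological_space set" and X V W
    using continuous_on_compose2[OF cont(2) continuous_on_Pair[OF that(1) continuous_on_Pair[OF that(2,3)]]] by simp
  show ?thesis
    unfolding jet2_def case_prod_beta'
  proof (intro conjI allI)
    fix x v w
    show "((\<lambda>r. f (\<Theta> (x + r *\<^sub>R v))) has_real_derivative inner (f' (\<Theta> x)) (\<Theta>' x v)) (at 0)"
      by (rule has_derivative_directional[OF has_derivative_compose[OF \<Theta>(1) D(1)]])
    have "((\<lambda>x. inner (f' (\<Theta> x)) (\<Theta>' x v)) has_derivative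
        (\<lambda>w. inner (f' (\<Theta> x)) (\<Theta>'' x v w) + inner (f'' (\<Theta> x) (\<Theta>' x w)) (\<Theta>' x v))) (at x)"
      by (rule has_derivative_inner[OF has_derivative_compose[OF \<Theta>(1) D(2)] \<Theta>(2)])
    from has_derivative_directional[OF this, of w]
    show "((\<lambda>r. inner (f' (\<Theta> (x + r *\<^sub>R w))) (\<Theta>' (x + r *\<^sub>R w) v)) has_real_derivative
        inner (f'' (\<Theta> x) (\<Theta>' x w)) (\<Theta>' x v) + inner (f' (\<Theta> x)) (\<Theta>'' x v w)) (at 0)"
      by (simp add: add.commute)
    show "\<bar>f (\<Theta> x)\<bar> \<le> 2 * C" using D(4)[of "\<Theta> x"] D(7) by linarith
    have "\<bar>inner (f' (\<Theta> x)) u\<bar> \<le> C * norm u" for u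
      using Cauchy_Schwarz_ineq2[of "f' (\<Theta> x)" u] mult_right_mono[OF D(5)[of "\<Theta> x"], of "norm u"] by simp
    then have *: "\<bar>inner (f' (\<Theta> x)) u\<bar> \<le> C * c" if "norm u \<le> c" for u c
      using mult_left_mono[OF that D(7)] order_trans by blast
    show "\<bar>inner (f' (\<Theta> x)) (\<Theta>' x v)\<bar> \<le> 2 * C * norm v"
      using *[OF bnd(1)[of x v]] D(7) by simp
    have "\<bar>inner (f'' (\<Theta> x) (\<Theta>' x w)) (\<Theta>' x v)\<bar> \<le> norm (f'' (\<Theta> x) (\<Theta>' x w)) * norm (\<Theta>' x v)"
      by (rule Cauchy_Schwarz_ineq2)
    also have "\<dots> \<le> (C * norm w) * norm v"
      using D(6)[of "\<Theta> x" "\<Theta>' x w"] mult_left_mono[OF bnd(1)[of x w] D(7)] D(7) bnd(1)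
      by (intro mult_mono) auto
    finally show "\<bar>inner (f'' (\<Theta> x) (\<Theta>' x w)) (\<Theta>' x v) + inner (f' (\<Theta> x)) (\<Theta>'' x v w)\<bar> \<le> 2 * C * norm v * norm w"
      using *[OF bnd(2)[of x v w]] by (simp add: algebra_simps)
  qed (intro continuous_intros D)+
qed

lemma C2b_jet2:
  assumes "C2b C f f' f''"
  shows "jet2 (2 * C) f (\<lambda>x v. inner (f' x) v) (\<lambda>x v w. inner (f'' x w) v)"
  using C2b_compose_jet2[OF assms, of "\<lambda>x. x" "\<lambda>x v. v" "\<lambda>x v w. 0"]
  by (simp add: case_prod_beta' continuous_on_snd)

text \<open>Replacing a coordinate \<open>r\<close> by \<open>n sin (r / n)\<close> makes functions periodic without a cutoff.\<close>

definition wrap :: "nat \<Rightarrow> 'h::{real_inner, second_countable_topology} \<Rightarrow> 'h" where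
  "wrap n x = (\<Sum>e\<in>hfin n. (real (Suc n) * sin (inner x e / real (Suc n))) *\<^sub>R e)"

definition wrap' :: "nat \<Rightarrow> 'h::{real_inner, second_countable_topology} \<Rightarrow> 'h \<Rightarrow> 'h" where
  "wrap' n x v = (\<Sum>e\<in>hfin n. (cos (inner x e / real (Suc n)) * inner v e) *\<^sub>R e)"

definition wrap'' :: "nat \<Rightarrow> 'h::{real_inner, second_countable_topology} \<Rightarrow> 'h \<Rightarrow> 'h \<Rightarrow> 'h" where
  "wrap'' n x v w = (\<Sum>e\<in>hfin n. (- (sin (inner x e / real (Suc n)) * (inner w e / real (Suc n))) * inner v e) *\<^sub>R e)"

lemma norm_hfin_sum_le:
  fixes c :: "'h::{real_inner, second_countable_topology} \<Rightarrow> real"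
  assumes "\<And>e. e \<in> hfin n \<Longrightarrow> \<bar>c e\<bar> \<le> K * \<bar>inner v e\<bar>" "K \<ge> 0"
  shows "norm (\<Sum>e\<in>hfin n. c e *\<^sub>R e) \<le> K * norm v"
proof (rule power2_le_imp_le)
  have "(norm (\<Sum>e\<in>hfin n. c e *\<^sub>R e))\<^sup>2 = (\<Sum>e\<in>hfin n. (c e)\<^sup>2)"
    by (rule norm_sum_orthonormal[OF hfin(1-3)])
  also have "\<dots> \<le> (\<Sum>e\<in>hfin n. K\<^sup>2 * (inner v e)\<^sup>2)"
  proof (rule sum_mono)
    fix e :: 'h assume "e \<in> hfin n"
    from power_mono[OF assms(1)[OF this], of 2] show "(c e)\<^sup>2 \<le> K\<^sup>2 * (inner v e)\<^sup>2"
      by (simp add: power_mult_distrib)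
  qed
  also have "\<dots> \<le> K\<^sup>2 * (norm v)\<^sup>2"
    unfolding sum_distrib_left[symmetric] by (intro mult_left_mono bessel(1)[OF hfin(1-3)]) simp
  finally show "(norm (\<Sum>e\<in>hfin n. c e *\<^sub>R e))\<^sup>2 \<le> (K * norm v)\<^sup>2" by (simp add: power_mult_distrib)
qed (use assms(2) in simp)

lemma abs_inner_hfin_le: "e \<in> hfin n \<Longrightarrow> \<bar>inner x e\<bar> \<le> norm x"
  using Cauchy_Schwarz_ineq2[of x e] hfin(2) by fastforce

text \<open>The bounds are uniform in \<open>n\<close>: each coordinate map has slope at most 1 and
  curvature at most \<open>1 / Suc n\<close>, and orthonormality carries this over to the vector.
  Hence all functions \<open>f (wrap n x)\<close> share one jet constant.\<close>

lemma wrap_derivatives: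
  fixes x :: "'h::{real_inner, second_countable_topology}"
  shows "(wrap n has_derivative wrap' n x) (at x)" "((\<lambda>x. wrap' n x v) has_derivative wrap'' n x v) (at x)"
    "continuous_on UNIV (\<lambda>(x, v :: 'h). wrap' n x v)" "continuous_on UNIV (\<lambda>(x, v, w :: 'h). wrap'' n x v w)"
    "norm (wrap' n x v) \<le> norm v" "norm (wrap'' n x v w) \<le> 1 / Suc n * (norm v * norm w)"
proof -
  show "(wrap n has_derivative wrap' n x) (at x)"
    unfolding wrap_def[abs_def] wrap'_def[abs_def]
    by (auto intro!: has_derivative_sum derivative_eq_intros simp del: of_nat_Suc)
  show "((\<lambda>x. wrap' n x v) has_derivative wrap'' n x v) (at x)"
    unfolding wrap'_def[abs_def] wrap''_def[abs_def]
    by (auto intro!: has_derivative_sum derivative_eq_intros simp del: of_nat_Suc)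
  show "continuous_on UNIV (\<lambda>(x, v :: 'h). wrap' n x v)" "continuous_on UNIV (\<lambda>(x, v, w :: 'h). wrap'' n x v w)"
    unfolding wrap'_def wrap''_def case_prod_beta' by (intro continuous_intros; simp)+
  have "norm (wrap' n x v) \<le> 1 * norm v"
    unfolding wrap'_def by (rule norm_hfin_sum_le) (auto simp: abs_mult intro!: mult_left_le_one_le)
  then show "norm (wrap' n x v) \<le> norm v" by simp
  have "norm (wrap'' n x v w) \<le> (norm w / Suc n) * norm v"
    unfolding wrap''_def
  proof (rule norm_hfin_sum_le)
    fix e :: 'h assume e: "e \<in> hfin n"
    have "\<bar>sin (inner x e / real (Suc n)) * (inner w e / real (Suc n))\<bar> \<le> 1 * (norm w / real (Suc n))"
      unfolding abs_mult using abs_inner_hfin_le[OF e, of w]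
      by (intro mult_mono) (auto simp: divide_right_mono abs_divide simp del: of_nat_Suc)
    then show "\<bar>- (sin (inner x e / real (Suc n)) * (inner w e / real (Suc n))) * inner v e\<bar> \<le> norm w / real (Suc n) * \<bar>inner v e\<bar>"
      unfolding abs_mult[of _ "inner v e"] by (intro mult_right_mono) auto
  qed simp
  then show "norm (wrap'' n x v w) \<le> 1 / Suc n * (norm v * norm w)" by (simp add: mult.commute)
qed

lemma abs_sin_minus_le: "\<bar>sin u - u\<bar> \<le> u\<^sup>2" and abs_cos_minus_1_le: "\<bar>cos u - 1\<bar> \<le> \<bar>u\<bar>" for u :: real
proof -
  have "\<bar>Im (iexp u - 1 - \<i> * complex_of_real u)\<bar> \<le> u\<^sup>2"
    by (rule order_trans[OF abs_Im_le_cmod cmod_iexp_taylor])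
  then show "\<bar>sin u - u\<bar> \<le> u\<^sup>2" by (simp add: Im_exp)
  have "\<bar>Re (iexp u - 1)\<bar> \<le> \<bar>u\<bar>"
    by (rule order_trans[OF abs_Re_le_cmod cmod_iexp_minus_1])
  then show "\<bar>cos u - 1\<bar> \<le> \<bar>u\<bar>" by (simp add: Re_exp)
qed

text \<open>Compared with the truncated expansion over \<open>hfin n\<close>, each coordinate errs
  by at most \<open>norm x / Suc n\<close> times itself, so the errors sum in norm regardless of the
  number of coordinates.\<close>

lemma wrap_tendsto:
  fixes x :: "'h::{real_inner, second_countable_topology}"
  shows "(\<lambda>n. wrap n x) \<longlonglongrightarrow> x" "(\<lambda>n. wrap' n x v) \<longlonglongrightarrow> v" "(\<lambda>n. wrap'' n x v w) \<longlonglongrightarrow> 0"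
proof -
  have lim0: "(\<lambda>n. c / real (Suc n)) \<longlonglongrightarrow> 0" for c :: real
    using LIMSEQ_Suc[OF lim_const_over_n[of c]] by simp
  have 1: "norm (wrap n x - (\<Sum>e\<in>hfin n. inner x e *\<^sub>R e)) \<le> (norm x / Suc n) * norm x" for n
    unfolding wrap_def sum_subtractf[symmetric] scaleR_diff_left[symmetric]
  proof (rule norm_hfin_sum_le)
    fix e :: 'h assume e: "e \<in> hfin n"
    define R where "R = real (Suc n)"
    have R: "R > 0" by (simp add: R_def)
    have "\<bar>R * sin (inner x e / R) - inner x e\<bar> = R * \<bar>sin (inner x e / R) - inner x e / R\<bar>"
      using R abs_mult[of R "sin (inner x e / R) - inner x e / R"] by (simp add: right_diff_distrib)
    also have "\<dots> \<le> R * (inner x e / R)\<^sup>2" using R by (intro mult_left_mono abs_sin_minus_le) auto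
    also have "\<dots> = \<bar>inner x e\<bar> / R * \<bar>inner x e\<bar>" using R by (simp add: power2_eq_square)
    also have "\<dots> \<le> norm x / R * \<bar>inner x e\<bar>"
      using R abs_inner_hfin_le[OF e] by (intro mult_right_mono divide_right_mono) auto
    finally show "\<bar>real (Suc n) * sin (inner x e / real (Suc n)) - inner x e\<bar> \<le> norm x / real (Suc n) * \<bar>inner x e\<bar>"
      by (simp add: R_def)
  qed simp
  have "(\<lambda>n. wrap n x - (\<Sum>e\<in>hfin n. inner x e *\<^sub>R e)) \<longlonglongrightarrow> 0"
    by (rule Lim_null_comparison[OF always_eventually[OF allI[OF 1]]])
      (use tendsto_mult[OF lim0 tendsto_const, of "norm x" "norm x"] in simp)
  from tendsto_add[OF this hfin_expansion[of x]] show "(\<lambda>n. wrap n x) \<longlonglongrightarrow> x" by simp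
  have 2: "norm (wrap' n x v - (\<Sum>e\<in>hfin n. inner v e *\<^sub>R e)) \<le> (norm x / Suc n) * norm v" for n
    unfolding wrap'_def sum_subtractf[symmetric] scaleR_diff_left[symmetric]
  proof (rule norm_hfin_sum_le)
    fix e :: 'h assume e: "e \<in> hfin n"
    have "\<bar>cos (inner x e / real (Suc n)) - 1\<bar> \<le> norm x / real (Suc n)"
      using abs_cos_minus_1_le[of "inner x e / real (Suc n)"] divide_right_mono[OF abs_inner_hfin_le[OF e, of x], of "real (Suc n)"]
      by (simp add: abs_divide)
    then have "\<bar>cos (inner x e / real (Suc n)) - 1\<bar> * \<bar>inner v e\<bar> \<le> norm x / real (Suc n) * \<bar>inner v e\<bar>"
      by (intro mult_right_mono) auto
    moreover have "cos (inner x e / real (Suc n)) * inner v e - inner v e = (cos (inner x e / real (Suc n)) - 1) * inner v e"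
      by (simp add: left_diff_distrib)
    ultimately show "\<bar>cos (inner x e / real (Suc n)) * inner v e - inner v e\<bar> \<le> norm x / real (Suc n) * \<bar>inner v e\<bar>"
      by (simp only: abs_mult)
  qed simp
  have "(\<lambda>n. wrap' n x v - (\<Sum>e\<in>hfin n. inner v e *\<^sub>R e)) \<longlonglongrightarrow> 0"
    by (rule Lim_null_comparison[OF always_eventually[OF allI[OF 2]]])
      (use tendsto_mult[OF lim0 tendsto_const, of "norm x" "norm v"] in simp)
  from tendsto_add[OF this hfin_expansion[of v]] show "(\<lambda>n. wrap' n x v) \<longlonglongrightarrow> v" by simp
  show "(\<lambda>n. wrap'' n x v w) \<longlonglongrightarrow> 0"
    by (rule Lim_null_comparison[OF always_eventually[OF allI[OF wrap_derivatives(6)]]])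
      (use tendsto_mult[OF lim0 tendsto_const, of 1 "norm v * norm w"] in simp)
qed

lemma (in ou_setting) dynkin_C2b:
  assumes x: "x \<in> DA" and f: "C2b C f f' f''"
  shows "dynkin x f"
proof -
  note D = C2bD[OF f]
  have w2: "norm (wrap'' n y v w) \<le> norm v * norm w" for n and y v w :: 'h
  proof -
    have "1 / real (Suc n) * (norm v * norm w) \<le> 1 * (norm v * norm w)" by (intro mult_right_mono) auto
    then show ?thesis using wrap_derivatives(6)[of n y v w] by simp
  qed
  note j = C2b_compose_jet2[OF f wrap_derivatives(1-5) w2]
  show ?thesis
  proof (rule dynkin_limit[OF j C2b_jet2[OF f]])
    fix n
    let ?g = "\<lambda>z. f (wrap n z)"
    \<comment> \<open>Frequency and phase 0 make the character factor equal to 1. The period is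
      \<open>2 * pi * real (Suc n)\<close> in every coordinate of \<open>hfin n\<close>.\<close>
    have "dynkin x (\<lambda>z. ?g z * cos (inner z 0 + 0))"
    proof (rule dynkin_cylindrical[OF x _ hfin(1-3) j])
      show "real (Suc n) > 0" by simp
      fix e z :: 'h assume e: "e \<in> hfin n"
      have "sin (inner (z + (2 * pi * real (Suc n)) *\<^sub>R e) d / real (Suc n)) = sin (inner z d / real (Suc n))"
        if d: "d \<in> hfin n" for d
      proof (cases "d = e")
        case True
        then have "inner e d = 1" using hfin(2) e by (auto simp: norm_eq_1)
        then have "inner (z + (2 * pi * real (Suc n)) *\<^sub>R e) d / real (Suc n) = inner z d / real (Suc n) + 2 * pi"
          by (simp add: inner_add_left add_divide_distrib del: of_nat_Suc)
        then show ?thesis by simp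
      next
        case False
        then have "inner e d = 0" using hfin(3)[of n] e d by (auto simp: pairwise_def orthogonal_def)
        then show ?thesis by (simp add: inner_add_left)
      qed
      then show "f (wrap n (z + (2 * pi * real (Suc n)) *\<^sub>R e)) = f (wrap n z)"
        unfolding wrap_def by (simp cong: sum.cong)
    next
      fix v z :: 'h assume "\<And>e. e \<in> hfin n \<Longrightarrow> inner v e = 0"
      then show "f (wrap n (z + v)) = f (wrap n z)"
        unfolding wrap_def by (simp add: inner_add_left cong: sum.cong)
    qed
    then show "dynkin x ?g" by simp
  next
    have 0: "(\<lambda>n. f' (wrap n z)) \<longlonglongrightarrow> f' z" for z
      by (rule continuous_on_tendsto_compose[OF D(9)[OF continuous_on_id[of UNIV]] wrap_tendsto(1)]) auto
    have 1: "(\<lambda>n. f'' (wrap n z) (wrap' n z w)) \<longlonglongrightarrow> f'' z w" for z w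
      using continuous_on_tendsto_compose[OF D(3) tendsto_Pair[OF wrap_tendsto(1)[of z] wrap_tendsto(2)[of z w]]] by simp
    show "(\<lambda>n. f (wrap n z)) \<longlonglongrightarrow> f z" for z
      by (rule continuous_on_tendsto_compose[OF D(8)[OF continuous_on_id[of UNIV]] wrap_tendsto(1)]) auto
    show "(\<lambda>n. inner (f' (wrap n z)) (wrap' n z v)) \<longlonglongrightarrow> inner (f' z) v" for z v
      by (intro tendsto_intros 0 wrap_tendsto)
    show "(\<lambda>n. inner (f'' (wrap n z) (wrap' n z w)) (wrap' n z v) + inner (f' (wrap n z)) (wrap'' n z v w)) \<longlonglongrightarrow> inner (f'' z w) v" for z v w
      using tendsto_add[OF tendsto_inner[OF 1 wrap_tendsto(2)] tendsto_inner[OF 0 wrap_tendsto(3)]] by simp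
  qed
qed

section \<open>Weak convergence tested on smooth functions\<close>

lemma C2b_add:
  assumes "C2b C f f' f''" "C2b D g g' g''"
  shows "C2b (C + D) (\<lambda>x. f x + g x) (\<lambda>x. f' x + g' x) (\<lambda>x v. f'' x v + g'' x v)"
proof -
  note F = C2bD[OF assms(1)] and G = C2bD[OF assms(2)]
  show ?thesis
    unfolding C2b_def case_prod_beta' distrib_right inner_add_left
    by (intro conjI allI has_derivative_add F G order_trans[OF abs_triangle_ineq] add_mono
        order_trans[OF norm_triangle_ineq] continuous_intros)
qed

lemma C2b_const: "C2b \<bar>c\<bar> (\<lambda>x. c) (\<lambda>x. 0) (\<lambda>x v. 0)"
  unfolding C2b_def case_prod_beta' inner_zero_left by simp

lemma C2b_mult:
  assumes "C2b C f f' f''" "C2b D g g' g''"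
  shows "C2b (4 * (C * D)) (\<lambda>x. f x * g x) (\<lambda>x. f x *\<^sub>R g' x + g x *\<^sub>R f' x)
    (\<lambda>x v. (f x *\<^sub>R g'' x v + inner (f' x) v *\<^sub>R g' x) + (g x *\<^sub>R f'' x v + inner (g' x) v *\<^sub>R f' x))"
proof -
  note F = C2bD[OF assms(1)] and G = C2bD[OF assms(2)]
  have CD: "C * D \<ge> 0" using F(7) G(7) by simp
  have fi: "\<bar>inner (f' x) v\<bar> \<le> C * norm v" for x v
    using Cauchy_Schwarz_ineq2[of "f' x" v] mult_right_mono[OF F(5)[of x], of "norm v"] by simp
  have gi: "\<bar>inner (g' x) v\<bar> \<le> D * norm v" for x v
    using Cauchy_Schwarz_ineq2[of "g' x" v] mult_right_mono[OF G(5)[of x], of "norm v"] by simp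
  have m1: "norm (r *\<^sub>R u) \<le> C * D * c" if "\<bar>r\<bar> \<le> C" "norm u \<le> D * c" for r c and u :: 'a
    using mult_mono[OF that F(7)] by (simp add: mult.assoc)
  have m2: "norm (r *\<^sub>R u) \<le> C * D * c" if "\<bar>r\<bar> \<le> D" "norm u \<le> C * c" for r c and u :: 'a
    using mult_mono[OF that G(7)] by (simp add: mult_ac)
  have m3: "norm (r *\<^sub>R u) \<le> C * D * c" if "\<bar>r\<bar> \<le> C * c" "norm u \<le> D" "c \<ge> 0" for r c and u :: 'a
    using mult_mono[OF that(1,2)] F(7) that(3) by (simp add: mult_ac)
  have m4: "norm (r *\<^sub>R u) \<le> C * D * c" if "\<bar>r\<bar> \<le> D * c" "norm u \<le> C" "c \<ge> 0" for r c and u :: 'a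
    using mult_mono[OF that(1,2)] G(7) that(3) by (simp add: mult_ac)
  show ?thesis
    unfolding C2b_def case_prod_beta'
  proof (intro conjI allI)
    fix x v
    show "((\<lambda>x. f x * g x) has_derivative (\<lambda>v. inner (f x *\<^sub>R g' x + g x *\<^sub>R f' x) v)) (at x)"
      by (rule has_derivative_eq_rhs[OF has_derivative_mult[OF F(1) G(1)]])
        (simp add: inner_add_left algebra_simps)
    show "((\<lambda>x. f x *\<^sub>R g' x + g x *\<^sub>R f' x) has_derivative
      (\<lambda>v. (f x *\<^sub>R g'' x v + inner (f' x) v *\<^sub>R g' x) + (g x *\<^sub>R f'' x v + inner (g' x) v *\<^sub>R f' x))) (at x)"
      by (intro has_derivative_add has_derivative_scaleR F G)
    have "\<bar>f x * g x\<bar> \<le> C * D" using mult_mono[OF F(4)[of x] G(4)[of x] F(7)] by (simp add: abs_mult)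
    then show "\<bar>f x * g x\<bar> \<le> 4 * (C * D)" using CD by simp
    have "norm (f x *\<^sub>R g' x + g x *\<^sub>R f' x) \<le> C * D * 1 + C * D * 1"
      using F G by (intro norm_triangle_mono m1 m2) auto
    then show "norm (f x *\<^sub>R g' x + g x *\<^sub>R f' x) \<le> 4 * (C * D)" using CD by simp
    have "norm ((f x *\<^sub>R g'' x v + inner (f' x) v *\<^sub>R g' x) + (g x *\<^sub>R f'' x v + inner (g' x) v *\<^sub>R f' x))
      \<le> (C * D * norm v + C * D * norm v) + (C * D * norm v + C * D * norm v)"
      by (intro norm_triangle_mono m1 m2 m3 m4 F G fi gi) auto
    then show "norm ((f x *\<^sub>R g'' x v + inner (f' x) v *\<^sub>R g' x) + (g x *\<^sub>R f'' x v + inner (g' x) v *\<^sub>R f' x)) \<le> 4 * (C * D) * norm v"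
      by simp
  qed (intro continuous_intros F(8-10) G(8-10))
qed

definition smooth :: "('h::real_inner \<Rightarrow> real) \<Rightarrow> bool" where
  "smooth f \<longleftrightarrow> (\<exists>C f' f''. C2b C f f' f'')"

lemma smooth_const: "smooth (\<lambda>x. c)" and smooth_add: "smooth f \<Longrightarrow> smooth g \<Longrightarrow> smooth (\<lambda>x. f x + g x)"
  and smooth_mult: "smooth f \<Longrightarrow> smooth g \<Longrightarrow> smooth (\<lambda>x. f x * g x)"
  unfolding smooth_def using C2b_const C2b_add C2b_mult by blast+

lemma smooth_diff: "smooth f \<Longrightarrow> smooth g \<Longrightarrow> smooth (\<lambda>x. f x - g x)"
  using smooth_add[OF _ smooth_mult[OF smooth_const[of "-1"]], of f g] by simp

lemma smooth_sum: "(\<And>i. i < n \<Longrightarrow> smooth (f i)) \<Longrightarrow> smooth (\<lambda>x. \<Sum>i<n. f i x)" for n :: nat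
  by (induction n) (auto intro: smooth_const smooth_add)

lemma smooth_prod: "(\<And>i. i < n \<Longrightarrow> smooth (f i)) \<Longrightarrow> smooth (\<lambda>x. \<Prod>i<n. f i x)" for n :: nat
  by (induction n) (auto intro: smooth_const smooth_mult)

lemma smooth_continuous: "smooth f \<Longrightarrow> continuous_on UNIV f"
  unfolding smooth_def using C2bD(8)[OF _ continuous_on_id] by blast

lemma smooth_bounded: "smooth f \<Longrightarrow> \<exists>C. \<forall>x. \<bar>f x\<bar> \<le> C"
  unfolding smooth_def using C2bD(4) by blast

section \<open>Smooth bump functions and partitions of unity\<close>

lemma DERIV_max_power:
  "((\<lambda>u. (max 0 u) ^ Suc (Suc n)) has_real_derivative real (Suc (Suc n)) * (max 0 u) ^ Suc n) (at u)"
proof -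
  consider "u > 0" | "u < 0" | "u = 0" by linarith
  then show ?thesis
  proof cases
    case 1
    have "((\<lambda>u. u ^ Suc (Suc n)) has_real_derivative real (Suc (Suc n)) * u ^ Suc n) (at u)"
      using DERIV_pow[of "Suc (Suc n)" u] by simp
    moreover have "\<forall>\<^sub>F v in nhds u. v ^ Suc (Suc n) = (max 0 v) ^ Suc (Suc n)"
      using eventually_nhds_in_open[of "{0<..}" u] 1 by (auto elim: eventually_mono simp: max_def)
    ultimately have "((\<lambda>u. (max 0 u) ^ Suc (Suc n)) has_real_derivative real (Suc (Suc n)) * u ^ Suc n) (at u)"
      using DERIV_cong_ev[OF refl _ refl, of "\<lambda>v. v ^ Suc (Suc n)" "\<lambda>v. (max 0 v) ^ Suc (Suc n)" u] by blast
    moreover have "max 0 u = u" using 1 by simp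
    ultimately show ?thesis by simp
  next
    case 2
    have "\<forall>\<^sub>F v in nhds u. 0 = (max 0 v) ^ Suc (Suc n)"
      using eventually_nhds_in_open[of "{..<0}" u] 2 by (auto elim: eventually_mono simp: max_def)
    then show ?thesis using 2 DERIV_cong_ev[OF refl _ refl, of "\<lambda>_. 0" _ u 0] by (simp add: max_def)
  next
    case 3
    have "((\<lambda>h::real. (max 0 h) ^ Suc (Suc n) / h) \<longlongrightarrow> 0) (at 0)"
    proof (rule Lim_null_comparison)
      show "\<forall>\<^sub>F h::real in at 0. norm ((max 0 h) ^ Suc (Suc n) / h) \<le> \<bar>h\<bar> ^ Suc n"
      proof (rule always_eventually, rule allI)
        fix h :: real
        show "norm ((max 0 h) ^ Suc (Suc n) / h) \<le> \<bar>h\<bar> ^ Suc n"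
        proof (cases "h > 0")
          case False
          then have "(max 0 h) ^ Suc (Suc n) = 0" by simp
          moreover have "0 \<le> \<bar>h\<bar> ^ Suc n" by (rule zero_le_power) simp
          ultimately show ?thesis by (simp only: div_0 norm_zero)
        qed (simp add: max_def)
      qed
      have "((\<lambda>h. \<bar>h\<bar> ^ Suc n) \<longlongrightarrow> \<bar>0::real\<bar> ^ Suc n) (at 0)" by (intro tendsto_intros)
      then show "((\<lambda>h::real. \<bar>h\<bar> ^ Suc n) \<longlongrightarrow> 0) (at 0)" by simp
    qed
    then show ?thesis using 3 by (simp add: DERIV_def)
  qed
qed

text \<open>The squared norm is smooth on a Hilbert space, and the cube of a positive part is twice
  continuously differentiable, so no smooth cutoff on the line is required.\<close>

definition bump :: "'h::real_inner \<Rightarrow> real \<Rightarrow> 'h \<Rightarrow> real" where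
  "bump c R x = (max 0 (1 - (norm (x - c))\<^sup>2 / R\<^sup>2)) ^ 3"

lemma bump_pos:
  assumes "R > 0"
  shows "0 \<le> bump c R x" "bump c R x \<le> 1" "bump c R x > 0 \<longleftrightarrow> norm (x - c) < R"
proof -
  have "(norm (x - c))\<^sup>2 / R\<^sup>2 < 1 \<longleftrightarrow> (norm (x - c))\<^sup>2 < R\<^sup>2"
    using assms by (simp add: divide_less_eq)
  also have "\<dots> \<longleftrightarrow> norm (x - c) < R"
    using assms power2_less_imp_less[of "norm (x - c)" R] power_strict_mono[of "norm (x - c)" R 2] by auto
  finally show "bump c R x > 0 \<longleftrightarrow> norm (x - c) < R" by (simp add: bump_def zero_less_power_eq less_max_iff_disj)
  show "0 \<le> bump c R x" "bump c R x \<le> 1" by (simp_all add: bump_def power_le_one)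
qed

text \<open>The derivatives contain powers of \<open>x - c\<close>, which are unbounded, but each
  comes with a factor \<open>m x\<close> that vanishes outside the ball of radius \<open>R\<close>;
  the estimate \<open>near\<close> trades \<open>norm (x - c)\<close> for \<open>R\<close>. The
  constant \<open>k\<close> comes from differentiating the squared norm over
  \<open>R\<^sup>2\<close>.\<close>

lemma smooth_bump:
  fixes c :: "'h::real_inner"
  assumes R: "R > 0"
  shows "smooth (bump c R)"
proof -
  define m where "m x = max 0 (1 - (norm (x - c))\<^sup>2 / R\<^sup>2)" for x
  define k where "k = 2 / R\<^sup>2"
  have k: "k > 0" using R by (simp add: k_def)
  have phi: "((\<lambda>x. 1 - (norm (x - c))\<^sup>2 / R\<^sup>2) has_derivative (\<lambda>v. - k * inner (x - c) v)) (at x)" for x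
    unfolding power2_norm_eq_inner k_def
    by (rule has_derivative_eq_rhs, (rule derivative_intros)+) (use R in \<open>auto simp: inner_commute\<close>)
  have mp: "((\<lambda>x. m x ^ Suc (Suc n)) has_derivative (\<lambda>v. real (Suc (Suc n)) * m x ^ Suc n * (- k * inner (x - c) v))) (at x)" for n x
    unfolding m_def
    by (rule has_derivative_compose[OF phi DERIV_max_power[unfolded has_field_derivative_def]])
  have m: "0 \<le> m x" "m x \<le> 1" for x by (simp_all add: m_def)
  have near: "m x * norm (x - c) \<le> m x * R" for x
  proof (cases "m x = 0")
    case False
    then have "(norm (x - c))\<^sup>2 / R\<^sup>2 < 1" by (auto simp: m_def)
    then have "(norm (x - c))\<^sup>2 < R\<^sup>2" using R by (simp add: field_simps)
    then have "norm (x - c) < R" by (rule power2_less_imp_less) (use R in simp)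
    then show ?thesis using m[of x] by (intro mult_left_mono) auto
  qed simp
  let ?f' = "\<lambda>x. (- 3 * k * m x ^ 2) *\<^sub>R (x - c)"
  let ?f'' = "\<lambda>x v. (- 3 * k * m x ^ 2) *\<^sub>R v + (6 * k\<^sup>2 * m x * inner (x - c) v) *\<^sub>R (x - c)"
  define C where "C = 1 + 3 * k * R + (3 * k + 6 * k\<^sup>2 * R * R)"
  have mc: "continuous_on UNIV m"
    unfolding m_def by (intro continuous_intros) (use R in auto)
  have [continuous_intros]: "continuous_on S (\<lambda>z. m (X z))" if "continuous_on S X" for S :: "('h \<times> 'h) set" and X
    using continuous_on_compose2[OF mc that] by simp
  have "C2b C (bump c R) ?f' ?f''"
    unfolding C2b_def case_prod_beta'
  proof (intro conjI allI)
    fix x v :: 'h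
    show "(bump c R has_derivative (\<lambda>v. inner (?f' x) v)) (at x)"
      using mp[of 1 x] by (simp add: bump_def[abs_def] m_def numeral_3_eq_3 numeral_2_eq_2 mult_ac)
    have "((\<lambda>x. (- 3 * k * m x ^ 2) *\<^sub>R (x - c)) has_derivative
        (\<lambda>v. (- 3 * k * m x ^ 2) *\<^sub>R v + (- 3 * k * (2 * m x * (- k * inner (x - c) v))) *\<^sub>R (x - c))) (at x)"
    proof (rule has_derivative_scaleR)
      show "((\<lambda>x. - 3 * k * m x ^ 2) has_derivative (\<lambda>v. - 3 * k * (2 * m x * (- k * inner (x - c) v)))) (at x)"
        using has_derivative_mult_right[OF mp[of 0 x], of "- 3 * k"] by (simp add: numeral_2_eq_2)
      show "((\<lambda>x. x - c) has_derivative (\<lambda>v. v)) (at x)" by (auto intro!: derivative_eq_intros)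
    qed
    then show "(?f' has_derivative ?f'' x) (at x)" by (simp add: power2_eq_square mult_ac)
    have kR: "0 \<le> 3 * k * R" "0 \<le> 3 * k" "0 \<le> 6 * k\<^sup>2 * R * R" using k R by auto
    have "\<bar>bump c R x\<bar> \<le> 1" using bump_pos[OF R, of c x] by simp
    then show "\<bar>bump c R x\<bar> \<le> C" using kR unfolding C_def by linarith
    have m2: "m x ^ 2 \<le> 1" "m x ^ 2 \<le> m x"
      using power_le_one[OF m(1,2), of x 2] mult_left_le[OF m(2,1), of x x] by (simp_all add: power2_eq_square)
    have mR: "m x * norm (x - c) \<le> R"
      using near[of x] mult_right_mono[OF m(2)[of x], of R] R by linarith
    have "m x ^ 2 * norm (x - c) \<le> m x * norm (x - c)" using m2 by (intro mult_right_mono) auto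
    then have "m x ^ 2 * norm (x - c) \<le> R" using mR by linarith
    then have "norm (?f' x) \<le> 3 * k * R" using k by (simp add: abs_mult)
    then show "norm (?f' x) \<le> C" using kR unfolding C_def by linarith
    have 1: "norm ((- 3 * k * m x ^ 2) *\<^sub>R v) \<le> 3 * k * norm v"
      using k m2 by (simp add: abs_mult mult_left_le_one_le mult_right_mono)
    have far: "m x * (norm (x - c) * norm (x - c)) \<le> R * R"
    proof -
      have "m x * (norm (x - c) * norm (x - c)) \<le> (m x * norm (x - c)) * norm (x - c)" by simp
      also have "\<dots> \<le> (m x * R) * norm (x - c)" using near[of x] by (intro mult_right_mono) auto
      also have "\<dots> = (m x * norm (x - c)) * R" by simp
      also have "\<dots> \<le> R * R" using mR R by (intro mult_right_mono) auto
      finally show ?thesis .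
    qed
    have "norm ((6 * k\<^sup>2 * m x * inner (x - c) v) *\<^sub>R (x - c)) = 6 * k\<^sup>2 * m x * \<bar>inner (x - c) v\<bar> * norm (x - c)"
      using m[of x] by (simp add: abs_mult)
    also have "\<dots> \<le> 6 * k\<^sup>2 * m x * (norm (x - c) * norm v) * norm (x - c)"
      using m[of x] by (intro mult_right_mono mult_left_mono Cauchy_Schwarz_ineq2) auto
    also have "\<dots> = 6 * k\<^sup>2 * (m x * (norm (x - c) * norm (x - c))) * norm v" by (simp add: mult_ac)
    also have "\<dots> \<le> 6 * k\<^sup>2 * (R * R) * norm v"
      using far by (intro mult_right_mono mult_left_mono) auto
    finally have "norm (?f'' x v) \<le> 3 * k * norm v + 6 * k\<^sup>2 * (R * R) * norm v"
      using 1 by (intro norm_triangle_mono)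
    moreover have "0 \<le> (1 + 3 * k * R) * norm v" using kR by simp
    ultimately show "norm (?f'' x v) \<le> C * norm v" unfolding C_def by (simp add: algebra_simps)
  qed (intro continuous_intros)
  then show ?thesis unfolding smooth_def by blast
qed

text \<open>A partition of unity subordinate to small balls reduces bounded continuous functions
  to smooth ones. Every ball is listed infinitely often, so that the products tend to 0.\<close>

lemma smooth_partition:
  fixes g :: "'h::{real_inner, second_countable_topology} \<Rightarrow> real"
  assumes g: "continuous_on UNIV g" and G: "\<And>x. \<bar>g x\<bar> \<le> G" and \<epsilon>: "\<epsilon> > 0"
  obtains h \<rho> :: "nat \<Rightarrow> 'h \<Rightarrow> real" where "\<And>n. smooth (h n)" "\<And>n. smooth (\<rho> n)"
    "\<And>n x. 0 \<le> \<rho> n x" "\<And>n x. \<rho> n x \<le> 1" "\<And>x. (\<lambda>n. \<rho> n x) \<longlonglongrightarrow> 0"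
    "\<And>n x. \<bar>g x - h n x\<bar> \<le> \<epsilon> + G * \<rho> n x"
proof -
  have "\<exists>r>0. \<forall>x\<in>ball c r. \<bar>g x - g c\<bar> < \<epsilon>" for c
  proof -
    have "isCont g c" using g by (simp add: continuous_on_eq_continuous_at)
    then obtain d where "d > 0" "\<forall>x. dist x c < d \<longrightarrow> dist (g x) (g c) < \<epsilon>"
      using \<epsilon> unfolding continuous_at_eps_delta by blast
    then show ?thesis by (intro exI[of _ d]) (auto simp: dist_real_def dist_commute)
  qed
  then obtain r where r: "\<And>c. r c > 0" "\<And>c x. x \<in> ball c (r c) \<Longrightarrow> \<bar>g x - g c\<bar> < \<epsilon>" by metis
  obtain \<F> where \<F>: "\<F> \<subseteq> range (\<lambda>c. ball c (r c))" "countable \<F>" "\<Union>\<F> = \<Union>(range (\<lambda>c. ball c (r c)))"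
    using Lindelof[of "range (\<lambda>c. ball c (r c))"] by (metis (no_types, lifting) imageE open_ball)
  have UN: "\<Union>\<F> = UNIV" unfolding \<F>(3) using r(1) by (auto intro: centre_in_ball[THEN iffD2])
  then have "\<F> \<noteq> {}" by auto
  then have "range (from_nat_into \<F>) = \<F>" using \<F>(2) by simp
  then have "\<exists>c. from_nat_into \<F> k = ball c (r c)" for k using \<F>(1) by (metis imageE rangeI subsetD)
  then obtain cc where cc: "\<And>k. from_nat_into \<F> k = ball (cc k) (r (cc k))" by metis
  define c where "c i = cc (fst (prod_decode i))" for i
  define b where "b i = bump (c i) (r (c i))" for i
  \<comment> \<open>The weights \<open>b i x * \<rho> i x\<close> telescope to
    \<open>1 - \<rho> n x\<close>, so \<open>\<rho> n\<close> is the mass not yet covered by the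
    first \<open>n\<close> bumps.\<close>
  define \<rho> where "\<rho> n x = (\<Prod>j<n. 1 - b j x)" for n x
  define h where "h n x = (\<Sum>i<n. g (c i) * (b i x * \<rho> i x))" for n x
  have b: "smooth (b i)" "0 \<le> b i x" "b i x \<le> 1" "b i x > 0 \<longleftrightarrow> x \<in> ball (c i) (r (c i))" for i x
  proof -
    show "b i x > 0 \<longleftrightarrow> x \<in> ball (c i) (r (c i))"
      unfolding b_def bump_pos(3)[OF r(1)] by (simp add: dist_norm norm_minus_commute)
  qed (simp_all add: b_def smooth_bump[OF r(1)] bump_pos[OF r(1)])
  have \<rho>: "smooth (\<rho> n)" "0 \<le> \<rho> n x" "\<rho> n x \<le> 1" for n x
    unfolding \<rho>_def using b by (auto intro!: smooth_prod smooth_diff smooth_const prod_nonneg prod_le_1)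
  have tele: "(\<Sum>i<n. b i x * \<rho> i x) = 1 - \<rho> n x" for n x
    by (induction n) (auto simp: \<rho>_def algebra_simps)
  show ?thesis
  proof (rule that[of h \<rho>])
    show "smooth (h n)" for n unfolding h_def by (intro smooth_sum smooth_mult smooth_const b \<rho>)
    show "\<bar>g x - h n x\<bar> \<le> \<epsilon> + G * \<rho> n x" for n x
    proof -
      have eq: "g x - h n x = (\<Sum>i<n. (g x - g (c i)) * (b i x * \<rho> i x)) + g x * \<rho> n x"
        unfolding h_def
        by (simp add: left_diff_distrib sum_subtractf sum_distrib_left[symmetric] tele right_diff_distrib)
      have "\<bar>\<Sum>i<n. (g x - g (c i)) * (b i x * \<rho> i x)\<bar> \<le> (\<Sum>i<n. \<epsilon> * (b i x * \<rho> i x))"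
      proof (rule order_trans[OF sum_abs sum_mono])
        fix i
        show "\<bar>(g x - g (c i)) * (b i x * \<rho> i x)\<bar> \<le> \<epsilon> * (b i x * \<rho> i x)"
        proof (cases "b i x > 0")
          case True
          then have "\<bar>g x - g (c i)\<bar> \<le> \<epsilon>" using r(2) b(4) by (metis less_imp_le)
          then show ?thesis using b(2)[of i x] \<rho>(2)[of i x] by (simp add: abs_mult mult_right_mono)
        next
          case False
          then have "b i x = 0" using b(2)[of i x] by simp
          then show ?thesis by simp
        qed
      qed
      also have "\<dots> = \<epsilon> * (1 - \<rho> n x)" by (simp add: sum_distrib_left[symmetric] tele)
      also have "\<dots> \<le> \<epsilon>" using \<epsilon> \<rho>(2)[of n x] by (simp add: algebra_simps)
      finally have "\<bar>\<Sum>i<n. (g x - g (c i)) * (b i x * \<rho> i x)\<bar> \<le> \<epsilon>" .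
      moreover have "\<bar>g x * \<rho> n x\<bar> \<le> G * \<rho> n x"
        using G[of x] \<rho>(2)[of n x] by (simp add: abs_mult mult_right_mono)
      ultimately show ?thesis unfolding eq by linarith
    qed
    show "(\<lambda>n. \<rho> n x) \<longlonglongrightarrow> 0" for x
    proof -
      obtain k where k: "x \<in> ball (cc k) (r (cc k))"
        using UN \<open>range (from_nat_into \<F>) = \<F>\<close> cc by (metis UNIV_I UnionE imageE)
      have "decseq (\<lambda>n. \<rho> n x)"
        by (rule decseq_SucI) (use b(2) \<rho>(2)[of _ x] in \<open>simp add: \<rho>_def algebra_simps\<close>)
      then obtain L where L: "(\<lambda>n. \<rho> n x) \<longlonglongrightarrow> L"
        by (rule decseq_convergent[of _ 0]) (use \<rho>(2) in blast)+
      have "summable (\<lambda>i. b i x * \<rho> i x)"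
        unfolding summable_def sums_def tele using tendsto_diff[OF tendsto_const L] by blast
      then have z: "(\<lambda>i. b i x * \<rho> i x) \<longlonglongrightarrow> 0" by (rule summable_LIMSEQ_zero)
      \<comment> \<open>Along these indices the same ball recurs, so \<open>b\<close> keeps one
        positive value at \<open>x\<close>. Since the telescoping terms tend to 0, the limit of
        \<open>\<rho>\<close> must be 0.\<close>
      define i where "i m = prod_encode (k, m)" for m
      have fi: "filterlim i at_top sequentially"
        unfolding i_def by (rule filterlim_at_top_mono[OF filterlim_ident]) (simp add: le_prod_encode_2)
      have bi: "b (i m) x = b (i 0) x" for m by (simp add: i_def b_def c_def)
      have "b (i 0) x > 0" using k by (simp add: b(4) i_def c_def del: mem_ball)
      moreover have "(\<lambda>m. b (i 0) x * \<rho> (i m) x) \<longlonglongrightarrow> 0"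
      proof -
        have "(\<lambda>m. b (i m) x * \<rho> (i m) x) = (\<lambda>m. b (i 0) x * \<rho> (i m) x)" by (rule ext) (subst bi, rule refl)
        then show ?thesis using filterlim_compose[OF z fi] by simp
      qed
      moreover have "(\<lambda>m. b (i 0) x * \<rho> (i m) x) \<longlonglongrightarrow> b (i 0) x * L"
        by (intro tendsto_mult tendsto_const filterlim_compose[OF L fi])
      ultimately have "L = 0" using LIMSEQ_unique by fastforce
      then show ?thesis using L by simp
    qed
  qed (use \<rho> in auto)
qed

text \<open>The uncovered mass \<open>\<rho> n\<close> is itself smooth. Fixing \<open>n\<close>
  with small expected \<open>\<rho> n\<close> at the limit \<open>X'\<close>, convergence on smooth
  functions makes it small for all late \<open>X m\<close> too. This uniform control plays the role
  of tightness.\<close>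

lemma (in prob_space) expectation_tendsto_if_smooth:
  fixes X :: "nat \<Rightarrow> 'a \<Rightarrow> 'h::{real_inner, second_countable_topology}" and g :: "'h \<Rightarrow> real"
  assumes X: "\<And>n. random_variable borel (X n)" "random_variable borel X'"
    and sm: "\<And>f. smooth f \<Longrightarrow> (\<lambda>n. expectation (\<lambda>\<omega>. f (X n \<omega>))) \<longlonglongrightarrow> expectation (\<lambda>\<omega>. f (X' \<omega>))"
    and g: "continuous_on UNIV g" "\<And>x. \<bar>g x\<bar> \<le> G"
  shows "(\<lambda>n. expectation (\<lambda>\<omega>. g (X n \<omega>))) \<longlonglongrightarrow> expectation (\<lambda>\<omega>. g (X' \<omega>))"
proof (rule metric_LIMSEQ_I)
  fix e :: real assume e: "e > 0"
  have G: "G \<ge> 0" using g(2)[of undefined] by linarith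
  \<comment> \<open>Three errors of size \<open>\<epsilon>\<close> and two of size
    \<open>G * \<epsilon>\<close> have to fit into \<open>e\<close>.\<close>
  define \<epsilon> where "\<epsilon> = e / (3 + 3 * G)"
  have \<epsilon>: "\<epsilon> > 0" "\<epsilon> * (3 + 3 * G) = e" using e G by (simp_all add: \<epsilon>_def)
  obtain h \<rho> where h: "\<And>n. smooth (h n)" "\<And>n. smooth (\<rho> n)"
    "\<And>n x. 0 \<le> \<rho> n x" "\<And>n x. \<rho> n x \<le> 1" "\<And>x. (\<lambda>n. \<rho> n x) \<longlonglongrightarrow> 0"
    "\<And>n x. \<bar>g x - h n x\<bar> \<le> \<epsilon> + G * \<rho> n x"
    using smooth_partition[OF g \<epsilon>(1)] by blast
  have int: "integrable M (\<lambda>\<omega>. f (W \<omega>))"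
    if "random_variable borel W" "continuous_on UNIV f" "\<And>x. \<bar>f x\<bar> \<le> B" for W :: "'a \<Rightarrow> 'h" and f :: "'h \<Rightarrow> real" and B
    using measurable_compose[OF that(1) borel_measurable_continuous_onI[OF that(2)]] that(3)
    by (intro integrable_const_bound[where B = B]) auto
  have sint: "integrable M (\<lambda>\<omega>. f (W \<omega>))" if "random_variable borel W" "smooth f" for W :: "'a \<Rightarrow> 'h" and f
    using smooth_bounded[OF that(2)] int[OF that(1) smooth_continuous[OF that(2)]] by blast
  have approx: "\<bar>expectation (\<lambda>\<omega>. g (W \<omega>)) - expectation (\<lambda>\<omega>. h n (W \<omega>))\<bar> \<le> \<epsilon> + G * expectation (\<lambda>\<omega>. \<rho> n (W \<omega>))"
    if W: "random_variable borel W" for W :: "'a \<Rightarrow> 'h" and n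
  proof -
    have "\<bar>expectation (\<lambda>\<omega>. g (W \<omega>)) - expectation (\<lambda>\<omega>. h n (W \<omega>))\<bar> = \<bar>expectation (\<lambda>\<omega>. g (W \<omega>) - h n (W \<omega>))\<bar>"
      using int[OF W g] sint[OF W h(1)] by simp
    also have "\<dots> \<le> expectation (\<lambda>\<omega>. \<bar>g (W \<omega>) - h n (W \<omega>)\<bar>)"
      using integral_norm_bound[of M "\<lambda>\<omega>. g (W \<omega>) - h n (W \<omega>)"] by simp
    also have "\<dots> \<le> expectation (\<lambda>\<omega>. \<epsilon> + G * \<rho> n (W \<omega>))"
      using int[OF W g] sint[OF W h(1)] sint[OF W h(2)] h(6) by (intro integral_mono) auto
    also have "\<dots> = \<epsilon> + G * expectation (\<lambda>\<omega>. \<rho> n (W \<omega>))"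
      using sint[OF W h(2)] by (simp add: prob_space)
    finally show ?thesis .
  qed
  have "(\<lambda>n. expectation (\<lambda>\<omega>. \<rho> n (X' \<omega>))) \<longlonglongrightarrow> expectation (\<lambda>\<omega>. 0)"
    using h by (intro tendsto_expectation[where B = 1] measurable_compose[OF X(2)]
        borel_measurable_continuous_onI smooth_continuous) (auto intro: smooth_const)
  then have "\<forall>\<^sub>F n in sequentially. expectation (\<lambda>\<omega>. \<rho> n (X' \<omega>)) < \<epsilon>"
    using \<epsilon> by (intro order_tendstoD) auto
  then obtain n where n: "expectation (\<lambda>\<omega>. \<rho> n (X' \<omega>)) < \<epsilon>" unfolding eventually_sequentially by blast
  have "\<forall>\<^sub>F m in sequentially. expectation (\<lambda>\<omega>. \<rho> n (X m \<omega>)) < \<epsilon>"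
    using sm[OF h(2)] n by (intro order_tendstoD) auto
  moreover have "\<forall>\<^sub>F m in sequentially. dist (expectation (\<lambda>\<omega>. h n (X m \<omega>))) (expectation (\<lambda>\<omega>. h n (X' \<omega>))) < \<epsilon>"
    using sm[OF h(1)] \<epsilon> unfolding tendsto_iff by blast
  ultimately have "\<forall>\<^sub>F m in sequentially. dist (expectation (\<lambda>\<omega>. g (X m \<omega>))) (expectation (\<lambda>\<omega>. g (X' \<omega>))) < e"
  proof eventually_elim
    case (elim m)
    have "G * expectation (\<lambda>\<omega>. \<rho> n (X m \<omega>)) \<le> G * \<epsilon>" "G * expectation (\<lambda>\<omega>. \<rho> n (X' \<omega>)) \<le> G * \<epsilon>"
      using elim n G by (auto intro!: mult_left_mono)
    then have "dist (expectation (\<lambda>\<omega>. g (X m \<omega>))) (expectation (\<lambda>\<omega>. g (X' \<omega>))) < 3 * \<epsilon> + 2 * (G * \<epsilon>)"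
      using approx[OF X(1), of m n] approx[OF X(2), of n] elim unfolding dist_real_def by linarith
    also have "\<dots> \<le> \<epsilon> * (3 + 3 * G)" using \<epsilon>(1) G by (simp add: algebra_simps)
    finally show ?case using \<epsilon>(2) by simp
  qed
  then show "\<exists>no. \<forall>n\<ge>no. dist (expectation (\<lambda>\<omega>. g (X n \<omega>))) (expectation (\<lambda>\<omega>. g (X' \<omega>))) < e"
    unfolding eventually_sequentially .
qed

context ou_setting
begin

section \<open>Continuity in time\<close>

text \<open>Starting from 0, which lies in the domain and is fixed by \<open>T\<close>, the flow is
  \<open>Y\<close> itself. An indefinite gauge integral is continuous whatever the regularity of its
  integrand.\<close>

lemma expectation_Y_tendsto:
  assumes s: "s \<longlonglongrightarrow> s'" "\<And>n. s n \<ge> 0" "s' \<ge> 0" and f: "smooth f"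
  shows "(\<lambda>n. \<integral>\<omega>. f (Y (s n) \<omega>) \<partial>M) \<longlonglongrightarrow> (\<integral>\<omega>. f (Y s' \<omega>) \<partial>M)"
proof -
  obtain C f' f'' where f: "C2b C f f' f''" using f unfolding smooth_def by blast
  have "((\<lambda>t. (T t 0 - 0) /\<^sub>R t) \<longlongrightarrow> 0) (at_right 0)"
    using eventually_at_right_less[of 0] by (intro tendsto_eventually) (auto elim!: eventually_mono simp: T_linear)
  then have "0 \<in> DA" by (rule generatorI(1)[OF A_gen])
  from dynkin_C2b[OF this f] obtain p q where
    I: "\<And>t. t \<ge> 0 \<Longrightarrow> ((\<lambda>s. gen0 f p q s 0) has_integral (P t f 0 - f 0)) {0..t}"
    unfolding dynkin_def by blast
  have "Bseq s" using s(1) convergentI convergent_imp_Bseq by blast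
  then obtain K where K: "\<And>n. \<bar>s n\<bar> \<le> K" unfolding Bseq_def by auto
  have sK: "s n \<le> K" for n using K[of n] by simp
  have K0: "s' \<le> K" "K \<ge> 0" using LIMSEQ_le_const2[OF s(1), of K] sK order_trans[OF s(2) sK] by auto
  have "continuous_on {0..K} (\<lambda>t. integral {0..t} (\<lambda>s. gen0 f p q s 0))"
    using I[OF K0(2)] by (intro indefinite_integral_continuous_1) auto
  then have "(\<lambda>n. integral {0..s n} (\<lambda>s. gen0 f p q s 0)) \<longlonglongrightarrow> integral {0..s'} (\<lambda>s. gen0 f p q s 0)"
    by (rule continuous_on_tendsto_compose[OF _ s(1)]) (use s(2,3) sK K0 in auto)
  then have "(\<lambda>n. f 0 + integral {0..s n} (\<lambda>s. gen0 f p q s 0)) \<longlonglongrightarrow> f 0 + integral {0..s'} (\<lambda>s. gen0 f p q s 0)"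
    by (intro tendsto_intros)
  moreover have "f 0 + integral {0..t} (\<lambda>s. gen0 f p q s 0) = (\<integral>\<omega>. f (Y t \<omega>) \<partial>M)" if "t \<ge> 0" for t
    using integral_unique[OF I[OF that]] by (simp add: ou_semigroup_def T_linear[OF that])
  ultimately show ?thesis using s by simp
qed

text \<open>For a smooth test function the moving base point is frozen at \<open>T s' x'\<close>, at
  a cost controlled by its Lipschitz constant; the translated function is then used merely as a
  bounded continuous one. A second appeal to \<open>expectation_tendsto_if_smooth\<close> passes
  from smooth functions to \<open>g\<close>.\<close>

lemma flow_tendsto:
  fixes g :: "'h \<Rightarrow> real"
  assumes s: "s \<longlonglongrightarrow> s'" "\<And>n. s n \<ge> 0" "s' \<ge> 0" and x: "x \<longlonglongrightarrow> x'"
    and g: "continuous_on UNIV g" "\<And>z. \<bar>g z\<bar> \<le> G"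
  shows "(\<lambda>n. \<integral>\<omega>. g (T (s n) (x n) + Y (s n) \<omega>) \<partial>M) \<longlonglongrightarrow> (\<integral>\<omega>. g (T s' x' + Y s' \<omega>) \<partial>M)"
proof (rule expectation_tendsto_if_smooth[OF _ _ _ g])
  show rv: "(\<lambda>\<omega>. T (s n) (x n) + Y (s n) \<omega>) \<in> borel_measurable M" "(\<lambda>\<omega>. T s' x' + Y s' \<omega>) \<in> borel_measurable M" for n
    using s by auto
  fix f :: "'h \<Rightarrow> real" assume "smooth f"
  then obtain C f' f'' where "C2b C f f' f''" unfolding smooth_def by blast
  note j = C2b_jet2[OF this]
  have fc: "continuous_on UNIV (\<lambda>z. f (T s' x' + z))"
    by (intro jet2_continuous_on[OF j] continuous_intros)
  have 1: "(\<lambda>n. \<integral>\<omega>. f (T s' x' + Y (s n) \<omega>) \<partial>M) \<longlonglongrightarrow> (\<integral>\<omega>. f (T s' x' + Y s' \<omega>) \<partial>M)"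
    using s jet2D(6)[OF j]
    by (intro expectation_tendsto_if_smooth[OF _ _ expectation_Y_tendsto[OF s] fc]) auto
  have Tx: "(\<lambda>n. T (s n) (x n) - T s' x') \<longlonglongrightarrow> 0"
    using T_tendsto[OF s(1) _ s(3) x] s(2) by (simp add: LIM_zero)
  have "(\<lambda>n. (\<integral>\<omega>. f (T (s n) (x n) + Y (s n) \<omega>) \<partial>M) - (\<integral>\<omega>. f (T s' x' + Y (s n) \<omega>) \<partial>M)) \<longlonglongrightarrow> 0"
  proof (rule Lim_null_comparison)
    show "(\<lambda>n. 2 * C * norm (T (s n) (x n) - T s' x')) \<longlonglongrightarrow> 0"
      using tendsto_mult[OF tendsto_const tendsto_norm_zero[OF Tx], of "2 * C"] by simp
    have "norm ((\<integral>\<omega>. f (T (s n) (x n) + Y (s n) \<omega>) \<partial>M) - (\<integral>\<omega>. f (T s' x' + Y (s n) \<omega>) \<partial>M))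
        \<le> 2 * C * norm (T (s n) (x n) - T s' x')" for n
    proof -
      have i: "integrable M (\<lambda>\<omega>. f (z + Y (s n) \<omega>))" for z
      proof (rule integrable_const_bound[where B = "2 * C"])
        have "continuous_on UNIV (\<lambda>y. f (z + y))" by (intro jet2_continuous_on[OF j] continuous_intros)
        then show "(\<lambda>\<omega>. f (z + Y (s n) \<omega>)) \<in> borel_measurable M"
          by (rule measurable_compose[OF Y_measurable[OF s(2)[of n]] borel_measurable_continuous_onI])
      qed (use jet2D(6)[OF j] in auto)
      have "(\<integral>\<omega>. f (T (s n) (x n) + Y (s n) \<omega>) \<partial>M) - (\<integral>\<omega>. f (T s' x' + Y (s n) \<omega>) \<partial>M)
          = (\<integral>\<omega>. f (T (s n) (x n) + Y (s n) \<omega>) - f (T s' x' + Y (s n) \<omega>) \<partial>M)"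
        using i by simp
      also have "norm \<dots> \<le> 2 * C * norm (T (s n) (x n) - T s' x')"
      proof (rule integral_norm_le)
        fix \<omega>
        show "norm (f (T (s n) (x n) + Y (s n) \<omega>) - f (T s' x' + Y (s n) \<omega>)) \<le> 2 * C * norm (T (s n) (x n) - T s' x')"
          using jet2_taylor(1)[OF j, of "T s' x' + Y (s n) \<omega>" "T (s n) (x n) - T s' x'"] by (simp add: algebra_simps)
      qed
      finally show ?thesis .
    qed
    then show "\<forall>\<^sub>F n in sequentially. norm ((\<integral>\<omega>. f (T (s n) (x n) + Y (s n) \<omega>) \<partial>M) - (\<integral>\<omega>. f (T s' x' + Y (s n) \<omega>) \<partial>M))
        \<le> 2 * C * norm (T (s n) (x n) - T s' x')" by simp
  qed
  from tendsto_add[OF this 1]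
  show "(\<lambda>n. \<integral>\<omega>. f (T (s n) (x n) + Y (s n) \<omega>) \<partial>M) \<longlonglongrightarrow> (\<integral>\<omega>. f (T s' x' + Y s' \<omega>) \<partial>M)" by simp
qed

text \<open>In the derivatives of \<open>P s f\<close> the direction \<open>T (s n) v\<close> moves
  along with the law. As the derivatives of \<open>f\<close> are bounded, the integrands converge
  uniformly in the space point, which is all that is required here.\<close>

lemma flow_tendsto_perturbed:
  fixes g :: "'h \<Rightarrow> real" and \<delta> :: "nat \<Rightarrow> real"
  assumes s: "s \<longlonglongrightarrow> s'" "\<And>n. s n \<ge> 0" "s' \<ge> 0" and x: "x \<longlonglongrightarrow> x'"
    and g: "continuous_on UNIV g" "\<And>z. \<bar>g z\<bar> \<le> G"
    and h: "\<And>n. continuous_on UNIV (h n)" "\<And>n z. \<bar>h n z - g z\<bar> \<le> \<delta> n" "\<delta> \<longlonglongrightarrow> 0"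
  shows "(\<lambda>n. \<integral>\<omega>. h n (T (s n) (x n) + Y (s n) \<omega>) \<partial>M) \<longlonglongrightarrow> (\<integral>\<omega>. g (T s' x' + Y s' \<omega>) \<partial>M)"
proof -
  let ?W = "\<lambda>n \<omega>. T (s n) (x n) + Y (s n) \<omega>"
  have "norm ((\<integral>\<omega>. h n (?W n \<omega>) \<partial>M) - (\<integral>\<omega>. g (?W n \<omega>) \<partial>M)) \<le> \<delta> n" for n
  proof -
    have "\<bar>h n z\<bar> \<le> G + \<delta> n" for z using g(2)[of z] h(2)[of n z] by linarith
    then have "integrable M (\<lambda>\<omega>. h n (?W n \<omega>))"
      using measurable_flow[OF s(2) h(1)] by (intro integrable_const_bound[where B = "G + \<delta> n"]) auto
    moreover have "integrable M (\<lambda>\<omega>. g (?W n \<omega>))"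
      using measurable_flow[OF s(2) g(1)] g(2) by (intro integrable_const_bound[where B = G]) auto
    ultimately have "(\<integral>\<omega>. h n (?W n \<omega>) \<partial>M) - (\<integral>\<omega>. g (?W n \<omega>) \<partial>M) = (\<integral>\<omega>. h n (?W n \<omega>) - g (?W n \<omega>) \<partial>M)" by simp
    also have "norm \<dots> \<le> \<delta> n" by (rule integral_norm_le) (simp add: h(2))
    finally show ?thesis .
  qed
  then have "(\<lambda>n. (\<integral>\<omega>. h n (?W n \<omega>) \<partial>M) - (\<integral>\<omega>. g (?W n \<omega>) \<partial>M)) \<longlonglongrightarrow> 0"
    by (intro Lim_null_comparison[OF _ h(3)]) simp
  from tendsto_add[OF this flow_tendsto[OF s x g]] show ?thesis by simp
qed

lemma gen1_continuous:
  assumes f: "C2b C f f' f''" and s: "s \<longlonglongrightarrow> s'" "\<And>n. s n \<ge> 0" "s' \<ge> 0" and x: "x \<longlonglongrightarrow> x'"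
  defines "p \<equiv> \<lambda>z v. inner (f' z) v" and "q \<equiv> \<lambda>z v w. inner (f'' z w) v"
  shows "(\<lambda>n. P (s n) f (x n)) \<longlonglongrightarrow> P s' f x'"
    and "(\<lambda>n. Pd1 p (s n) (x n) v) \<longlonglongrightarrow> Pd1 p s' x' v"
    and "(\<lambda>n. gen1 f p q (s n) (x n)) \<longlonglongrightarrow> gen1 f p q s' x'"
proof -
  note D = C2bD[OF f]
  have j: "jet2 (2 * C) f p q" unfolding p_def q_def by (rule C2b_jet2[OF f])
  have P: "(\<lambda>n. P (s n) f (y n)) \<longlonglongrightarrow> P s' f y'" if "y \<longlonglongrightarrow> y'" for y y'
    unfolding ou_semigroup_def by (rule flow_tendsto[OF s that jet2D(3)[OF j] D(4)])
  have T0: "(\<lambda>n. norm (T (s n) v - T s' v)) \<longlonglongrightarrow> 0" for v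
    using T_tendsto[OF s(1) _ s(3) tendsto_const] s(2) by (simp add: LIM_zero tendsto_norm_zero)
  have cs: "\<bar>inner u v\<bar> \<le> c * norm v" if "norm u \<le> c" for c and u v :: 'h
    using Cauchy_Schwarz_ineq2[of u v] mult_right_mono[OF that, of "norm v"] by simp
  have Pd1: "(\<lambda>n. Pd1 p (s n) (x n) v) \<longlonglongrightarrow> Pd1 p s' x' v" for v
    unfolding Pd1_def p_def
  proof (rule flow_tendsto_perturbed[OF s x])

    show "\<bar>inner (f' z) (T s' v)\<bar> \<le> C * norm (T s' v)" for z by (rule cs[OF D(5)])
    show "\<bar>inner (f' z) (T (s n) v) - inner (f' z) (T s' v)\<bar> \<le> C * norm (T (s n) v - T s' v)" for n z
      using cs[OF D(5)[of z]] by (simp add: inner_diff_right[symmetric])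
    show "(\<lambda>n. C * norm (T (s n) v - T s' v)) \<longlonglongrightarrow> 0" using tendsto_mult[OF tendsto_const T0, of C] by simp
  qed (intro continuous_intros D)+
  have Pd2: "(\<lambda>n. Pd2 q (s n) (x n) v w) \<longlonglongrightarrow> Pd2 q s' x' v w" for v w
    unfolding Pd2_def q_def
  proof (rule flow_tendsto_perturbed[OF s x])

    show "\<bar>inner (f'' z (T s' w)) (T s' v)\<bar> \<le> C * norm (T s' w) * norm (T s' v)" for z by (rule cs[OF D(6)])
    \<comment> \<open>The bilinear splitting: one direction is changed at a time.\<close>
    let ?\<delta> = "\<lambda>n. C * norm (T (s n) w - T s' w) * norm (T (s n) v) + C * norm (T s' w) * norm (T (s n) v - T s' v)"
    show "\<bar>inner (f'' z (T (s n) w)) (T (s n) v) - inner (f'' z (T s' w)) (T s' v)\<bar> \<le> ?\<delta> n" for n z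
    proof -
      have "inner (f'' z (T (s n) w)) (T (s n) v) - inner (f'' z (T s' w)) (T s' v)
        = inner (f'' z (T (s n) w - T s' w)) (T (s n) v) + inner (f'' z (T s' w)) (T (s n) v - T s' v)"
        by (simp add: linear_diff[OF has_derivative_linear[OF D(2)]] inner_diff_left inner_diff_right)
      also have "\<bar>\<dots>\<bar> \<le> ?\<delta> n"
        by (intro order_trans[OF abs_triangle_ineq] add_mono cs D(6))
      finally show ?thesis .
    qed
    have "?\<delta> \<longlonglongrightarrow> C * 0 * norm (T s' v) + C * norm (T s' w) * 0"
      using T_tendsto[OF s(1) _ s(3) tendsto_const] s(2) by (intro tendsto_intros T0) auto
    then show "?\<delta> \<longlonglongrightarrow> 0" by simp
  qed (intro continuous_intros D)+
  show "(\<lambda>n. P (s n) f (x n)) \<longlonglongrightarrow> P s' f x'" by (rule P[OF x])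
  show "(\<lambda>n. Pd1 p (s n) (x n) v) \<longlonglongrightarrow> Pd1 p s' x' v" by (rule Pd1)
  show "(\<lambda>n. gen1 f p q (s n) (x n)) \<longlonglongrightarrow> gen1 f p q s' x'"
    by (rule gen1_tendsto[OF j j s P Pd1 Pd2]) (intro tendsto_intros x)
qed

end

section \<open>Derivatives of the semigroup\<close>

lemma GDERIV_unique: "GDERIV f x :> g \<Longrightarrow> GDERIV f x :> g' \<Longrightarrow> g = g'"
proof -
  assume "GDERIV f x :> g" "GDERIV f x :> g'"
  then have "(\<lambda>h. inner h g) = (\<lambda>h. inner h g')" unfolding gderiv_def by (rule has_derivative_unique)
  from fun_cong[OF this] show "g = g'" using vector_eq_ldot by blast
qed

lemma grad_eq: "GDERIV f x :> g \<Longrightarrow> grad f x = g"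
  unfolding grad_def by (rule the_equality) (auto intro: GDERIV_unique)

lemma hess_eq: "(grad f has_derivative f'') (at x) \<Longrightarrow> hess f x = f''"
  unfolding hess_def by (rule frechet_derivative_at[symmetric])

text \<open>The Hilbert-Schmidt norm dominates the operator norm, so Hilbert-Schmidt continuity of
  the Hessian gives joint continuity in point and direction.\<close>

lemma Cb2_imp_C2b:
  fixes f :: "'h::{real_inner, banach, second_countable_topology} \<Rightarrow> real"
  assumes f: "f \<in> Cb2"
  obtains C where "C2b C f (grad f) (hess f)"
proof -
  have gd: "GDERIV f x :> grad f x" for x
  proof -
    obtain g where "GDERIV f x :> g" using f unfolding Cb2_def by blast
    with grad_eq[OF this] show ?thesis by simp
  qed
  have hd: "(grad f has_derivative hess f x) (at x)" for x
    using f frechet_derivative_works unfolding Cb2_def hess_def by blast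
  have hs: "hilbert_schmidt (hess f x)" for x using f unfolding Cb2_def by blast
  obtain C0 where C0: "\<And>x. \<bar>f x\<bar> \<le> C0" using f unfolding Cb2_def bounded_iff by auto
  obtain C1 where C1: "\<And>x. norm (grad f x) \<le> C1" using f unfolding Cb2_def bounded_iff by auto
  obtain C2 where C2: "\<And>x. hs_norm (hess f x) \<le> C2" using f unfolding Cb2_def by auto
  define C where "C = max C0 (max C1 C2)"
  have hC: "norm (hess f x v) \<le> C * norm v" for x v
  proof -
    have "hs_norm (hess f x) \<le> C" using C2[of x] by (simp add: C_def)
    from order_trans[OF norm_le_hs_norm[OF hs] mult_right_mono[OF this]] show ?thesis by simp
  qed
  have "continuous_on UNIV (\<lambda>(x, v). hess f x v)"
    unfolding continuous_on_sequentially
  proof (intro allI ballI impI, elim conjE)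
    fix z :: "nat \<Rightarrow> 'h \<times> 'h" and p assume z: "z \<longlonglongrightarrow> p"
    define x v where "x n = fst (z n)" and "v n = snd (z n)" for n
    have x: "x \<longlonglongrightarrow> fst p" and v: "v \<longlonglongrightarrow> snd p"
      using tendsto_fst[OF z] tendsto_snd[OF z] by (simp_all add: x_def[abs_def] v_def[abs_def])
    let ?d = "\<lambda>y. hs_norm (\<lambda>h. hess f y h - hess f (fst p) h)"
    \<comment> \<open>\<open>Cb2\<close> gives a limit over the punctured neighbourhood. With the
      value 0 at the centre it becomes continuity, which also covers sequences that hit the
      centre.\<close>
    have "?d (fst p) = 0" by (simp add: hs_norm_def)
    moreover have "(?d \<longlongrightarrow> 0) (at (fst p))" using f unfolding Cb2_def by blast
    ultimately have "isCont ?d (fst p)" by (simp add: isCont_def)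
    then have d: "(\<lambda>n. ?d (x n)) \<longlonglongrightarrow> 0" using isCont_tendsto_compose[OF _ x] \<open>?d (fst p) = 0\<close> by fastforce
    have "(\<lambda>n. hess f (x n) (v n) - hess f (fst p) (snd p)) \<longlonglongrightarrow> 0"
    proof (rule Lim_null_comparison)
      show "(\<lambda>n. ?d (x n) * norm (v n) + C * norm (v n - snd p)) \<longlonglongrightarrow> 0"
        using tendsto_add[OF tendsto_mult[OF d tendsto_norm[OF v]] tendsto_mult[OF tendsto_const tendsto_norm_zero[OF LIM_zero[OF v]]], of C] by simp
      have "norm (hess f (x n) (v n) - hess f (fst p) (snd p)) \<le> ?d (x n) * norm (v n) + C * norm (v n - snd p)" for n
      proof -
        have "hess f (x n) (v n) - hess f (fst p) (snd p)
          = (hess f (x n) (v n) - hess f (fst p) (v n)) + hess f (fst p) (v n - snd p)"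
          by (simp add: linear_diff[OF has_derivative_linear[OF hd]])
        also have "norm \<dots> \<le> ?d (x n) * norm (v n) + C * norm (v n - snd p)"
          by (intro norm_triangle_mono hC norm_le_hs_norm[OF hilbert_schmidt_diff[OF hs hs]])
        finally show ?thesis .
      qed
      then show "\<forall>\<^sub>F n in sequentially. norm (hess f (x n) (v n) - hess f (fst p) (snd p)) \<le> ?d (x n) * norm (v n) + C * norm (v n - snd p)"
        by simp
    qed
    then show "((\<lambda>(x, v). hess f x v) \<circ> z) \<longlonglongrightarrow> (\<lambda>(x, v). hess f x v) p"
      by (simp add: x_def v_def LIM_zero_iff case_prod_beta' comp_def)
  qed
  moreover have "\<bar>f x\<bar> \<le> C" "norm (grad f x) \<le> C" for x using C0[of x] C1[of x] by (auto simp: C_def)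
  moreover have "(f has_derivative (\<lambda>v. inner (grad f x) v)) (at x)" for x
    using gd[of x] unfolding gderiv_def by (simp add: inner_commute)
  ultimately have "C2b C f (grad f) (hess f)" using hd hC unfolding C2b_def by blast
  then show ?thesis by (rule that)
qed

context ou_setting
begin

text \<open>For each outcome the normalised remainder tends to 0, and the mean value inequality
  bounds it by \<open>2 * C * K\<close>; dominated convergence along sequences gives the Frechet
  derivative. The values lie in a general Banach space so that the lemma serves for \<open>f\<close>
  and for its gradient.\<close>

lemma flow_expectation_has_derivative:
  fixes g :: "'h \<Rightarrow> 'b::{banach, second_countable_topology}"
  assumes s: "s \<ge> 0" and g: "\<And>z. (g has_derivative g' z) (at z)" and B: "\<And>z. norm (g z) \<le> B"
    and C: "\<And>z v. norm (g' z v) \<le> C * norm v" and g'c: "\<And>v. continuous_on UNIV (\<lambda>z. g' z v)"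
  shows "((\<lambda>x. \<integral>\<omega>. g (T s x + Y s \<omega>) \<partial>M) has_derivative (\<lambda>v. \<integral>\<omega>. g' (T s x + Y s \<omega>) (T s v) \<partial>M)) (at x)"
proof -
  interpret Ts: bounded_linear "T s" by (rule T_bounded_linear[OF s])
  obtain K where K: "K > 0" "\<And>x. norm (T s x) \<le> K * norm x" using c0_bound[OF T_c0, of s] s by auto
  have lin: "linear (g' z)" for z by (rule has_derivative_linear[OF g])
  obtain C where C: "\<And>z v. norm (g' z v) \<le> C * norm v" "C \<ge> 0"
  proof (rule that[of "max 0 C"])
    show "norm (g' z v) \<le> max 0 C * norm v" for z v
      using C[of z v] mult_right_mono[of C "max 0 C" "norm v"] by simp
  qed simp
  have gc: "continuous_on UNIV g"
    by (auto simp: continuous_on_eq_continuous_at intro: has_derivative_continuous[OF g])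
  have gi: "integrable M (\<lambda>\<omega>. g (T s y + Y s \<omega>))" for y
  proof (rule integrable_const_bound[where B = B])
    show "(\<lambda>\<omega>. g (T s y + Y s \<omega>)) \<in> borel_measurable M"
      using s by (intro measurable_compose[OF _ borel_measurable_continuous_onI[OF gc]]) measurable
  qed (simp add: B)
  have g'm: "(\<lambda>\<omega>. g' (T s y + Y s \<omega>) v) \<in> borel_measurable M" for y v
    using s by (intro measurable_compose[OF _ borel_measurable_continuous_onI[OF g'c]]) measurable
  have g'i: "integrable M (\<lambda>\<omega>. g' (T s y + Y s \<omega>) v)" for y v
    by (rule integrable_const_bound[where B = "C * norm v"]) (simp_all add: g'm C)
  have lip: "norm (g y - g z) \<le> C * norm (y - z)" for y z
    by (rule differentiable_bound[where S = UNIV and f' = g']) (auto intro: g onorm_bound C)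
  let ?F = "\<lambda>x. \<integral>\<omega>. g (T s x + Y s \<omega>) \<partial>M" and ?F' = "\<lambda>v. \<integral>\<omega>. g' (T s x + Y s \<omega>) (T s v) \<partial>M"
  have "bounded_linear ?F'"
  proof (rule bounded_linear_intro[where K = "C * K"])
    show "?F' (u + v) = ?F' u + ?F' v" for u v by (simp add: Ts.add linear_add[OF lin] g'i)
    show "?F' (r *\<^sub>R v) = r *\<^sub>R ?F' v" for r v by (simp add: Ts.scale linear_scale[OF lin])
    show "norm (?F' v) \<le> norm v * (C * K)" for v
    proof (rule integral_norm_le)
      show "norm (g' (T s x + Y s \<omega>) (T s v)) \<le> norm v * (C * K)" for \<omega>
        using C(1)[of "T s x + Y s \<omega>" "T s v"] mult_left_mono[OF K(2)[of v] C(2)] by (simp add: mult_ac)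
    qed
  qed
  moreover have "((\<lambda>y. norm ((?F y - ?F x) - ?F' (y - x)) / norm (y - x)) \<longlongrightarrow> 0) (at x)"
    unfolding tendsto_at_iff_sequentially
  proof (intro allI impI)
    fix X assume X: "\<forall>i. X i \<in> UNIV - {x}" "X \<longlonglongrightarrow> x"
    define R where "R n \<omega> = ((g (T s (X n) + Y s \<omega>) - g (T s x + Y s \<omega>)) - g' (T s x + Y s \<omega>) (T s (X n - x))) /\<^sub>R norm (X n - x)" for n \<omega>
    have R0: "(\<lambda>n. R n \<omega>) \<longlonglongrightarrow> 0" for \<omega>
    proof -
      have "((\<lambda>y. T s y + Y s \<omega>) has_derivative T s) (at x)"
        by (rule has_derivative_eq_rhs[OF has_derivative_add[OF bounded_linear_imp_has_derivative[OF Ts.bounded_linear_axioms] has_derivative_const]]) simp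
      then have "((\<lambda>y. g (T s y + Y s \<omega>)) has_derivative (\<lambda>v. g' (T s x + Y s \<omega>) (T s v))) (at x)"
        by (rule has_derivative_compose) (rule g)
      then have "((\<lambda>y. norm ((g (T s y + Y s \<omega>) - g (T s x + Y s \<omega>)) - g' (T s x + Y s \<omega>) (T s (y - x))) / norm (y - x)) \<longlongrightarrow> 0) (at x)"
        unfolding has_derivative_iff_norm by blast
      then have "(\<lambda>n. norm (R n \<omega>)) \<longlonglongrightarrow> 0"
        using X unfolding tendsto_at_iff_sequentially R_def comp_def by (simp add: divide_inverse mult.commute)
      then show ?thesis by (rule tendsto_norm_zero_cancel)
    qed
    have Rb: "norm (R n \<omega>) \<le> 2 * C * K" for n \<omega>
    proof -
      have "X n \<noteq> x" using X(1) by auto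
      have "norm (T s (X n - x)) \<le> K * norm (X n - x)" by (rule K)
      then have KC: "C * norm (T s (X n - x)) \<le> C * K * norm (X n - x)" using C(2) mult_left_mono by fastforce
      have "norm (g (T s (X n) + Y s \<omega>) - g (T s x + Y s \<omega>)) \<le> C * norm (T s (X n - x))"
        using lip[of "T s (X n) + Y s \<omega>" "T s x + Y s \<omega>"] by (simp add: Ts.diff)
      from norm_triangle_le_diff[OF add_mono[OF this C(1)[of "T s x + Y s \<omega>" "T s (X n - x)"]]]
      have "norm ((g (T s (X n) + Y s \<omega>) - g (T s x + Y s \<omega>)) - g' (T s x + Y s \<omega>) (T s (X n - x))) \<le> 2 * C * K * norm (X n - x)"
        using KC by linarith
      then show ?thesis using \<open>X n \<noteq> x\<close> by (simp add: R_def divide_le_eq flip: divide_inverse_commute)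
    qed
    have "(\<lambda>n. \<integral>\<omega>. R n \<omega> \<partial>M) \<longlonglongrightarrow> (\<integral>\<omega>. 0 \<partial>M)"
    proof (rule tendsto_expectation[OF _ _ R0 Rb])
      show "R n \<in> borel_measurable M" for n
        unfolding R_def using g'm borel_measurable_integrable[OF gi] by measurable
    qed simp
    then have "(\<lambda>n. norm (\<integral>\<omega>. R n \<omega> \<partial>M)) \<longlonglongrightarrow> 0" by (simp add: tendsto_norm_zero)
    moreover have "norm (\<integral>\<omega>. R n \<omega> \<partial>M) = norm ((?F (X n) - ?F x) - ?F' (X n - x)) / norm (X n - x)" for n
      unfolding R_def by (simp add: gi g'i divide_inverse mult.commute)
    ultimately show "((\<lambda>y. norm ((?F y - ?F x) - ?F' (y - x)) / norm (y - x)) \<circ> X) \<longlonglongrightarrow> 0"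
      by (simp add: comp_def)
  qed
  ultimately show ?thesis unfolding has_derivative_iff_norm by blast
qed

section \<open>The operators \<open>L1\<close> and \<open>L0\<close> applied to
  \<open>P s f\<close>\<close>

context
  fixes C :: real and f :: "'h \<Rightarrow> real" and f' :: "'h \<Rightarrow> 'h" and f'' :: "'h \<Rightarrow> 'h \<Rightarrow> 'h"
  assumes f: "C2b C f f' f''"
begin

lemma C2b_integrable:
  assumes "s \<ge> 0"
  shows "integrable M (\<lambda>\<omega>. f' (T s x + Y s \<omega>))" "integrable M (\<lambda>\<omega>. f'' (T s x + Y s \<omega>) v)"
proof -
  note D = C2bD[OF f]
  have "(\<lambda>\<omega>. h (T s x + Y s \<omega>)) \<in> borel_measurable M" if "continuous_on UNIV h" for h :: "'h \<Rightarrow> 'h"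
    using assms by (intro measurable_compose[OF _ borel_measurable_continuous_onI[OF that]]) measurable
  note m = this
  show "integrable M (\<lambda>\<omega>. f' (T s x + Y s \<omega>))"
    by (rule integrable_const_bound[where B = C]) (use D(5) in \<open>auto intro!: m D continuous_intros\<close>)
  show "integrable M (\<lambda>\<omega>. f'' (T s x + Y s \<omega>) v)"
    by (rule integrable_const_bound[where B = "C * norm v"]) (use D(6) in \<open>auto intro!: m D continuous_intros\<close>)
qed

lemma grad_P:
  assumes "s \<ge> 0"
  shows "grad (P s f) x = hadj (T s) (\<integral>\<omega>. f' (T s x + Y s \<omega>) \<partial>M)"
proof (rule grad_eq)
  note D = C2bD[OF f]
  have "(P s f has_derivative (\<lambda>v. \<integral>\<omega>. inner (f' (T s x + Y s \<omega>)) (T s v) \<partial>M)) (at x)"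
    unfolding ou_semigroup_def[abs_def]
  proof (rule flow_expectation_has_derivative[OF assms D(1)])
    show "norm (inner (f' z) v) \<le> C * norm v" for z v
      using Cauchy_Schwarz_ineq2[of "f' z" v] mult_right_mono[OF D(5)[of z], of "norm v"] by simp
  qed (use D(4) in \<open>auto intro!: continuous_intros D\<close>)
  moreover have "(\<integral>\<omega>. inner (f' (T s x + Y s \<omega>)) (T s v) \<partial>M) = inner v (hadj (T s) (\<integral>\<omega>. f' (T s x + Y s \<omega>) \<partial>M))" for v
    using C2b_integrable(1)[OF assms] inner_hadj[OF T_bounded_linear[OF assms], symmetric]
    by (simp add: inner_commute[of _ "T s v"])
  ultimately show "GDERIV (P s f) x :> hadj (T s) (\<integral>\<omega>. f' (T s x + Y s \<omega>) \<partial>M)"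
    unfolding gderiv_def by simp
qed

lemma hess_P:
  assumes "s \<ge> 0"
  shows "hess (P s f) x = (\<lambda>v. hadj (T s) (\<integral>\<omega>. f'' (T s x + Y s \<omega>) (T s v) \<partial>M))"
proof (rule hess_eq)
  note D = C2bD[OF f]
  have "((\<lambda>x. \<integral>\<omega>. f' (T s x + Y s \<omega>) \<partial>M) has_derivative (\<lambda>v. \<integral>\<omega>. f'' (T s x + Y s \<omega>) (T s v) \<partial>M)) (at x)"
    by (rule flow_expectation_has_derivative[OF assms D(2) D(5) D(6)]) (intro continuous_intros D)
  from bounded_linear.has_derivative[OF bounded_linear_hadj[OF T_bounded_linear[OF assms]] this]
  show "(grad (P s f) has_derivative (\<lambda>v. hadj (T s) (\<integral>\<omega>. f'' (T s x + Y s \<omega>) (T s v) \<partial>M))) (at x)"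
    unfolding grad_P[OF assms, abs_def] .
qed

lemma inner_grad_P:
  assumes "s \<ge> 0"
  shows "inner v (grad (P s f) x) = Pd1 (\<lambda>z v. inner (f' z) v) s x v"
  using C2b_integrable(1)[OF assms] inner_hadj[OF T_bounded_linear[OF assms], symmetric]
  unfolding grad_P[OF assms] Pd1_def by (simp add: inner_commute[of _ "T s v"])

text \<open>Converts the trace over the basis into the series in \<open>qa\<close> and
  \<open>qb\<close>. Moving the adjoint of \<open>T s\<close> across the inner product turns the
  Hessian of \<open>P s f\<close> into \<open>Pd2\<close>.\<close>

lemma L1_P:
  assumes s: "s \<ge> 0"
  shows "L1 Q a \<nu> (P s f) x = gen1 f (\<lambda>z v. inner (f' z) v) (\<lambda>z v w. inner (f'' z w) v) s x"
proof -
  have "(grad (P s f) has_derivative hess (P s f) x) (at x)"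
    using hess_P[OF s, of x] bounded_linear.has_derivative[OF bounded_linear_hadj[OF T_bounded_linear[OF s]]
      flow_expectation_has_derivative[OF s C2bD(2,5,6)[OF f]]]
    unfolding grad_P[OF s, abs_def] by (simp add: C2bD(10)[OF f] continuous_intros)
  then have "bounded_linear (hess (P s f) x)" by (rule has_derivative_bounded_linear)
  then have "op_trace (Q \<circ> hess (P s f) x) = (\<Sum>j. inner (qa j) (hess (P s f) x (qb j)))"
    by (rule op_trace_nuclear[OF Q_summable Q_sums])
  moreover have "inner u (hess (P s f) x v) = Pd2 (\<lambda>z v w. inner (f'' z w) v) s x u v" for u v
    using C2b_integrable(2)[OF s] inner_hadj[OF T_bounded_linear[OF s], symmetric]
    unfolding hess_P[OF s] Pd2_def by (simp add: inner_commute[of _ "T s u"])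
  ultimately show ?thesis
    unfolding L1_def gen1_def Pjump_def inner_grad_P[OF s] by simp
qed

lemma L0_P:
  assumes "s \<ge> 0"
  shows "L0 A Q a \<nu> (P s f) x = gen0 f (\<lambda>z v. inner (f' z) v) (\<lambda>z v w. inner (f'' z w) v) s x"
  unfolding L0_def gen0_def L1_P[OF assms] inner_grad_P[OF assms] ..

lemma dynkin_formula:
  assumes "x \<in> DA" "t \<ge> 0"
  shows "((\<lambda>s. gen0 f (\<lambda>z v. inner (f' z) v) (\<lambda>z v w. inner (f'' z w) v) s x) has_integral (P t f x - f x)) {0..t}"
proof -
  obtain D p q where j: "jet2 D f p q"
    and I: "((\<lambda>s. gen0 f p q s x) has_integral (P t f x - f x)) {0..t}"
    using dynkin_C2b[OF assms(1) f] assms(2) unfolding dynkin_def by blast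
  from I show ?thesis unfolding jet2_unique[OF C2b_jet2[OF f] j] .
qed

text \<open>On the domain this is the integral formula over the degenerate interval; density and
  continuity in space extend it to every point.\<close>

lemma P_0: "P 0 f = f"
proof
  fix x
  obtain X where X: "\<And>n::nat. X n \<in> DA" "X \<longlonglongrightarrow> x" using generator_dense[OF A_gen, of x] by blast
  have "P 0 f (X n) = f (X n)" for n
    using integral_unique[OF dynkin_formula[OF X(1) order_refl], of n] by simp
  moreover have "(\<lambda>n. P 0 f (X n)) \<longlonglongrightarrow> P 0 f x"
    using gen1_continuous(1)[OF f tendsto_const[of 0] _ _ X(2)] by simp
  moreover have "(\<lambda>n. f (X n)) \<longlonglongrightarrow> f x"
    by (rule continuous_on_tendsto_compose[OF C2bD(8)[OF f continuous_on_id[of UNIV]] X(2)]) auto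
  ultimately show "P 0 f x = f x" using LIMSEQ_unique by simp
qed

section \<open>Continuity, the limit at 0 and the integral formula\<close>

lemma kolmogorov_domain:
  assumes x: "x \<in> DA"
  shows "continuous_on {0..} (\<lambda>t. L0 A Q a \<nu> (P t f) x)"
    and "((\<lambda>t. L0 A Q a \<nu> (P t f) x) \<longlongrightarrow> L0 A Q a \<nu> f x) (at_right 0)"
    and "t \<ge> 0 \<Longrightarrow> P t f x = f x + integral {0..t} (\<lambda>s. L0 A Q a \<nu> (P s f) x)"
proof -
  show cont: "continuous_on {0..} (\<lambda>t. L0 A Q a \<nu> (P t f) x)"
    unfolding continuous_on_sequentially
  proof (intro allI ballI impI, elim conjE)
    fix s :: "nat \<Rightarrow> real" and t assume *: "t \<in> {0..}" "\<forall>n. s n \<in> {0..}" "s \<longlonglongrightarrow> t"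
    then have s: "s n \<ge> 0" and t: "t \<ge> 0" for n by auto
    show "((\<lambda>t. L0 A Q a \<nu> (P t f) x) \<circ> s) \<longlonglongrightarrow> L0 A Q a \<nu> (P t f) x"
      unfolding comp_def L0_P[OF s] L0_P[OF t] gen0_def
      by (intro tendsto_add gen1_continuous(2,3)[OF f *(3) s t tendsto_const])
  qed
  have "((\<lambda>t. L0 A Q a \<nu> (P t f) x) \<longlongrightarrow> L0 A Q a \<nu> (P 0 f) x) (at 0 within {0..})"
    using cont by (auto simp: continuous_on_def)
  then show "((\<lambda>t. L0 A Q a \<nu> (P t f) x) \<longlongrightarrow> L0 A Q a \<nu> f x) (at_right 0)"
    unfolding P_0 by (rule tendsto_within_subset) auto
  show "P t f x = f x + integral {0..t} (\<lambda>s. L0 A Q a \<nu> (P s f) x)" if t: "t \<ge> 0"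
  proof -
    have "integral {0..t} (\<lambda>s. L0 A Q a \<nu> (P s f) x) = P t f x - f x"
      by (rule integral_unique[OF has_integral_eq[OF _ dynkin_formula[OF x t]]]) (simp add: L0_P)
    then show ?thesis by simp
  qed
qed

text \<open>Density of the domain makes the representing vector unique, so the definite description
  in \<open>adj_op\<close> picks it.\<close>

lemma adj_op_eqI:
  assumes "\<And>y. y \<in> DA \<Longrightarrow> inner (A y) z = inner y w"
  shows "adj_op DA A z = w"
  unfolding adj_op_def
proof (rule the_equality)
  fix w' assume w': "\<forall>y\<in>DA. inner (A y) z = inner y w'"
  obtain X where X: "\<And>n::nat. X n \<in> DA" "X \<longlonglongrightarrow> w' - w" using generator_dense[OF A_gen] by blast
  have "inner (X n) (w' - w) = 0" for n using assms[OF X(1)] w' X(1) by (simp add: inner_diff_right)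
  moreover have "(\<lambda>n. inner (X n) (w' - w)) \<longlonglongrightarrow> inner (w' - w) (w' - w)"
    by (intro tendsto_inner X tendsto_const)
  ultimately show "w' = w" by (simp add: LIMSEQ_const_iff)
qed (use assms in blast)

text \<open>Moving \<open>A\<close> from the point to the gradient replaces the drift term by
  \<open>H s y\<close>, which is defined and jointly continuous for all \<open>y\<close> and agrees
  with the old drift on the domain. The formula on the domain then passes to the limit along domain
  points \<open>X n\<close> tending to \<open>x\<close>.\<close>

lemma kolmogorov_everywhere:
  fixes x :: 'h
  assumes dom: "\<And>z. f' z \<in> adj_dom DA A" and cont: "continuous_on UNIV (\<lambda>z. adj_op DA A (f' z))"
    and B: "\<And>z. norm (adj_op DA A (f' z)) \<le> B"
  shows "continuous_on {0..} (\<lambda>t. L0_ext DA A Q a \<nu> (P t f) x)"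
    and "((\<lambda>t. L0_ext DA A Q a \<nu> (P t f) x) \<longlongrightarrow> L0_ext DA A Q a \<nu> f x) (at_right 0)"
    and "t \<ge> 0 \<Longrightarrow> P t f x = f x + integral {0..t} (\<lambda>s. L0_ext DA A Q a \<nu> (P s f) x)"
proof -
  define h where "h z = adj_op DA A (f' z)" for z
  have hc: "continuous_on UNIV h" and hB: "norm (h z) \<le> B" for z using cont B by (simp_all add: h_def[abs_def])
  have adj: "inner (A y) (f' z) = inner y (h z)" if "y \<in> DA" for y z
  proof -
    obtain w where "\<And>y. y \<in> DA \<Longrightarrow> inner (A y) (f' z) = inner y w" using dom[of z] unfolding adj_dom_def by blast
    then show ?thesis using adj_op_eqI[of "f' z" w] that by (simp add: h_def)
  qed
  let ?p = "\<lambda>z v. inner (f' z) v" and ?q = "\<lambda>z v w. inner (f'' z w) v"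
  have hi: "integrable M (\<lambda>\<omega>. h (T s y + Y s \<omega>))" if "s \<ge> 0" for s y
  proof (rule integrable_const_bound[where B = B])
    show "(\<lambda>\<omega>. h (T s y + Y s \<omega>)) \<in> borel_measurable M"
      using that by (intro measurable_compose[OF _ borel_measurable_continuous_onI[OF hc]]) measurable
  qed (simp add: hB)
  \<comment> \<open>\<open>T s\<close> preserves the domain and commutes with \<open>A\<close>, so
    the adjoint relation for \<open>f'\<close> at \<open>T s z\<close> transfers to the gradient of
    \<open>P s f\<close>.\<close>
  have adjP: "adj_op DA A (grad (P s f) y) = hadj (T s) (\<integral>\<omega>. h (T s y + Y s \<omega>) \<partial>M)" if s: "s \<ge> 0" for s y
  proof (rule adj_op_eqI)
    fix z assume z: "z \<in> DA"
    note TA = generator_commute[OF A_gen z s]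
    have "inner (A z) (grad (P s f) y) = (\<integral>\<omega>. inner (A (T s z)) (f' (T s y + Y s \<omega>)) \<partial>M)"
      unfolding inner_grad_P[OF s] Pd1_def TA(2) by (simp add: inner_commute)
    also have "\<dots> = (\<integral>\<omega>. inner (T s z) (h (T s y + Y s \<omega>)) \<partial>M)" by (simp add: adj[OF TA(1)])
    also have "\<dots> = inner z (hadj (T s) (\<integral>\<omega>. h (T s y + Y s \<omega>) \<partial>M))"
      using hi[OF s] by (simp add: inner_hadj[OF T_bounded_linear[OF s], symmetric])
    finally show "inner (A z) (grad (P s f) y) = inner z (hadj (T s) (\<integral>\<omega>. h (T s y + Y s \<omega>) \<partial>M))" .
  qed
  define H where "H s y = (\<integral>\<omega>. inner (h (T s y + Y s \<omega>)) (T s y) \<partial>M)" for s y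
  have ext: "L0_ext DA A Q a \<nu> (P s f) y = H s y + gen1 f ?p ?q s y" if s: "s \<ge> 0" for s y
    unfolding L0_ext_def L1_P[OF s] adjP[OF s] H_def
    using hi[OF s, of y] by (simp add: inner_hadj[OF T_bounded_linear[OF s], symmetric] inner_commute[of _ "T s y"])
  have dom_ext: "L0_ext DA A Q a \<nu> (P s f) y = gen0 f ?p ?q s y" if s: "s \<ge> 0" and y: "y \<in> DA" for s y
  proof -
    note TA = generator_commute[OF A_gen y s]
    have "inner (h z) (T s y) = inner (f' z) (A (T s y))" for z
      using adj[OF TA(1), of z] by (simp only: inner_commute)
    then have "H s y = Pd1 ?p s y (A y)"
      unfolding H_def Pd1_def TA(2)[symmetric] by simp
    then show ?thesis unfolding ext[OF s] gen0_def by simp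
  qed
  have H_tendsto: "(\<lambda>n. H (s n) (y n)) \<longlonglongrightarrow> H s' y'"
    if s: "s \<longlonglongrightarrow> s'" "\<And>n. s n \<ge> 0" "s' \<ge> 0" and y: "y \<longlonglongrightarrow> y'" for s s' y y'
    unfolding H_def
  proof (rule flow_tendsto_perturbed[OF s y])
    have cs: "\<bar>inner (h z) v\<bar> \<le> B * norm v" for z v
      using Cauchy_Schwarz_ineq2[of "h z" v] mult_right_mono[OF hB[of z], of "norm v"] by simp
    show "\<bar>inner (h z) (T s' y')\<bar> \<le> B * norm (T s' y')" for z by (rule cs)
    show "\<bar>inner (h z) (T (s n) (y n)) - inner (h z) (T s' y')\<bar> \<le> B * norm (T (s n) (y n) - T s' y')" for n z
      using cs[of z "T (s n) (y n) - T s' y'"] by (simp add: inner_diff_right)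
    have "(\<lambda>n. norm (T (s n) (y n) - T s' y')) \<longlonglongrightarrow> 0"
      using T_tendsto[OF s(1) _ s(3) y] s(2) by (simp add: LIM_zero tendsto_norm_zero)
    from tendsto_mult[OF tendsto_const this, of B]
    show "(\<lambda>n. B * norm (T (s n) (y n) - T s' y')) \<longlonglongrightarrow> 0" by simp
  qed (intro continuous_intros hc)+
  have ext_tendsto: "(\<lambda>n. L0_ext DA A Q a \<nu> (P (s n) f) (y n)) \<longlonglongrightarrow> L0_ext DA A Q a \<nu> (P s' f) y'"
    if s: "s \<longlonglongrightarrow> s'" "\<And>n. s n \<ge> 0" "s' \<ge> 0" and y: "y \<longlonglongrightarrow> y'" for s s' y y'
    unfolding ext[OF s(2)] ext[OF s(3)] by (intro tendsto_add H_tendsto gen1_continuous(3)[OF f] s y)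
  show c: "continuous_on {0..} (\<lambda>t. L0_ext DA A Q a \<nu> (P t f) x)"
    unfolding continuous_on_sequentially comp_def by (auto intro!: ext_tendsto)
  have "((\<lambda>t. L0_ext DA A Q a \<nu> (P t f) x) \<longlongrightarrow> L0_ext DA A Q a \<nu> (P 0 f) x) (at 0 within {0..})"
    using c by (auto simp: continuous_on_def)
  then show "((\<lambda>t. L0_ext DA A Q a \<nu> (P t f) x) \<longlongrightarrow> L0_ext DA A Q a \<nu> f x) (at_right 0)"
    unfolding P_0 by (rule tendsto_within_subset) auto
  show "P t f x = f x + integral {0..t} (\<lambda>s. L0_ext DA A Q a \<nu> (P s f) x)" if t: "t \<ge> 0"
  proof -
    obtain X where X: "\<And>n::nat. X n \<in> DA" "X \<longlonglongrightarrow> x" using generator_dense[OF A_gen, of x] by blast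
    obtain D where D: "\<And>n. norm (X n) \<le> D" using convergent_imp_bounded[OF X(2)] unfolding bounded_iff by auto
    obtain K where K: "K > 0" "\<And>s y. s \<in> {0..t} \<Longrightarrow> norm (T s y) \<le> K * norm y"
      using c0_bound[OF T_c0, of t] by blast
    \<comment> \<open>The bound on \<open>gen1\<close> is uniform in the space point, so it holds
      for all \<open>X n\<close> at once. A bound on \<open>gen0\<close> would involve
      \<open>norm (A (X n))\<close>, which need not stay bounded.\<close>
    obtain E where E: "\<And>s y. s \<in> {0..t} \<Longrightarrow> \<bar>gen1 f ?p ?q s y\<bar> \<le> 2 * C * E"
      by (rule gen_bound[of t x]) (use C2b_jet2[OF f] in blast)
    have B0: "B \<ge> 0" using order_trans[OF norm_ge_zero hB[of 0]] .
    have "((\<lambda>s. L0_ext DA A Q a \<nu> (P s f) x) has_integral P t f x - f x) {0..t}"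
    proof (rule has_integral_dominated_convergence)
      show "((\<lambda>s. L0_ext DA A Q a \<nu> (P s f) (X n)) has_integral P t f (X n) - f (X n)) {0..t}" for n
        by (rule has_integral_eq[OF _ dynkin_formula[OF X(1) t]]) (simp add: dom_ext X(1))
      show "(\<lambda>s. B * (K * D) + 2 * C * E) integrable_on {0..t}" by (rule integrable_const_ivl)
      show "\<forall>s\<in>{0..t}. norm (L0_ext DA A Q a \<nu> (P s f) (X n)) \<le> B * (K * D) + 2 * C * E" for n
      proof
        fix s assume s: "s \<in> {0..t}"
        have "norm (H s (X n)) \<le> B * (K * D)"
          unfolding H_def
        proof (rule integral_norm_le)
          fix \<omega>
          have "norm (T s (X n)) \<le> K * D" using K(2)[OF s, of "X n"] mult_left_mono[OF D[of n]] K(1) by (meson less_imp_le order_trans)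
          then show "norm (inner (h (T s (X n) + Y s \<omega>)) (T s (X n))) \<le> B * (K * D)"
            unfolding real_norm_def using hB B0
            by (intro order_trans[OF Cauchy_Schwarz_ineq2] mult_mono) auto
        qed
        moreover have "L0_ext DA A Q a \<nu> (P s f) (X n) = H s (X n) + gen1 f ?p ?q s (X n)" using s by (intro ext) simp
        ultimately show "norm (L0_ext DA A Q a \<nu> (P s f) (X n)) \<le> B * (K * D) + 2 * C * E"
          using E[OF s, of "X n"] by simp
      qed
      show "\<forall>s\<in>{0..t}. (\<lambda>n. L0_ext DA A Q a \<nu> (P s f) (X n)) \<longlonglongrightarrow> L0_ext DA A Q a \<nu> (P s f) x"
        by (auto intro!: ext_tendsto X)
      show "(\<lambda>n. P t f (X n) - f (X n)) \<longlonglongrightarrow> P t f x - f x"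
        using gen1_continuous(1)[OF f tendsto_const[of t] _ _ X(2)] t
        by (intro tendsto_diff continuous_on_tendsto_compose[OF C2bD(8)[OF f continuous_on_id[of UNIV]] X(2)]) auto
    qed
    then show ?thesis by (simp add: integral_unique)
  qed
qed

end

end

theorem theorem5p1:
  fixes Q A :: "'h::{real_inner, banach, second_countable_topology} \<Rightarrow> 'h"
    and DA :: "'h set"
    and a :: 'h
    and \<nu> :: "'h measure"
    and T :: "real \<Rightarrow> 'h \<Rightarrow> 'h"
    and M :: "'w measure"
    and Z Y :: "real \<Rightarrow> 'w \<Rightarrow> 'h"
    and f :: "'h \<Rightarrow> real"
  assumes Q_trace: "trace_class Q"
    and Q_sym: "\<forall>x y. inner (Q x) y = inner x (Q y)"
    and Q_nonneg: "\<forall>x. inner (Q x) x \<ge> 0"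
    and nu_sets: "sets \<nu> = sets borel"
    and nu_sigma_finite: "sigma_finite_measure \<nu>"
    and nu_0: "emeasure \<nu> {0} = 0"
    and nu_int: "(\<integral>\<^sup>+y. ennreal (min 1 ((norm y)\<^sup>2)) \<partial>\<nu>) < \<infinity>"
    and Z_levy: "levy_process M Z"
    and Z_char: "\<forall>t\<ge>0. \<forall>h. (\<integral>\<omega>. exp (\<i> * of_real (inner (Z t \<omega>) h)) \<partial>M)
                   = exp (- of_real t * levy_exponent Q a \<nu> h)"
    and A_gen: "generates DA A T"
    and Y_conv: "\<forall>t\<ge>0. stoch_convolution M T Z t (Y t)"
    and f: "f \<in> Cb2"
  shows "(\<forall>x\<in>DA.
            continuous_on {0..} (\<lambda>t. L0 A Q a \<nu> (ou_semigroup M T Y t f) x) \<and>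
            ((\<lambda>t. L0 A Q a \<nu> (ou_semigroup M T Y t f) x) \<longlongrightarrow> L0 A Q a \<nu> f x) (at_right 0) \<and>
            (\<forall>t\<ge>0. ou_semigroup M T Y t f x
               = f x + integral {0..t} (\<lambda>s. L0 A Q a \<nu> (ou_semigroup M T Y s f) x)))
       \<and> (f \<in> CA2 DA A \<longrightarrow>
           (\<forall>x.
            continuous_on {0..} (\<lambda>t. L0_ext DA A Q a \<nu> (ou_semigroup M T Y t f) x) \<and>
            ((\<lambda>t. L0_ext DA A Q a \<nu> (ou_semigroup M T Y t f) x)
               \<longlongrightarrow> L0_ext DA A Q a \<nu> f x) (at_right 0) \<and>
            (\<forall>t\<ge>0. ou_semigroup M T Y t f x
               = f x + integral {0..t} (\<lambda>s. L0_ext DA A Q a \<nu> (ou_semigroup M T Y s f) x))))"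
proof -
  obtain qa qb :: "nat \<Rightarrow> 'h" where q: "summable (\<lambda>k. norm (qa k) * norm (qb k))"
    "\<And>x. (\<lambda>k. inner (qa k) x *\<^sub>R qb k) sums Q x"
    using Q_trace unfolding trace_class_def by blast
  interpret ou_setting Q A DA a \<nu> T M Z Y qa qb
    by unfold_locales (use q nu_sets nu_int Z_levy Z_char A_gen Y_conv in blast)+
  obtain C where C: "C2b C f (grad f) (hess f)" using Cb2_imp_C2b[OF f] .
  show ?thesis
  proof (intro conjI ballI impI allI)
    fix x assume CA: "f \<in> CA2 DA A"
    then obtain B where B: "\<And>z. norm (adj_op DA A (grad f z)) \<le> B"
      unfolding CA2_def bounded_iff by auto
    have dom: "\<And>z. grad f z \<in> adj_dom DA A" and cont: "continuous_on UNIV (\<lambda>z. adj_op DA A (grad f z))"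
      using CA unfolding CA2_def by auto
    note K = kolmogorov_everywhere[OF C dom cont B]
    show "continuous_on {0..} (\<lambda>t. L0_ext DA A Q a \<nu> (ou_semigroup M T Y t f) x)"
      "((\<lambda>t. L0_ext DA A Q a \<nu> (ou_semigroup M T Y t f) x) \<longlongrightarrow> L0_ext DA A Q a \<nu> f x) (at_right 0)"
      "\<And>t. t \<ge> 0 \<Longrightarrow> ou_semigroup M T Y t f x = f x + integral {0..t} (\<lambda>s. L0_ext DA A Q a \<nu> (ou_semigroup M T Y s f) x)"
      by (rule K; assumption?)+
  qed (use kolmogorov_domain[OF C] in blast)+
qed

end
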